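(* There exist positive integers $p,m_1,\ldots,m_p$, a translation-admissible tropical variety $\Gamma\subset\mathbb R^{m_1}\times\cdots\times\mathbb R^{m_p}$ that is connected in codimension one, and a sequence $\underline\Lambda=\Lambda_1,\ldots,\Lambda_p$ of positive tropical divisors $\Lambda_i\subset\mathbb R^{m_i}$, such that the tropical volume polynomial $\mathrm{tvol}_{\Gamma,\underline\Lambda}(t_1,\ldots,t_p)$ is not Lorentzian.
   Context: Notation. $\mathbb N=\{0,1,2,\ldots\}$, $[p]=\{1,\ldots,p\}$, $N=\mathbb Z^{m_1+\cdots+m_p}$, $N_{\mathbb R}=N\otimes\mathbb R=\mathbb R^{m_1}\times\cdots\times\mathbb R^{m_p}$, $\Pi_i:N_{\mathbb R}\to\mathbb R^{m_i}$ the natural projection, $|\mathbf n|=\sum_in_i$. Tropical varieties. A tropical variety of dimension $d$ in $N_{\mathbb R}$ is a finite rational polyhedral complex $\Gamma$, pure of dimension $d$ (in particular nonempty), with positive integer weights $\omega_\Gamma$ on its facets ($d$-dimensional cells), balanced: for every $(d-1)$-dimensional cell $\tau$, $\sum_{\sigma\supset\tau}\omega_\Gamma(\sigma)\mathbf v_{\sigma/\tau}=0$ in $N_{\mathbb R}/(N_\tau)_{\mathbb R}$, the sum being over facets $\sigma\supset\tau$, where $N_\tau$ and $(N_\tau)_{\mathbb R}$ are the lattice and linear space parallel to $\tau$ and $\mathbf v_{\sigma/\tau}$ is the primitive integer generator of $\sigma$ modulo $\tau$. Its support is the union of its cells; one works up to refinement. A tropical divisor has codimension $1$; a tropical curve has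 dimension $1$. The stable intersection $\Gamma\cap_{\mathrm{st}}\Gamma'$ is the limit as $\varepsilon\to0^+$ of $\Gamma\cap(\Gamma'+\varepsilon\mathbf v)$ for generic $\mathbf v$ (a transverse intersection), with weight $\omega_\Gamma(\sigma)\omega_{\Gamma'}(\sigma')[N:N_\sigma+N_{\sigma'}]$ on the facet $\sigma\cap(\sigma'+\varepsilon\mathbf v)$ (weights of facets with the same limit are added). The degree of a $0$-dimensional tropical variety is the sum of its weights ($0$ if empty). A tropical divisor $\Lambda_i\subset\mathbb R^{m_i}$ is positive if $\deg(\Lambda_i\cap_{\mathrm{st}}C)>0$ for every tropical curve $C\subset\mathbb R^{m_i}$. For $|\mathbf n|=d=\dim\Gamma$, $\deg^{\mathbf n}_{\underline\Lambda}(\Gamma)=\deg(\Gamma\cap_{\mathrm{st}}(\Pi_1^{-1}(\Lambda_1))^{n_1}\cap_{\mathrm{st}}\cdots\cap_{\mathrm{st}}(\Pi_p^{-1}(\Lambda_p))^{n_p})$, powers being stable self-intersections. The tropical volume polynomial is $\mathrm{tvol}_{\Gamma,\underline\Lambda}(t_1,\ldots,t_p)=\sum_{|\mathbf n|=d}\frac{d!}{n_1!\cdots n_p!}\deg^{\mathbf n}_{\underline\Lambda}(\Gamma)\,t_1^{n_1}\cdots t_p^{n_p}$. $\Gamma$ is translation-admissible if for every rational linear subspace $V\subseteq N_{\mathbb R}$ the Minkowski sum $\Gamma+V$ is the support of a tropical variety (equivalently, is pure-dimensional). $\Gamma$ is connected in codimension one if any two facets $\sigma,\sigma'$ can be joined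 by a sequence of facets $\sigma=\sigma_0,\sigma_1,\ldots,\sigma_k=\sigma'$ such that consecutive ones share a common face of dimension $d-1$. Lorentzian. A homogeneous polynomial $h\in\mathbb R[t_1,\ldots,t_p]$ of degree $d$ is Lorentzian if its coefficients are nonnegative, its support is M-convex (equivalently, the set of lattice points of the base polytope of a polymatroid, i.e. of $\{\mathbf v\in\mathbb R^p_{\ge0}\mid\sum_{i\in I}v_i\le r(I)\ \forall I,\ \sum_iv_i=r([p])\}$ for a normalized monotone submodular $r:2^{[p]}\to\mathbb N$), and for all $1\le i_1\le\cdots\le i_{d-2}\le p$ the quadratic form $\partial_{t_{i_1}}\cdots\partial_{t_{i_{d-2}}}h$ has at most one positive eigenvalue. *)

theory Defs
  imports
    "HOL-Analysis.Analysis"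
    "HOL-Library.Function_Algebras"
    "HOL-Library.Set_Algebras"
    "HOL-Library.Poly_Mapping"
    "Jordan_Normal_Form.Char_Poly"
begin

section \<open>Coordinate spaces\<close>

text \<open>
  The dimensions occur as quantified natural numbers, so a coordinate space with finite index
  set \<open>I\<close> is the subspace of functions vanishing outside \<open>I\<close>.  Making the whole
  function type a real vector space gives access to \<^const>\<open>span\<close>, \<^const>\<open>dim\<close>,
  \<^const>\<open>subspace\<close> and \<^const>\<open>face_of\<close>; its topology is the product topology, which
  on a coordinate space is the Euclidean one.
\<close>

instantiation "fun" :: (type, real_vector) real_vector
begin

definition scaleR_fun :: "real \<Rightarrow> ('a \<Rightarrow> 'b) \<Rightarrow> 'a \<Rightarrow> 'b"
  where "scaleR_fun c f = (\<lambda>x. c *\<^sub>R f x)"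

instance
  by standard (auto simp: scaleR_fun_def fun_eq_iff scaleR_add_right scaleR_add_left)

end

definition coord_space :: "'k set \<Rightarrow> ('k \<Rightarrow> real) set"
  where "coord_space I = {x. \<forall>k. k \<notin> I \<longrightarrow> x k = 0}"

definition int_lattice :: "'k set \<Rightarrow> ('k \<Rightarrow> real) set"
  where "int_lattice I = {x \<in> coord_space I. \<forall>k. x k \<in> \<int>}"

definition rational_subspace :: "'k set \<Rightarrow> ('k \<Rightarrow> real) set \<Rightarrow> bool"
  where "rational_subspace I V \<longleftrightarrow> (\<exists>B \<subseteq> int_lattice I. V = span B)"

definition lattice_index :: "('k \<Rightarrow> real) set \<Rightarrow> ('k \<Rightarrow> real) set \<Rightarrow> nat"
  where "lattice_index N L = card (N // {(x, y). x \<in> N \<and> y \<in> N \<and> x - y \<in> L})"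


section \<open>Weighted rational polyhedral complexes\<close>

text \<open>Rationality concerns the slopes; the constant terms are arbitrary reals.\<close>

definition rational_polyhedron :: "'k set \<Rightarrow> ('k \<Rightarrow> real) set \<Rightarrow> bool"
  where "rational_polyhedron I P \<longleftrightarrow>
    (\<exists>H :: (('k \<Rightarrow> real) \<times> real) set. finite H \<and> (\<forall>(u, c) \<in> H. u \<in> int_lattice I) \<and>
       P = {x \<in> coord_space I. \<forall>(u, c) \<in> H. (\<Sum>k\<in>I. u k * x k) \<le> c})"

definition lin :: "('k \<Rightarrow> real) set \<Rightarrow> ('k \<Rightarrow> real) set"
  where "lin P = span {x - y | x y. x \<in> P \<and> y \<in> P}"

text \<open>This is the usual dimension for nonempty polyhedra; note \<open>pdim {} = 0\<close>.\<close>

definition pdim :: "('k \<Rightarrow> real) set \<Rightarrow> nat"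
  where "pdim P = dim (lin P)"

definition lat :: "'k set \<Rightarrow> ('k \<Rightarrow> real) set \<Rightarrow> ('k \<Rightarrow> real) set"
  where "lat I P = lin P \<inter> int_lattice I"

text \<open>Only the values of the weight function on facets are meaningful.\<close>

record 'k wcomplex =
  cells :: "('k \<Rightarrow> real) set set"
  wt :: "('k \<Rightarrow> real) set \<Rightarrow> nat"

definition polyhedral_complex :: "'k set \<Rightarrow> ('k \<Rightarrow> real) set set \<Rightarrow> bool"
  where "polyhedral_complex I C \<longleftrightarrow>
    finite C \<and>
    (\<forall>\<sigma>\<in>C. rational_polyhedron I \<sigma> \<and> \<sigma> \<noteq> {}) \<and>
    (\<forall>\<sigma>\<in>C. \<forall>\<tau>. \<tau> face_of \<sigma> \<and> \<tau> \<noteq> {} \<longrightarrow> \<tau> \<in> C) \<and>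
    (\<forall>\<sigma>\<in>C. \<forall>\<sigma>'\<in>C. (\<sigma> \<inter> \<sigma>') face_of \<sigma> \<and> (\<sigma> \<inter> \<sigma>') face_of \<sigma>')"

definition cdim :: "'k wcomplex \<Rightarrow> nat"
  where "cdim \<Gamma> = Max (pdim ` cells \<Gamma>)"

definition facets :: "'k wcomplex \<Rightarrow> ('k \<Rightarrow> real) set set"
  where "facets \<Gamma> = {\<sigma> \<in> cells \<Gamma>. pdim \<sigma> = cdim \<Gamma>}"

definition supp :: "'k wcomplex \<Rightarrow> ('k \<Rightarrow> real) set"
  where "supp \<Gamma> = \<Union> (cells \<Gamma>)"

text \<open>
  \<open>v\<close> represents the primitive generator of \<open>\<sigma>\<close> modulo its face \<open>\<tau>\<close> of codimension one:
  it generates \<open>lat I \<sigma>\<close> modulo \<open>lat I \<tau>\<close> and points from \<open>\<tau>\<close> into \<open>\<sigma>\<close>.  It is unique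
  modulo \<open>lat I \<tau>\<close>.
\<close>

definition primitive_generator ::
    "'k set \<Rightarrow> ('k \<Rightarrow> real) set \<Rightarrow> ('k \<Rightarrow> real) set \<Rightarrow> ('k \<Rightarrow> real) \<Rightarrow> bool"
  where "primitive_generator I \<sigma> \<tau> v \<longleftrightarrow>
    lat I \<sigma> = {of_int z *\<^sub>R v + w | z w. w \<in> lat I \<tau>} \<and>
    (\<exists>x\<in>\<sigma>. \<exists>y\<in>\<tau>. \<exists>c>0. x - y - c *\<^sub>R v \<in> lin \<tau>)"

definition balanced :: "'k set \<Rightarrow> 'k wcomplex \<Rightarrow> bool"
  where "balanced I \<Gamma> \<longleftrightarrow>
    (\<forall>\<tau> \<in> cells \<Gamma>. pdim \<tau> + 1 = cdim \<Gamma> \<longrightarrow>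
      (\<exists>v. (\<forall>\<sigma> \<in> facets \<Gamma>. \<tau> \<subseteq> \<sigma> \<longrightarrow> primitive_generator I \<sigma> \<tau> (v \<sigma>)) \<and>
           (\<Sum>\<sigma> | \<sigma> \<in> facets \<Gamma> \<and> \<tau> \<subseteq> \<sigma>. real (wt \<Gamma> \<sigma>) *\<^sub>R v \<sigma>) \<in> lin \<tau>))"

definition tropical_variety :: "'k set \<Rightarrow> nat \<Rightarrow> 'k wcomplex \<Rightarrow> bool"
  where "tropical_variety I d \<Gamma> \<longleftrightarrow>
    polyhedral_complex I (cells \<Gamma>) \<and>
    cells \<Gamma> \<noteq> {} \<and> (\<forall>\<sigma> \<in> cells \<Gamma>. \<exists>\<sigma>' \<in> cells \<Gamma>. \<sigma> \<subseteq> \<sigma>' \<and> pdim \<sigma>' = d) \<and>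
    (\<forall>\<sigma> \<in> facets \<Gamma>. wt \<Gamma> \<sigma> > 0) \<and>
    balanced I \<Gamma>"

definition translation_admissible :: "'k set \<Rightarrow> 'k wcomplex \<Rightarrow> bool"
  where "translation_admissible I \<Gamma> \<longleftrightarrow>
    (\<forall>V. rational_subspace I V \<longrightarrow>
      (\<exists>e \<Delta>. tropical_variety I e \<Delta> \<and> supp \<Delta> = supp \<Gamma> + V))"

definition connected_codim_one :: "'k wcomplex \<Rightarrow> bool"
  where "connected_codim_one \<Gamma> \<longleftrightarrow>
    (\<forall>\<sigma> \<in> facets \<Gamma>. \<forall>\<sigma>' \<in> facets \<Gamma>.
      (\<sigma>, \<sigma>') \<in> {(\<alpha>, \<beta>). \<alpha> \<in> facets \<Gamma> \<and> \<beta> \<in> facets \<Gamma> \<and>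
        (\<exists>\<tau> \<in> cells \<Gamma>. \<tau> face_of \<alpha> \<and> \<tau> face_of \<beta> \<and> pdim \<tau> + 1 = cdim \<Gamma>)}\<^sup>*)"


section \<open>Stable intersection\<close>

definition displaced_inter ::
    "('k \<Rightarrow> real) \<Rightarrow> ('k \<Rightarrow> real) set \<Rightarrow> ('k \<Rightarrow> real) set \<Rightarrow> real \<Rightarrow> ('k \<Rightarrow> real) set"
  where "displaced_inter v \<sigma> \<sigma>' \<epsilon> = \<sigma> \<inter> (\<lambda>x. x + \<epsilon> *\<^sub>R v) ` \<sigma>'"

text \<open>
  Limit of a family of sets for \<open>\<epsilon> \<rightarrow> 0+\<close>.  For the families \<^term>\<open>displaced_inter v \<sigma> \<sigma>'\<close> of
  polyhedra this (lower) Kuratowski limit is an honest limit.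
\<close>

definition limit_set :: "(real \<Rightarrow> ('k \<Rightarrow> real) set) \<Rightarrow> ('k \<Rightarrow> real) set"
  where "limit_set S =
    {x. \<exists>y. (\<forall>\<^sub>F \<epsilon> in at_right 0. y \<epsilon> \<in> S \<epsilon>) \<and> (y \<longlongrightarrow> x) (at_right 0)}"

definition generic_displacement ::
    "'k set \<Rightarrow> 'k wcomplex \<Rightarrow> 'k wcomplex \<Rightarrow> ('k \<Rightarrow> real) \<Rightarrow> bool"
  where "generic_displacement I \<Gamma> \<Gamma>' v \<longleftrightarrow> v \<in> coord_space I \<and>
    (\<forall>\<^sub>F \<epsilon> in at_right 0. \<forall>\<sigma> \<in> cells \<Gamma>. \<forall>\<sigma>' \<in> cells \<Gamma>'.
       displaced_inter v \<sigma> \<sigma>' \<epsilon> \<noteq> {} \<longrightarrow> lin \<sigma> + lin \<sigma>' = coord_space I)"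

text \<open>
  Pairs of facets whose displaced intersection has limit \<open>\<rho>\<close>, where \<open>\<rho>\<close> keeps the dimension
  \<open>pdim \<sigma> + pdim \<sigma>' - card I\<close> of the transverse intersection; limits of smaller dimension
  are not facets.
\<close>

definition stable_pairs ::
    "'k set \<Rightarrow> ('k \<Rightarrow> real) \<Rightarrow> 'k wcomplex \<Rightarrow> 'k wcomplex \<Rightarrow> ('k \<Rightarrow> real) set \<Rightarrow>
      (('k \<Rightarrow> real) set \<times> ('k \<Rightarrow> real) set) set"
  where "stable_pairs I v \<Gamma> \<Gamma>' \<rho> =
    {(\<sigma>, \<sigma>'). \<sigma> \<in> facets \<Gamma> \<and> \<sigma>' \<in> facets \<Gamma>' \<and>
       \<rho> = limit_set (displaced_inter v \<sigma> \<sigma>') \<and> \<rho> \<noteq> {} \<and>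
       pdim \<rho> + card I = pdim \<sigma> + pdim \<sigma>'}"

text \<open>
  For balanced complexes the outcome does not depend on the generic vector that is chosen.
  The result may have no cells at all.
\<close>

definition stable_inter :: "'k set \<Rightarrow> 'k wcomplex \<Rightarrow> 'k wcomplex \<Rightarrow> 'k wcomplex"
  where "stable_inter I \<Gamma> \<Gamma>' =
    (let v = (SOME v. generic_displacement I \<Gamma> \<Gamma>' v) in
     \<lparr> cells = {\<tau>. \<tau> \<noteq> {} \<and> (\<exists>\<rho>. stable_pairs I v \<Gamma> \<Gamma>' \<rho> \<noteq> {} \<and> \<tau> face_of \<rho>)},
       wt = (\<lambda>\<rho>. \<Sum>(\<sigma>, \<sigma>') \<in> stable_pairs I v \<Gamma> \<Gamma>' \<rho>.
               wt \<Gamma> \<sigma> * wt \<Gamma>' \<sigma>' * lattice_index (int_lattice I) (lat I \<sigma> + lat I \<sigma>')) \<rparr>)"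

text \<open>The whole space with weight one is neutral for stable intersection (up to refinement).\<close>

definition whole_space :: "'k set \<Rightarrow> 'k wcomplex"
  where "whole_space I = \<lparr> cells = {coord_space I}, wt = (\<lambda>_. 1) \<rparr>"

primrec stable_power :: "'k set \<Rightarrow> 'k wcomplex \<Rightarrow> nat \<Rightarrow> 'k wcomplex"
  where
    "stable_power I \<Gamma> 0 = whole_space I"
  | "stable_power I \<Gamma> (Suc n) = stable_inter I (stable_power I \<Gamma> n) \<Gamma>"

text \<open>Used for complexes that are empty or of dimension zero.\<close>

definition degree0 :: "'k wcomplex \<Rightarrow> nat"
  where "degree0 \<Gamma> = (\<Sum>\<sigma> \<in> facets \<Gamma>. wt \<Gamma> \<sigma>)"

definition positive_divisor :: "nat \<Rightarrow> nat wcomplex \<Rightarrow> bool"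
  where "positive_divisor m \<Lambda> \<longleftrightarrow>
    (\<exists>e. e + 1 = m \<and> tropical_variety {1..m} e \<Lambda>) \<and>
    (\<forall>C. tropical_variety {1..m} 1 C \<longrightarrow> degree0 (stable_inter {1..m} \<Lambda> C) > 0)"


section \<open>Tropical volume polynomials\<close>

text \<open>
  The product of the spaces of dimensions \<open>m 1, \<dots>, m p\<close> is the coordinate space with
  coordinates \<open>(i, j)\<close>, where \<open>1 \<le> i \<le> p\<close> and \<open>1 \<le> j \<le> m i\<close>.
\<close>

definition blocks :: "nat \<Rightarrow> (nat \<Rightarrow> nat) \<Rightarrow> (nat \<times> nat) set"
  where "blocks p m = (SIGMA i:{1..p}. {1..m i})"

definition block_proj :: "nat \<Rightarrow> (nat \<times> nat \<Rightarrow> real) \<Rightarrow> nat \<Rightarrow> real"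
  where "block_proj i x = (\<lambda>j. x (i, j))"

definition block_preimage ::
    "nat \<Rightarrow> (nat \<Rightarrow> nat) \<Rightarrow> nat \<Rightarrow> nat wcomplex \<Rightarrow> (nat \<times> nat) wcomplex"
  where "block_preimage p m i \<Lambda> =
    \<lparr> cells = (\<lambda>\<sigma>. {x \<in> coord_space (blocks p m). block_proj i x \<in> \<sigma>}) ` cells \<Lambda>,
      wt = (\<lambda>P. wt \<Lambda> (block_proj i ` P)) \<rparr>"

definition multidegree ::
    "nat \<Rightarrow> (nat \<Rightarrow> nat) \<Rightarrow> (nat \<times> nat) wcomplex \<Rightarrow> (nat \<Rightarrow> nat wcomplex) \<Rightarrow>
      (nat \<Rightarrow>\<^sub>0 nat) \<Rightarrow> nat"
  where "multidegree p m \<Gamma> \<Lambda> n =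
    degree0 (foldl (\<lambda>\<Delta> i. stable_inter (blocks p m) \<Delta>
        (stable_power (blocks p m) (block_preimage p m i (\<Lambda> i)) (Poly_Mapping.lookup n i)))
      \<Gamma> [1..<Suc p])"

definition exponents :: "nat \<Rightarrow> nat \<Rightarrow> (nat \<Rightarrow>\<^sub>0 nat) set"
  where "exponents p d =
    {n. Poly_Mapping.keys n \<subseteq> {1..p} \<and> (\<Sum>i=1..p. Poly_Mapping.lookup n i) = d}"

text \<open>
  A real polynomial in \<open>t\<^sub>1, \<dots>, t\<^sub>p\<close> is an element of \<^typ>\<open>(nat \<Rightarrow>\<^sub>0 nat) \<Rightarrow>\<^sub>0 real\<close>,
  mapping exponent vectors to coefficients.
\<close>

definition tvol ::
    "nat \<Rightarrow> (nat \<Rightarrow> nat) \<Rightarrow> nat \<Rightarrow> (nat \<times> nat) wcomplex \<Rightarrow> (nat \<Rightarrow> nat wcomplex) \<Rightarrow>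
      ((nat \<Rightarrow>\<^sub>0 nat) \<Rightarrow>\<^sub>0 real)"
  where "tvol p m d \<Gamma> \<Lambda> =
    (\<Sum>n \<in> exponents p d. Poly_Mapping.single n
       (fact d / (\<Prod>i=1..p. fact (Poly_Mapping.lookup n i)) * real (multidegree p m \<Gamma> \<Lambda> n)))"

lemma finite_exponents: "finite (exponents p d)"
proof -
  have bound: "Poly_Mapping.lookup n i \<le> d" if "n \<in> exponents p d" for n i
  proof (cases "i \<in> {1..p}")
    case True
    then have "Poly_Mapping.lookup n i \<le> (\<Sum>i=1..p. Poly_Mapping.lookup n i)"
      by (intro member_le_sum) auto
    with that show ?thesis by (simp add: exponents_def)
  next
    case False
    with that have "i \<notin> Poly_Mapping.keys n" by (auto simp: exponents_def)
    then show ?thesis by (simp add: in_keys_iff)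
  qed
  have "Poly_Mapping.lookup ` exponents p d \<subseteq>
      {f. \<forall>i. (i \<in> {1..p} \<longrightarrow> f i \<in> {..d}) \<and> (i \<notin> {1..p} \<longrightarrow> f i = 0)}"
    using bound by (auto simp: exponents_def in_keys_iff subset_eq)
  moreover have "finite {f :: nat \<Rightarrow> nat. \<forall>i. (i \<in> {1..p} \<longrightarrow> f i \<in> {..d}) \<and> (i \<notin> {1..p} \<longrightarrow> f i = 0)}"
    by (rule finite_set_of_finite_funs) auto
  ultimately have "finite (Poly_Mapping.lookup ` exponents p d)"
    by (rule finite_subset)
  then show ?thesis
    by (rule finite_imageD) (auto intro: inj_onI poly_mapping_eqI)
qed

lemma lookup_tvol:
  "Poly_Mapping.lookup (tvol p m d \<Gamma> \<Lambda>) n =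
    (if n \<in> exponents p d
     then fact d / (\<Prod>i=1..p. fact (Poly_Mapping.lookup n i)) * real (multidegree p m \<Gamma> \<Lambda> n)
     else 0)"
  unfolding tvol_def lookup_sum lookup_single when_def
  using finite_exponents[of p d] by simp

lemma keys_tvol: "Poly_Mapping.keys (tvol p m d \<Gamma> \<Lambda>) \<subseteq> exponents p d"
  by (auto simp: in_keys_iff lookup_tvol split: if_splits)


section \<open>Lorentzian polynomials\<close>

definition mpoly_deriv ::
    "nat \<Rightarrow> ((nat \<Rightarrow>\<^sub>0 nat) \<Rightarrow>\<^sub>0 real) \<Rightarrow> ((nat \<Rightarrow>\<^sub>0 nat) \<Rightarrow>\<^sub>0 real)"
  where "mpoly_deriv i h =
    (\<Sum>n \<in> Poly_Mapping.keys h. Poly_Mapping.single (n - Poly_Mapping.single i 1)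
       (real (Poly_Mapping.lookup n i) * Poly_Mapping.lookup h n))"

definition m_convex :: "(nat \<Rightarrow>\<^sub>0 nat) set \<Rightarrow> bool"
  where "m_convex J \<longleftrightarrow>
    (\<forall>\<alpha>\<in>J. \<forall>\<beta>\<in>J. \<forall>i. Poly_Mapping.lookup \<alpha> i > Poly_Mapping.lookup \<beta> i \<longrightarrow>
      (\<exists>j. Poly_Mapping.lookup \<alpha> j < Poly_Mapping.lookup \<beta> j \<and>
           \<alpha> - Poly_Mapping.single i 1 + Poly_Mapping.single j 1 \<in> J))"

text \<open>The symmetric matrix of a quadratic form in \<open>t\<^sub>1, \<dots>, t\<^sub>p\<close>; matrix indices start at 0.\<close>

definition quadratic_form_mat :: "nat \<Rightarrow> ((nat \<Rightarrow>\<^sub>0 nat) \<Rightarrow>\<^sub>0 real) \<Rightarrow> real Matrix.mat"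
  where "quadratic_form_mat p q = Matrix.mat p p (\<lambda>(i, j).
    Poly_Mapping.lookup q (Poly_Mapping.single (Suc i) 1 + Poly_Mapping.single (Suc j) 1)
      / (if i = j then 1 else 2))"

text \<open>Eigenvalues are counted with multiplicity.\<close>

definition num_positive_eigenvalues :: "real Matrix.mat \<Rightarrow> nat"
  where "num_positive_eigenvalues A = size (filter_mset (\<lambda>x. x > 0) (proots (char_poly A)))"

definition lorentzian :: "nat \<Rightarrow> nat \<Rightarrow> ((nat \<Rightarrow>\<^sub>0 nat) \<Rightarrow>\<^sub>0 real) \<Rightarrow> bool"
  where "lorentzian p d h \<longleftrightarrow>
    Poly_Mapping.keys h \<subseteq> exponents p d \<and>
    (\<forall>n. Poly_Mapping.lookup h n \<ge> 0) \<and>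
    m_convex (Poly_Mapping.keys h) \<and>
    (\<forall>is. length is + 2 = d \<and> set is \<subseteq> {1..p} \<and> sorted is \<longrightarrow>
       num_positive_eigenvalues (quadratic_form_mat p (fold mpoly_deriv is h)) \<le> 1)"

end

theory Submission
  imports Defs
begin

text \<open>
  Take \<open>p = 4\<close> and all \<open>m i = 1\<close>, so that the ambient space is \<open>\<real>\<^sup>4\<close> with one coordinate per block.
  A point on the line is a positive divisor: the support of a tropical curve in \<open>\<real>\<close> is all of \<open>\<real>\<close>
  (\<open>support_is_line\<close>), so a displaced point always meets it
  (\<open>positive_point_divisor\<close>).  The preimages of the four points are the coordinate hyperplanes.

  The variety is the union of the six coordinate planes of \<open>\<real>\<^sup>4\<close>, subdivided into quadrants, where
  every plane carries a constant weight.  Constant weights on linear spaces are always balanced, hence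
  the weights may be chosen freely; let them be \<open>3\<close> on the complementary planes \<open>{1, 2}\<close> and
  \<open>{3, 4}\<close>, and \<open>1\<close> on the other four.

  Stable intersection with the coordinate hyperplane of \<open>k\<close> discards the planes that do not contain
  the axis of \<open>k\<close> and contracts \<open>k\<close> in the others, keeping weights
  (\<open>stable_inter_coordinate_hyperplane\<close>); a hyperplane has empty stable self-intersection.  Thus
  the volume polynomial is \<open>2 * (\<Sum>i<j. w {i, j} * t i * t j)\<close>
  (\<open>multidegree_coordinate_planes\<close>).  Half its Hessian has zero diagonal, entries \<open>3\<close> at the
  positions of \<open>{1, 2}\<close> and \<open>{3, 4}\<close>, and \<open>1\<close> elsewhere off the diagonal.  The vectors \<open>(1, 1, 1, 1)\<close> and
  \<open>(1, 1, -1, -1)\<close> are eigenvectors with eigenvalues \<open>5\<close> and \<open>1\<close>: two positive eigenvalues, so the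
  polynomial is not Lorentzian.

  Translation admissibility is a property of the support.  For a rational subspace \<open>V\<close>, the sum of the support and \<open>V\<close> is a union of the spaces spanned by \<open>V\<close> and
  two unit vectors.  By the exchange property in the quotient by \<open>V\<close>, those of maximal dimension
  already cover the union (\<open>coordinate_planes_plus_subspace\<close>).  A finite union of
  rational subspaces of one dimension is the support of a tropical variety
  (\<open>union_of_rational_subspaces_tropical\<close>): cut it by finitely many rational hyperplanes that
  define the subspaces.  In the resulting fan, reflection in a cell of codimension one pairs the
  facets around it with opposite primitive generators, which gives balancing
  (\<open>balanced_fan\<close>).  The same construction yields the fan of weighted coordinate planes.
\<close>

section \<open>Linear algebra over the integers\<close>

definition unit :: "'k \<Rightarrow> 'k \<Rightarrow> real"
  where "unit k = (\<lambda>j. if j = k then 1 else 0)"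

definition pairing :: "'k set \<Rightarrow> ('k \<Rightarrow> real) \<Rightarrow> ('k \<Rightarrow> real) \<Rightarrow> real"
  where "pairing I u x = (\<Sum>k\<in>I. u k * x k)"

definition solutions :: "'k set \<Rightarrow> ('k \<Rightarrow> real) set \<Rightarrow> ('k \<Rightarrow> real) set"
  where "solutions I H = {x \<in> coord_space I. \<forall>u\<in>H. pairing I u x = 0}"

lemma fun_scaleR_apply [simp]: "(c *\<^sub>R f) x = c *\<^sub>R f x"
  by (simp add: scaleR_fun_def)

lemma pairing_simps:
  "pairing I u (x + y) = pairing I u x + pairing I u y"
  "pairing I u (x - y) = pairing I u x - pairing I u y"
  "pairing I u (c *\<^sub>R x) = c * pairing I u x"
  "pairing I u (- x) = - pairing I u x"
  "pairing I u 0 = 0"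
  "pairing I (u + w) x = pairing I u x + pairing I w x"
  "pairing I (u - w) x = pairing I u x - pairing I w x"
  "pairing I (c *\<^sub>R u) x = c * pairing I u x"
  by (simp_all add: pairing_def sum.distrib sum_subtractf sum_negf sum_distrib_left algebra_simps)

lemma pairing_commute: "pairing I u x = pairing I x u"
  by (simp add: pairing_def mult.commute)

lemma pairing_unit: "finite I \<Longrightarrow> k \<in> I \<Longrightarrow> pairing I (unit k) x = x k"
  by (simp add: pairing_def unit_def if_distrib[of "\<lambda>a. a * _"] cong: if_cong)

lemma unit_in_coord_space [simp]: "unit k \<in> coord_space I \<longleftrightarrow> k \<in> I"
  by (auto simp: coord_space_def unit_def)

lemma unit_in_int_lattice [simp]: "unit k \<in> int_lattice I \<longleftrightarrow> k \<in> I"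
  by (auto simp: int_lattice_def) (auto simp: unit_def)

lemma subspace_coord_space [simp]: "subspace (coord_space I)"
  by (auto simp: subspace_def coord_space_def)

lemma subspace_solutions [simp]: "subspace (solutions I H)"
  using subspace_coord_space[of I]
  by (auto simp: subspace_def solutions_def pairing_simps)

lemma solutions_subset_coord: "solutions I H \<subseteq> coord_space I"
  by (auto simp: solutions_def)

lemma int_lattice_subset_coord: "int_lattice I \<subseteq> coord_space I"
  by (auto simp: int_lattice_def)

lemma int_lattice_closed:
  "x \<in> int_lattice I \<Longrightarrow> y \<in> int_lattice I \<Longrightarrow> x + y \<in> int_lattice I"
  "x \<in> int_lattice I \<Longrightarrow> y \<in> int_lattice I \<Longrightarrow> x - y \<in> int_lattice I"
  "c \<in> \<int> \<Longrightarrow> y \<in> int_lattice I \<Longrightarrow> c *\<^sub>R y \<in> int_lattice I"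
  "0 \<in> int_lattice I"
  by (auto simp: int_lattice_def coord_space_def)

lemma pairing_int:
  "u \<in> int_lattice I \<Longrightarrow> x \<in> int_lattice I \<Longrightarrow> pairing I u x \<in> \<int>"
  by (auto simp: pairing_def int_lattice_def intro!: Ints_sum)

lemma coord_space_expand:
  assumes "finite I" "x \<in> coord_space I"
  shows "x = (\<Sum>k\<in>I. x k *\<^sub>R unit k)"
proof
  fix j
  have *: "(\<Sum>k\<in>A. x k *\<^sub>R unit k) j = (\<Sum>k\<in>A. if k = j then x k else 0)" for A
    by (induction A rule: infinite_finite_induct) (auto simp: unit_def)
  show "x j = (\<Sum>k\<in>I. x k *\<^sub>R unit k) j"
    using assms unfolding * by (auto simp: coord_space_def)
qed

lemma coord_space_span: "finite I \<Longrightarrow> coord_space I = span (unit ` I)"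
proof (rule antisym)
  assume "finite I"
  then show "coord_space I \<subseteq> span (unit ` I)"
    using coord_space_expand[of I] by (metis (no_types, lifting) imageI span_base span_scale span_sum subsetI)
  show "span (unit ` I) \<subseteq> coord_space I"
    by (rule span_minimal) auto
qed

subsection \<open>Dimension inside a coordinate space\<close>

lemma finite_independent:
  assumes "finite I" "B \<subseteq> coord_space I" "independent B"
  shows "finite B"
  using independent_span_bound[of "unit ` I" B] assms coord_space_span[of I] by auto

lemma subspace_basis:
  assumes "finite I" "S \<subseteq> coord_space I" "subspace S"
  obtains B where "finite B" "B \<subseteq> S" "independent B" "span B = S" "card B = dim S"
proof -
  obtain B where B: "B \<subseteq> S" "independent B" "S \<subseteq> span B" "card B = dim S"
    using basis_exists[of S] by blast
  show ?thesis
  proof (rule that[of B])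
    show "span B = S" using B assms by (intro span_subspace)
    show "finite B" using B assms by (intro finite_independent[of I B]) auto
  qed (use B in auto)
qed

lemma dim_less:
  assumes "finite I" "T \<subseteq> coord_space I" "subspace S" "subspace T" "S \<subset> T"
  shows "dim S < dim T"
proof -
  obtain B where B: "finite B" "B \<subseteq> S" "independent B" "span B = S" "card B = dim S"
    using subspace_basis[of I S] assms by auto
  obtain x where x: "x \<in> T" "x \<notin> S" using assms by auto
  have "independent (insert x B)" using B x by (intro independent_insertI) auto
  moreover obtain C where C: "finite C" "independent C" "span C = T" "card C = dim T"
    using subspace_basis[of I T] assms by metis
  moreover have "insert x B \<subseteq> span C" using C B x assms by auto
  ultimately have "card (insert x B) \<le> card C"
    using independent_span_bound by blast
  moreover have "x \<notin> B" using B x by auto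
  ultimately show ?thesis using B C by simp
qed

lemma dim_insert_new:
  assumes "finite I" "S \<subseteq> coord_space I" "subspace S" "x \<notin> S"
  shows "dim (span (insert x S)) = Suc (dim S)"
proof -
  obtain B where B: "finite B" "B \<subseteq> S" "independent B" "span B = S" "card B = dim S"
    using subspace_basis[of I S] assms by auto
  have ind: "independent (insert x B)" using B assms by (intro independent_insertI) auto
  have "span (insert x S) = span (insert x B)"
    unfolding span_insert B(4) span_eq_iff[THEN iffD2, OF assms(3)] ..
  moreover have "x \<notin> B" using B assms(4) by auto
  ultimately show ?thesis
    using dim_eq_card_independent[OF ind] dim_span[of "insert x B"] B by simp
qed

subsection \<open>Rational subspaces and integral equations\<close>

lemma solutions_insert: "solutions I (insert u H) = {x \<in> solutions I H. pairing I u x = 0}"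
  by (auto simp: solutions_def)

text \<open>
  Impose the equations one at a time.  If an integral vector \<open>a\<close> violates the next equation \<open>u\<close>, then
  \<open>x \<mapsto> \<langle>u, a\<rangle> x - \<langle>u, x\<rangle> a\<close> maps into the new solution space, maps integral vectors to integral
  ones, and is a nonzero multiple of the identity on that space.
\<close>

lemma solutions_integral_span:
  assumes "finite I" "finite H" "H \<subseteq> int_lattice I"
  shows "solutions I H = span (solutions I H \<inter> int_lattice I)"
  using assms(2,3)
proof (induction H rule: finite_induct)
  case empty
  have "span (unit ` I) \<subseteq> span (solutions I {} \<inter> int_lattice I)"
    by (rule span_mono) (auto simp: solutions_def)
  then have "coord_space I \<subseteq> span (solutions I {} \<inter> int_lattice I)"
    using coord_space_span[OF assms(1)] by simp
  moreover have "span (solutions I {} \<inter> int_lattice I) \<subseteq> solutions I {}"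
    by (rule span_minimal) auto
  ultimately show ?case by (auto simp: solutions_def)
next
  case (insert u H)
  let ?B = "solutions I H \<inter> int_lattice I" and ?K = "solutions I (insert u H)"
  have span: "span (?K \<inter> int_lattice I) \<subseteq> ?K"
    by (rule span_minimal) auto
  have IH: "solutions I H = span ?B" using insert by auto
  show ?case
  proof (cases "\<forall>b\<in>?B. pairing I u b = 0")
    case True
    have "span ?B \<subseteq> ?K"
    proof (rule span_minimal)
      show "?B \<subseteq> ?K" using True by (auto simp: solutions_insert)
    qed simp
    then have "?K = solutions I H" using IH by (auto simp: solutions_insert)
    with IH show ?thesis by simp
  next
    case False
    then obtain a where a: "a \<in> ?B" "pairing I u a \<noteq> 0" by auto
    define f where "f x = pairing I u a *\<^sub>R x - pairing I u x *\<^sub>R a" for x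
    have "f x \<in> span (?K \<inter> int_lattice I)" if "x \<in> span ?B" for x
      using that
    proof (induction rule: span_induct_alt)
      case base
      have "f 0 = 0" by (simp only: f_def pairing_simps(5) scaleR_zero_left scaleR_zero_right diff_zero)
      then show ?case by (simp only: span_zero)
    next
      case (step c b x)
      have "f b \<in> solutions I H" "pairing I u (f b) = 0" "f b \<in> int_lattice I"
        using a step(1) insert.prems unfolding f_def
        by (auto intro!: subspace_diff subspace_scale int_lattice_closed pairing_int
            simp: pairing_simps)
      then have "f b \<in> span (?K \<inter> int_lattice I)"
        by (intro span_base) (auto simp: solutions_insert)
      moreover have "f (c *\<^sub>R b + x) = c *\<^sub>R f b + f x"
        by (simp add: f_def pairing_simps algebra_simps)
      ultimately show ?case using step(2) by (simp only: span_add span_scale)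
    qed
    then have f: "f x \<in> span (?K \<inter> int_lattice I)" if "x \<in> ?K" for x
      using that IH by (auto simp: solutions_insert)
    have "x \<in> span (?K \<inter> int_lattice I)" if "x \<in> ?K" for x
    proof -
      have "x = inverse (pairing I u a) *\<^sub>R (pairing I u a *\<^sub>R x)"
        using a(2) by (simp only: scaleR_scaleR left_inverse scaleR_one not_False_eq_True)
      also have "pairing I u a *\<^sub>R x = f x"
        using that by (simp only: solutions_insert mem_Collect_eq f_def scaleR_zero_left diff_zero)
      finally show ?thesis using f[OF that] by (metis span_scale)
    qed
    with span show ?thesis by blast
  qed
qed

text \<open>
  The dual of the previous elimination: when \<open>b\<close> is added to the generators, an equation \<open>a\<close> that
  \<open>b\<close> violates serves to correct all other equations so that \<open>b\<close> satisfies them.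
\<close>

lemma finite_span_integral_solutions:
  assumes "finite I" "finite B" "B \<subseteq> int_lattice I"
  shows "\<exists>H. finite H \<and> H \<subseteq> int_lattice I \<and> span B = solutions I H"
  using assms(2,3)
proof (induction B rule: finite_induct)
  case empty
  have "x = 0" if "x \<in> solutions I (unit ` I)" for x
  proof
    fix k
    show "x k = 0 k"
      using that assms(1) by (cases "k \<in> I") (auto simp: solutions_def coord_space_def pairing_unit)
  qed
  moreover have "0 \<in> solutions I (unit ` I)" by (rule subspace_0) simp
  ultimately have "solutions I (unit ` I) = {0}" by blast
  moreover have "unit ` I \<subseteq> int_lattice I" by auto
  ultimately show ?case using assms(1) span_empty by (metis finite_imageI)
next
  case (insert b B)
  then obtain H where H: "finite H" "H \<subseteq> int_lattice I" "span B = solutions I H" by auto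
  have b: "b \<in> coord_space I" "b \<in> int_lattice I" using insert int_lattice_subset_coord by blast+
  show ?case
  proof (cases "b \<in> span B")
    case True
    then show ?thesis using H span_redundant[of b B] by metis
  next
    case False
    then obtain a where a: "a \<in> H" "pairing I a b \<noteq> 0" using H b by (auto simp: solutions_def)
    define f where "f u = pairing I a b *\<^sub>R u - pairing I u b *\<^sub>R a" for u
    have pf: "pairing I (f u) x = pairing I a b * pairing I u x - pairing I u b * pairing I a x" for u x
      by (simp add: f_def pairing_simps)
    have "span (insert b B) = solutions I (f ` H)"
    proof (rule Set.set_eqI)
      fix x
      have "x \<in> span (insert b B) \<longleftrightarrow> (\<exists>c. x - c *\<^sub>R b \<in> solutions I H)"
        by (simp add: span_insert H)
      also have "\<dots> \<longleftrightarrow> x \<in> solutions I (f ` H)"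
      proof
        assume "\<exists>c. x - c *\<^sub>R b \<in> solutions I H"
        then obtain c where c: "x - c *\<^sub>R b \<in> solutions I H" by auto
        then have "pairing I u x = c * pairing I u b" if "u \<in> H" for u
          using that by (auto simp: solutions_def pairing_simps)
        moreover have "(x - c *\<^sub>R b) + c *\<^sub>R b \<in> coord_space I"
          using c b by (intro subspace_add subspace_scale) (auto simp: solutions_def)
        ultimately show "x \<in> solutions I (f ` H)" using a by (auto simp: solutions_def pf)
      next
        assume x: "x \<in> solutions I (f ` H)"
        have "x - (pairing I a x / pairing I a b) *\<^sub>R b \<in> coord_space I"
          using x b by (intro subspace_diff subspace_scale) (auto simp: solutions_def)
        moreover have "pairing I u (x - (pairing I a x / pairing I a b) *\<^sub>R b) = 0" if "u \<in> H" for u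
        proof -
          have "pairing I a b * pairing I u x = pairing I u b * pairing I a x"
            using x that by (auto simp: solutions_def pf)
          then show ?thesis using a(2) by (simp add: pairing_simps(2,3) divide_simps mult.commute)
        qed
        ultimately have "x - (pairing I a x / pairing I a b) *\<^sub>R b \<in> solutions I H"
          by (simp only: solutions_def mem_Collect_eq) blast
        then show "\<exists>c. x - c *\<^sub>R b \<in> solutions I H" by blast
      qed
      finally show "x \<in> span (insert b B) \<longleftrightarrow> x \<in> solutions I (f ` H)" .
    qed
    moreover have "f ` H \<subseteq> int_lattice I"
      unfolding f_def
      by (intro image_subsetI int_lattice_closed pairing_int) (use H a b in blast)+
    ultimately show ?thesis using H(1) by (intro exI[of _ "f ` H"] conjI finite_imageI)
  qed
qed

lemma rational_subspace_solutions:
  assumes "finite I" "rational_subspace I V"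
  obtains H where "finite H" "H \<subseteq> int_lattice I" "V = solutions I H"
proof -
  obtain B where B: "B \<subseteq> int_lattice I" "V = span B"
    using assms by (auto simp: rational_subspace_def)
  obtain C where C: "C \<subseteq> B" "independent C" "B \<subseteq> span C"
    using maximal_independent_subset by metis
  have "finite C"
    using assms C B int_lattice_subset_coord by (intro finite_independent[of I]) blast+
  moreover have "span C = V"
    using C B by (metis span_mono span_span subset_antisym)
  ultimately show ?thesis
    using finite_span_integral_solutions[of I C] assms B C that by (metis subset_trans)
qed

section \<open>Fans cut out by a hyperplane arrangement\<close>

locale arrangement =
  fixes I :: "'k set" and H :: "('k \<Rightarrow> real) set"
  assumes finite_I: "finite I" and finite_H: "finite H" and H_int: "H \<subseteq> int_lattice I"
begin

text \<open>
  The cell of the arrangement that has \<open>x\<close> in its relative interior: the points that lie weakly on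
  the same side as \<open>x\<close> of every hyperplane.  Indexing cells by an interior point avoids the question
  which sign vectors are realised.
\<close>

definition cone :: "('k \<Rightarrow> real) \<Rightarrow> ('k \<Rightarrow> real) set"
  where "cone x = {y \<in> coord_space I. \<forall>u\<in>H.
    0 \<le> pairing I u x * pairing I u y \<and> (pairing I u x = 0 \<longrightarrow> pairing I u y = 0)}"

text \<open>The smallest intersection of hyperplanes that contains \<open>x\<close>; it is the linear span of the cell.\<close>

definition flat :: "('k \<Rightarrow> real) \<Rightarrow> ('k \<Rightarrow> real) set"
  where "flat x = solutions I {u \<in> H. pairing I u x = 0}"

lemma cone_coord: "cone x \<subseteq> coord_space I"
  by (auto simp: cone_def)

lemma flat_coord: "flat x \<subseteq> coord_space I"
  by (simp add: flat_def solutions_subset_coord)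

lemma subspace_flat [simp]: "subspace (flat x)"
  by (simp add: flat_def)

lemma flat_iff:
  "y \<in> flat x \<longleftrightarrow> y \<in> coord_space I \<and> (\<forall>u\<in>H. pairing I u x = 0 \<longrightarrow> pairing I u y = 0)"
  by (auto simp: flat_def solutions_def)

lemma cone_subset_flat: "cone x \<subseteq> flat x"
  by (auto simp: cone_def flat_iff)

lemma self_in_cone: "x \<in> coord_space I \<Longrightarrow> x \<in> cone x"
  by (simp add: cone_def)

lemma zero_in_cone: "0 \<in> cone x"
  using subspace_0[OF subspace_coord_space, of I] by (simp add: cone_def pairing_simps(5))

lemma cone_mono:
  assumes "y \<in> cone x"
  shows "cone y \<subseteq> cone x"
proof
  fix z assume z: "z \<in> cone y"
  have "0 \<le> a * c" if "0 \<le> a * b" "0 \<le> b * c" "b = 0 \<longrightarrow> c = 0" for a b c :: real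
    using that by (auto simp: zero_le_mult_iff)
  with assms z show "z \<in> cone x" unfolding cone_def by blast
qed

lemma flat_mono: "y \<in> cone x \<Longrightarrow> flat y \<subseteq> flat x"
  by (auto simp: cone_def flat_iff)

lemma cone_same_sign:
  assumes "a \<in> cone x" "b \<in> cone x" "u \<in> H"
  shows "0 \<le> pairing I u a * pairing I u b"
proof -
  have "0 \<le> pairing I u x * pairing I u a" "0 \<le> pairing I u x * pairing I u b"
    "pairing I u x = 0 \<longrightarrow> pairing I u a = 0"
    using assms unfolding cone_def by blast+
  then show ?thesis by (auto simp: zero_le_mult_iff)
qed

lemma cone_cong:
  assumes "\<And>u. u \<in> H \<Longrightarrow> sgn (pairing I u x) = sgn (pairing I u y)"
  shows "cone x = cone y"
proof -
  have *: "(0 \<le> pairing I u x * b \<and> (pairing I u x = 0 \<longrightarrow> b = 0)) \<longleftrightarrow>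
      (0 \<le> pairing I u y * b \<and> (pairing I u y = 0 \<longrightarrow> b = 0))" if "u \<in> H" for u b
    using assms[OF that] by (auto simp: zero_le_mult_iff sgn_if split: if_splits)
  show ?thesis unfolding cone_def using * by blast
qed

lemma sgn_eq_of_cone_eq:
  assumes "cone x = cone y" "x \<in> coord_space I" "y \<in> coord_space I" "u \<in> H"
  shows "sgn (pairing I u x) = sgn (pairing I u y)"
proof -
  have "x \<in> cone y" "y \<in> cone x" using assms self_in_cone by blast+
  then have "0 \<le> pairing I u x * pairing I u y" "pairing I u x = 0 \<longleftrightarrow> pairing I u y = 0"
    using assms(4) by (auto simp: cone_def)
  then show ?thesis by (auto simp: zero_le_mult_iff sgn_if)
qed

lemma cone_add: "y \<in> cone x \<Longrightarrow> z \<in> cone x \<Longrightarrow> y + z \<in> cone x"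
  using subspace_add[OF subspace_coord_space, of y I z]
  by (auto simp: cone_def pairing_simps distrib_left)

lemma cone_scale: "y \<in> cone x \<Longrightarrow> 0 \<le> c \<Longrightarrow> c *\<^sub>R y \<in> cone x"
  using subspace_scale[OF subspace_coord_space, of y I c]
  by (auto simp: cone_def pairing_simps mult.left_commute)

lemma convex_cone: "convex (cone x)"
  unfolding convex_def using cone_add cone_scale by blast

text \<open>Strict signs survive a small move; finiteness of the arrangement provides a common bound.\<close>

lemma perturbation:
  "\<exists>\<delta>>0. \<forall>\<epsilon>. \<bar>\<epsilon>\<bar> \<le> \<delta> \<longrightarrow>
    (\<forall>u\<in>H. pairing I u x \<noteq> 0 \<longrightarrow> 0 < pairing I u x * pairing I u (x + \<epsilon> *\<^sub>R z))"
  using finite_H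
proof (induction H rule: finite_induct)
  case empty
  then show ?case by (auto intro: exI[of _ 1])
next
  case (insert u K)
  then obtain \<delta> where \<delta>: "\<delta> > 0" "\<And>\<epsilon> u. \<bar>\<epsilon>\<bar> \<le> \<delta> \<Longrightarrow> u \<in> K \<Longrightarrow> pairing I u x \<noteq> 0 \<Longrightarrow>
      0 < pairing I u x * pairing I u (x + \<epsilon> *\<^sub>R z)" by blast
  define a where "a = pairing I u x"
  define b where "b = pairing I u z"
  show ?case
  proof (cases "a = 0")
    case True
    then show ?thesis using \<delta> unfolding a_def by (intro exI[of _ \<delta>] conjI allI impI ballI) blast+
  next
    case False
    define \<eta> where "\<eta> = min \<delta> (\<bar>a\<bar> / (\<bar>b\<bar> + 1))"
    have "0 < a * (a + \<epsilon> * b)" if "\<bar>\<epsilon>\<bar> \<le> \<eta>" for \<epsilon>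
    proof -
      have "\<bar>\<epsilon>\<bar> \<le> \<bar>a\<bar> / (\<bar>b\<bar> + 1)" using that by (simp add: \<eta>_def)
      then have "\<bar>\<epsilon>\<bar> * (\<bar>b\<bar> + 1) \<le> \<bar>a\<bar>" by (simp add: pos_le_divide_eq add_nonneg_pos)
      moreover have "\<bar>\<epsilon> * b\<bar> < \<bar>\<epsilon>\<bar> * (\<bar>b\<bar> + 1) \<or> \<epsilon> = 0" by (auto simp: abs_mult)
      ultimately have "\<bar>\<epsilon> * b\<bar> < \<bar>a\<bar>" using False by auto
      then show ?thesis by (cases "a > 0") (use False in \<open>auto simp: zero_less_mult_iff\<close>)
    qed
    moreover have "\<eta> > 0" using \<delta> False by (simp add: \<eta>_def add_nonneg_pos)
    moreover have "\<eta> \<le> \<delta>" by (simp add: \<eta>_def)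
    ultimately have "0 < pairing I w x * pairing I w (x + \<epsilon> *\<^sub>R z)"
      if "\<bar>\<epsilon>\<bar> \<le> \<eta>" "w \<in> insert u K" "pairing I w x \<noteq> 0" for \<epsilon> w
      using that \<delta>(2)[of \<epsilon> w] by (cases "w = u") (auto simp: a_def b_def pairing_simps(1,3))
    with \<open>\<eta> > 0\<close> show ?thesis by blast
  qed
qed

lemma cone_perturb:
  assumes "x \<in> coord_space I" "z \<in> flat x"
  obtains \<delta> where "\<delta> > 0" "x + \<delta> *\<^sub>R z \<in> cone x"
proof -
  obtain \<delta> where \<delta>: "\<delta> > 0" and "\<forall>\<epsilon>. \<bar>\<epsilon>\<bar> \<le> \<delta> \<longrightarrow>
    (\<forall>u\<in>H. pairing I u x \<noteq> 0 \<longrightarrow> 0 < pairing I u x * pairing I u (x + \<epsilon> *\<^sub>R z))"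
    using perturbation[of x z] by blast
  then have *: "pairing I u x \<noteq> 0 \<Longrightarrow> 0 < pairing I u x * pairing I u (x + \<delta> *\<^sub>R z)" if "u \<in> H" for u
    using that by simp
  have "x + \<delta> *\<^sub>R z \<in> coord_space I"
    using assms flat_coord by (intro subspace_add subspace_scale) auto
  moreover have "0 \<le> pairing I u x * pairing I u (x + \<delta> *\<^sub>R z) \<and>
      (pairing I u x = 0 \<longrightarrow> pairing I u (x + \<delta> *\<^sub>R z) = 0)" if "u \<in> H" for u
    using *[OF that] that assms by (cases "pairing I u x = 0") (auto simp: flat_iff pairing_simps(1,3))
  ultimately have "x + \<delta> *\<^sub>R z \<in> cone x" unfolding cone_def by blast
  with \<delta> that show thesis by blast
qed

lemma lin_cone:
  assumes "x \<in> coord_space I"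
  shows "lin (cone x) = flat x"
proof
  show "lin (cone x) \<subseteq> flat x"
    unfolding lin_def using cone_subset_flat
    by (intro span_minimal) (auto intro!: subspace_diff)
  show "flat x \<subseteq> lin (cone x)"
  proof
    fix z assume "z \<in> flat x"
    then obtain \<delta> where \<delta>: "\<delta> > 0" "x + \<delta> *\<^sub>R z \<in> cone x"
      using cone_perturb[OF assms] by blast
    have "(x + \<delta> *\<^sub>R z) - x \<in> lin (cone x)"
      unfolding lin_def using \<delta>(2) self_in_cone[OF assms] by (intro span_base) blast
    then have "\<delta> *\<^sub>R z \<in> lin (cone x)" by (simp only: add_diff_cancel_left')
    then have "inverse \<delta> *\<^sub>R \<delta> *\<^sub>R z \<in> lin (cone x)" unfolding lin_def by (rule span_scale)
    moreover have "inverse \<delta> *\<^sub>R \<delta> *\<^sub>R z = z"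
      using \<delta>(1) by (simp only: scaleR_scaleR left_inverse scaleR_one less_imp_neq[symmetric] not_False_eq_True)
    ultimately show "z \<in> lin (cone x)" by (simp only:)
  qed
qed

lemma pdim_cone: "x \<in> coord_space I \<Longrightarrow> pdim (cone x) = dim (flat x)"
  by (simp add: pdim_def lin_cone)

lemma rational_polyhedron_cone: "rational_polyhedron I (cone x)"
proof -
  let ?P = "(\<lambda>u. (u, 0::real)) ` {u \<in> H. pairing I u x \<le> 0} \<union>
    (\<lambda>u. (- u, 0)) ` {u \<in> H. pairing I u x \<ge> 0}"
  have neg: "pairing I (- u) y = - pairing I u y" for u y
    by (simp add: pairing_commute[of I _ y] pairing_simps)
  have "- u \<in> int_lattice I" if "u \<in> H" for u
    using int_lattice_closed(3)[of "-1" u I] that H_int by auto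
  then have "\<forall>(u, c) \<in> ?P. u \<in> int_lattice I" using H_int by auto
  moreover have "finite ?P" using finite_H by simp
  moreover have "cone x = {y \<in> coord_space I. \<forall>(u, c) \<in> ?P. (\<Sum>k\<in>I. u k * y k) \<le> c}"
  proof -
    have "(\<forall>(u, c) \<in> ?P. (\<Sum>k\<in>I. u k * y k) \<le> c) \<longleftrightarrow>
        (\<forall>u\<in>H. 0 \<le> pairing I u x * pairing I u y \<and> (pairing I u x = 0 \<longrightarrow> pairing I u y = 0))" for y
    proof -
      have "(\<forall>(u, c) \<in> ?P. (\<Sum>k\<in>I. u k * y k) \<le> c) \<longleftrightarrow>
          (\<forall>u\<in>H. (pairing I u x \<le> 0 \<longrightarrow> pairing I u y \<le> 0) \<and> (pairing I u x \<ge> 0 \<longrightarrow> pairing I (-u) y \<le> 0))"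
        unfolding pairing_def by blast
      also have "\<dots> \<longleftrightarrow> (\<forall>u\<in>H. 0 \<le> pairing I u x * pairing I u y \<and> (pairing I u x = 0 \<longrightarrow> pairing I u y = 0))"
        unfolding neg by (intro ball_cong) (auto simp: zero_le_mult_iff)
      finally show ?thesis .
    qed
    then show ?thesis unfolding cone_def by presburger
  qed
  ultimately show ?thesis unfolding rational_polyhedron_def by blast
qed

lemma finite_cones: "finite (range cone)"
proof (rule finite_subset)
  let ?c = "\<lambda>(P, N). {y \<in> coord_space I. \<forall>u\<in>H.
    (if u \<in> P then 0 \<le> pairing I u y else if u \<in> N then pairing I u y \<le> 0 else pairing I u y = 0)}"
  have "cone x = ?c ({u \<in> H. pairing I u x > 0}, {u \<in> H. pairing I u x < 0})" for x
    unfolding cone_def prod.case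
    by (intro Collect_cong conj_cong refl ball_cong) (auto simp: zero_le_mult_iff)
  moreover have "({u \<in> H. pairing I u x > 0}, {u \<in> H. pairing I u x < 0}) \<in> Pow H \<times> Pow H" for x
    by auto
  ultimately show "range cone \<subseteq> ?c ` (Pow H \<times> Pow H)" by blast
  show "finite (?c ` (Pow H \<times> Pow H))" using finite_H by simp
qed

lemma cone_face_of:
  assumes "y \<in> cone x"
  shows "cone y face_of cone x"
  unfolding face_of_def
proof (intro conjI ballI impI cone_mono[OF assms] convex_cone)
  have *: "a \<in> cone y" if ab: "a \<in> cone x" "b \<in> cone x" "(1 - t) *\<^sub>R a + t *\<^sub>R b \<in> cone y"
    and t: "0 < t" "t < 1" for a b t
  proof -
    have "0 \<le> pairing I u y * pairing I u a \<and> (pairing I u y = 0 \<longrightarrow> pairing I u a = 0)"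
      if u: "u \<in> H" for u
    proof (cases "pairing I u y = 0")
      case False
      then show ?thesis using cone_same_sign[OF assms ab(1) u] by simp
    next
      case True
      then have eq: "(1 - t) * pairing I u a + t * pairing I u b = 0"
        using ab(3) u by (auto simp: cone_def pairing_simps)
      have "(pairing I u a \<ge> 0 \<and> pairing I u b \<ge> 0) \<or> (pairing I u a \<le> 0 \<and> pairing I u b \<le> 0)"
        using cone_same_sign[OF ab(1,2) u] by (auto simp: zero_le_mult_iff)
      then have "pairing I u a = 0"
      proof
        assume "pairing I u a \<ge> 0 \<and> pairing I u b \<ge> 0"
        then show ?thesis using t eq add_nonneg_eq_0_iff[of "(1 - t) * pairing I u a" "t * pairing I u b"] by auto
      next
        assume "pairing I u a \<le> 0 \<and> pairing I u b \<le> 0"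
        then have "(1 - t) * pairing I u a \<le> 0" "t * pairing I u b \<le> 0"
          using t by (auto simp: mult_le_0_iff)
        then have "(1 - t) * pairing I u a = 0" using eq by linarith
        then show ?thesis using t by simp
      qed
      then show ?thesis using True by simp
    qed
    then show ?thesis using ab(1) unfolding cone_def by blast
  qed
  fix a b z assume ab: "a \<in> cone x" "b \<in> cone x" and z: "z \<in> cone y" "z \<in> open_segment a b"
  then obtain t where t: "0 < t" "t < 1" "z = (1 - t) *\<^sub>R a + t *\<^sub>R b"
    by (auto simp: in_segment)
  show "a \<in> cone y" using *[of a b t] ab z t by blast
  have "z = (1 - (1 - t)) *\<^sub>R b + (1 - t) *\<^sub>R a" using t(3) by (simp only: diff_diff_eq2 add.commute add_diff_cancel_left')
  note zeq = this[symmetric]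
  have "(1 - (1 - t)) *\<^sub>R b + (1 - t) *\<^sub>R a \<in> cone y" unfolding zeq by (rule z(1))
  from *[OF ab(2,1) this] t(1,2) show "b \<in> cone y" by simp
qed

text \<open>
  A point of \<open>F\<close> off as many hyperplanes as possible works: its midpoint with any \<open>z \<in> F\<close> is off
  all hyperplanes that either point is off, because both points are in one cell and nothing cancels.
  So \<open>z\<close> lies on every hyperplane through the chosen point.
\<close>

lemma generic_point:
  assumes F: "F \<subseteq> cone x" "F \<noteq> {}" "convex F"
  obtains y where "y \<in> F" "F \<subseteq> cone y"
proof -
  define N where "N y = {u \<in> H. pairing I u y \<noteq> 0}" for y
  have fin: "finite (N y)" for y using finite_H by (simp add: N_def)
  have bound: "\<forall>y. y \<in> F \<longrightarrow> card (N y) < Suc (card H)"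
    using finite_H by (auto simp: N_def less_Suc_eq_le intro: card_mono)
  obtain y0 where "y0 \<in> F" using F(2) by blast
  from ex_has_greatest_nat[where P = "\<lambda>y. y \<in> F" and f = "\<lambda>y. card (N y)", OF this bound]
  obtain y where y: "y \<in> F" "\<And>z. z \<in> F \<Longrightarrow> card (N z) \<le> card (N y)" by blast
  have "z \<in> cone y" if z: "z \<in> F" for z
  proof -
    let ?w = "(1/2) *\<^sub>R y + (1/2) *\<^sub>R z"
    have w: "?w \<in> F" using F(3) y(1) z by (rule convexD) auto
    have sign: "0 \<le> pairing I u y * pairing I u z" if "u \<in> H" for u
      using F(1) y(1) z that by (intro cone_same_sign[of _ x]) auto
    have "pairing I u ?w = 0 \<longleftrightarrow> pairing I u y = 0 \<and> pairing I u z = 0" if "u \<in> H" for u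
      using sign[OF that] by (auto simp: pairing_simps(1,3) zero_le_mult_iff)
    then have "N ?w = N y \<union> N z" by (auto simp: N_def)
    moreover have "N ?w = N y"
      using y(2)[OF w] fin by (intro card_seteq[symmetric]) (auto simp: calculation)
    ultimately have "N z \<subseteq> N y" by blast
    then show ?thesis
      using sign z F(1) cone_coord by (auto simp: N_def cone_def)
  qed
  with y(1) that show thesis by blast
qed

text \<open>
  A face contains a generic point \<open>y\<close> of itself, and \<open>y\<close> can be moved a little beyond itself, away from
  any \<open>z\<close> in its cell.  Thus \<open>y\<close> is inside a segment with end point \<open>z\<close>, which forces \<open>z\<close> into the face.
\<close>

lemma face_of_cone:
  assumes "F face_of cone x" "F \<noteq> {}"
  obtains y where "y \<in> cone x" "F = cone y"
proof -
  have sub: "F \<subseteq> cone x" "convex F" using assms by (auto simp: face_of_def)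
  then obtain y where y: "y \<in> F" "F \<subseteq> cone y" using generic_point assms(2) by metis
  have yx: "y \<in> cone x" and yc: "y \<in> coord_space I" using y sub cone_coord by auto
  have "z \<in> F" if z: "z \<in> cone y" for z
  proof (cases "z = y")
    case False
    have "y - z \<in> flat y" using z yc cone_subset_flat self_in_cone by (intro subspace_diff) auto
    then obtain \<delta> where \<delta>: "\<delta> > 0" "y + \<delta> *\<^sub>R (y - z) \<in> cone y"
      using cone_perturb[OF yc] by blast
    define w where "w = y + \<delta> *\<^sub>R (y - z)"
    have t: "0 < inverse (1 + \<delta>)" "inverse (1 + \<delta>) < 1"
      using \<delta>(1) by (auto simp: inverse_less_1_iff)
    have "y = (1 - inverse (1 + \<delta>)) *\<^sub>R z + inverse (1 + \<delta>) *\<^sub>R w"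
    proof
      fix k
      have "(1 + \<delta>) * y k = \<delta> * z k + w k" by (simp add: w_def algebra_simps)
      moreover have "y k = (1 + \<delta>) * y k / (1 + \<delta>)" using \<delta>(1) by simp
      ultimately have "y k = \<delta> / (1 + \<delta>) * z k + w k / (1 + \<delta>)" by (simp add: add_divide_distrib)
      moreover have "1 - inverse (1 + \<delta>) = \<delta> / (1 + \<delta>)" using \<delta>(1) by (simp add: field_simps)
      ultimately show "y k = ((1 - inverse (1 + \<delta>)) *\<^sub>R z + inverse (1 + \<delta>) *\<^sub>R w) k"
        by (simp add: divide_inverse mult.commute)
    qed
    moreover have "z \<noteq> w"
    proof
      assume "z = w"
      then have "y = z" using calculation by (simp only: scaleR_left_distrib[symmetric]) simp
      with False show False by simp
    qed
    ultimately have "y \<in> open_segment z w" unfolding in_segment using t by blast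
    moreover have "z \<in> cone x" "w \<in> cone x" using z \<delta>(2) cone_mono[OF yx] by (auto simp: w_def)
    ultimately show ?thesis using assms(1) y(1) unfolding face_of_def by blast
  qed (use y in simp)
  with y yx that show thesis by blast
qed

lemma cone_inter:
  obtains y where "y \<in> cone x" "y \<in> cone x'" "cone x \<inter> cone x' = cone y"
proof -
  have "cone x \<inter> cone x' \<noteq> {}" using zero_in_cone by blast
  then obtain y where y: "y \<in> cone x \<inter> cone x'" "cone x \<inter> cone x' \<subseteq> cone y"
    using generic_point[of "cone x \<inter> cone x'" x] convex_cone convex_Int by (metis Int_lower1)
  then have "cone x \<inter> cone x' = cone y" using cone_mono by blast
  with y that show thesis by blast
qed

end

text \<open>A facet spans one of the spaces, so a weight that depends on the span only is constant on each of them.\<close>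

definition subspace_fan :: "('k set) \<Rightarrow> ('k \<Rightarrow> real) set \<Rightarrow> ('k \<Rightarrow> real) set set \<Rightarrow> (('k \<Rightarrow> real) set \<Rightarrow> nat) \<Rightarrow> 'k wcomplex"
  where "subspace_fan I H \<W> \<omega> = \<lparr> cells = arrangement.cone I H ` \<Union>\<W>, wt = (\<lambda>\<sigma>. \<omega> (lin \<sigma>)) \<rparr>"

context arrangement
begin

lemma flat_rational: "flat x = span (flat x \<inter> int_lattice I)"
  unfolding flat_def using finite_I finite_H H_int by (intro solutions_integral_span) auto

lemma lat_cone: "x \<in> coord_space I \<Longrightarrow> lat I (cone x) = flat x \<inter> int_lattice I"
  by (simp add: lat_def lin_cone)

lemma separating_form:
  assumes "t \<in> cone y" "y \<in> coord_space I" "dim (flat t) < dim (flat y)"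
  obtains u where "u \<in> H" "pairing I u t = 0" "pairing I u y \<noteq> 0"
proof -
  have "\<not> flat y \<subseteq> flat t"
  proof
    assume "flat y \<subseteq> flat t"
    then have "flat y = flat t" using flat_mono[OF assms(1)] by blast
    then show False using assms(3) by simp
  qed
  then obtain z where z: "z \<in> flat y" "z \<notin> flat t" by blast
  then obtain u where "u \<in> H" "pairing I u t = 0" "pairing I u z \<noteq> 0"
    unfolding flat_iff by blast
  then show thesis using z(1) that[of u] unfolding flat_iff by blast
qed

lemma flat_facet_eq:
  assumes t: "t \<in> cone y" "y \<in> coord_space I" "dim (flat t) + 1 = dim (flat y)"
    and u: "u \<in> H" "pairing I u t = 0" "pairing I u y \<noteq> 0"
  shows "flat t = {z \<in> flat y. pairing I u z = 0}"
proof (rule ccontr)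
  let ?R = "{z \<in> flat y. pairing I u z = 0}"
  have R: "subspace ?R" using subspace_flat[of y] unfolding subspace_def by (simp add: pairing_simps)
  assume "flat t \<noteq> ?R"
  moreover have "flat t \<subseteq> ?R" using flat_mono[OF t(1)] u by (auto simp: flat_iff)
  ultimately have "dim (flat t) < dim ?R"
    using R flat_coord[of y] by (intro dim_less[OF finite_I]) auto
  moreover have "y \<in> flat y" using t(2) by (simp add: flat_iff)
  then have "dim ?R < dim (flat y)"
    using R flat_coord[of y] u(3) by (intro dim_less[OF finite_I]) auto
  ultimately show False using t(3) by simp
qed

text \<open>
  A form \<open>u\<close> that cuts out the span of the face at \<open>t\<close> is integer valued on the lattice.  Division with remainder
  shows that a lattice vector with least nonzero value generates modulo the kernel.
\<close>

lemma lattice_generator: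
  assumes t: "t \<in> cone y" "y \<in> coord_space I" "dim (flat t) + 1 = dim (flat y)"
  obtains v where "flat y \<inter> int_lattice I = {of_int z *\<^sub>R v + w | z w. w \<in> flat t \<inter> int_lattice I}"
proof -
  obtain u where u: "u \<in> H" "pairing I u t = 0" "pairing I u y \<noteq> 0"
    using separating_form[OF t(1,2)] t(3) by auto
  note eq = flat_facet_eq[OF t u]
  let ?L = "flat y \<inter> int_lattice I"
  have ex: "\<exists>v. v \<in> ?L \<and> pairing I u v \<noteq> 0"
  proof (rule ccontr)
    assume "\<not> ?thesis"
    then have "?L \<subseteq> flat t" unfolding eq by blast
    then have "span ?L \<subseteq> flat t" by (intro span_minimal) auto
    then have "flat y \<subseteq> flat t" using flat_rational[of y] by simp
    then show False using flat_mono[OF t(1)] t(3) by (metis Suc_eq_plus1 n_not_Suc_n subset_antisym)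
  qed
  have int: "pairing I u v \<in> \<int>" if "v \<in> ?L" for v
    using that u(1) H_int by (auto intro: pairing_int)
  obtain v where v: "v \<in> ?L" "pairing I u v \<noteq> 0"
    and least: "\<And>w. w \<in> ?L \<Longrightarrow> pairing I u w \<noteq> 0 \<Longrightarrow>
      nat \<bar>\<lfloor>pairing I u v\<rfloor>\<bar> \<le> nat \<bar>\<lfloor>pairing I u w\<rfloor>\<bar>"
    using ex_has_least_nat[of "\<lambda>v. v \<in> ?L \<and> pairing I u v \<noteq> 0" _ "\<lambda>v. nat \<bar>\<lfloor>pairing I u v\<rfloor>\<bar>"] ex
    by metis
  obtain b :: int where b: "pairing I u v = of_int b" using int[OF v(1)] by (auto elim: Ints_cases)
  have "x \<in> {of_int z *\<^sub>R v + w | z w. w \<in> flat t \<inter> int_lattice I}" if x: "x \<in> ?L" for x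
  proof -
    obtain a :: int where a: "pairing I u x = of_int a" using int[OF x] by (auto elim: Ints_cases)
    define w where "w = x - of_int (a div b) *\<^sub>R v"
    have w: "w \<in> ?L" unfolding w_def using x v(1)
      by (intro IntI subspace_diff subspace_scale int_lattice_closed) auto
    have "pairing I u w = of_int (a - a div b * b)"
      unfolding w_def pairing_simps a b by simp
    then have pw: "pairing I u w = of_int (a mod b)" by (simp add: minus_div_mult_eq_mod)
    have "pairing I u w = 0"
    proof (rule ccontr)
      assume "pairing I u w \<noteq> 0"
      then have "nat \<bar>b\<bar> \<le> nat \<bar>a mod b\<bar>" using least[OF w] by (simp add: pw b)
      moreover have "b \<noteq> 0" using v(2) b by simp
      then have "\<bar>a mod b\<bar> < \<bar>b\<bar>" by (rule abs_mod_less)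
      ultimately show False by linarith
    qed
    then have "w \<in> flat t \<inter> int_lattice I" using w unfolding eq by blast
    moreover have "x = of_int (a div b) *\<^sub>R v + w" by (simp add: w_def)
    ultimately show ?thesis by blast
  qed
  moreover have "of_int z *\<^sub>R v + w \<in> ?L" if "w \<in> flat t \<inter> int_lattice I" for z w
    using that v(1) flat_mono[OF t(1)]
    by (intro IntI subspace_add subspace_scale int_lattice_closed) auto
  ultimately have "?L = {of_int z *\<^sub>R v + w | z w. w \<in> flat t \<inter> int_lattice I}" by blast
  then show thesis by (rule that)
qed

lemma generator_uminus:
  fixes v :: "'k \<Rightarrow> real"
  shows "{of_int z *\<^sub>R (- v) + w | z w. w \<in> L} = {of_int z *\<^sub>R v + w | z w. w \<in> L}"
proof -
  have "of_int z *\<^sub>R (- v) + w = of_int (- z) *\<^sub>R v + w"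
    "of_int z *\<^sub>R v + w = of_int (- z) *\<^sub>R (- v) + w" for z w
    by simp_all
  then show ?thesis by blast
qed

text \<open>If the generator were parallel to the face, so would be the whole lattice and thus its span.\<close>

lemma generator_transverse:
  assumes t: "t \<in> cone y" "y \<in> coord_space I" "dim (flat t) + 1 = dim (flat y)"
    and u: "u \<in> H" "pairing I u t = 0" "pairing I u y \<noteq> 0"
    and v: "flat y \<inter> int_lattice I = {of_int z *\<^sub>R v + w | z w. w \<in> flat t \<inter> int_lattice I}"
  shows "v \<in> flat y" "pairing I u v \<noteq> 0"
proof -
  have "of_int 1 *\<^sub>R v + 0 \<in> flat y \<inter> int_lattice I"
    unfolding v using subspace_0[OF subspace_flat, of t] int_lattice_closed(4) by blast
  then show vy: "v \<in> flat y" by simp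
  show "pairing I u v \<noteq> 0"
  proof
    assume "pairing I u v = 0"
    then have "flat y \<inter> int_lattice I \<subseteq> flat t"
      unfolding v using vy flat_facet_eq[OF t u]
      by (auto intro!: subspace_add subspace_scale simp: pairing_simps)
    then have "span (flat y \<inter> int_lattice I) \<subseteq> flat t" by (intro span_minimal) auto
    then have "y \<in> flat t" using flat_rational[of y] t(2) by (auto simp: flat_iff)
    then show False using u by (simp add: flat_iff)
  qed
qed

text \<open>
  Inward pointing is detected by the sign of a separating form.  Hence exactly one of \<open>v\<close> and \<open>- v\<close>
  is primitive, and passing to the cone on the other side of the face interchanges them.
\<close>

lemma primitive_generator_sign:
  assumes t: "t \<in> cone y" "y \<in> coord_space I" "dim (flat t) + 1 = dim (flat y)"
    and u: "u \<in> H" "pairing I u t = 0" "pairing I u y \<noteq> 0"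
    and v: "flat y \<inter> int_lattice I = {of_int z *\<^sub>R v + w | z w. w \<in> flat t \<inter> int_lattice I}"
  shows "primitive_generator I (cone y) (cone t) v \<longleftrightarrow> 0 < pairing I u y * pairing I u v"
proof -
  note eq = flat_facet_eq[OF t u] and tr = generator_transverse[OF t u v]
  have tc: "t \<in> coord_space I" using t(1) cone_coord by blast
  have zero_t: "pairing I u z = 0" if "z \<in> cone t" for z
    using that u by (auto simp: cone_def)
  show ?thesis
  proof
    assume "primitive_generator I (cone y) (cone t) v"
    then obtain a b c where abc: "a \<in> cone y" "b \<in> cone t" "c > 0" "a - b - c *\<^sub>R v \<in> flat t"
      by (auto simp: primitive_generator_def lin_cone[OF tc])
    then have "pairing I u (a - b - c *\<^sub>R v) = 0" unfolding eq by blast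
    then have "pairing I u a = c * pairing I u v" using zero_t[OF abc(2)] by (simp add: pairing_simps)
    moreover have "0 \<le> pairing I u y * pairing I u a" using abc(1) u(1) by (auto simp: cone_def)
    ultimately have "0 \<le> c * (pairing I u y * pairing I u v)" by (simp add: mult.left_commute)
    then have "0 \<le> pairing I u y * pairing I u v" using abc(3) by (simp add: zero_le_mult_iff)
    then show "0 < pairing I u y * pairing I u v" using u(3) tr(2) by (simp add: less_le)
  next
    assume pos: "0 < pairing I u y * pairing I u v"
    define c where "c = pairing I u y / pairing I u v"
    have "c > 0" using pos by (auto simp: c_def zero_less_divide_iff zero_less_mult_iff)
    have "y \<in> flat y" using t(2) by (simp add: flat_iff)
    then have "y - 0 - c *\<^sub>R v \<in> flat y"
      using tr(1) subspace_0[OF subspace_flat] by (intro subspace_diff subspace_scale) auto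
    moreover have "pairing I u (y - 0 - c *\<^sub>R v) = 0"
      unfolding pairing_simps using tr(2) by (simp add: c_def)
    ultimately have "y - 0 - c *\<^sub>R v \<in> flat t" unfolding eq by blast
    then have "\<exists>x\<in>cone y. \<exists>y\<in>cone t. \<exists>c>0. x - y - c *\<^sub>R v \<in> lin (cone t)"
      using self_in_cone[OF t(2)] zero_in_cone[of t] \<open>c > 0\<close> lin_cone[OF tc] by blast
    then show "primitive_generator I (cone y) (cone t) v"
      unfolding primitive_generator_def lat_cone[OF t(2)] lat_cone[OF tc] using v by blast
  qed
qed

text \<open>
  Subtracting a small multiple of \<open>y\<close> from the point \<open>t\<close> of the face reverses exactly the signs
  that vanish on the face: \<open>y'\<close> is in the cell on the other side.
\<close>

lemma reflected_point:
  assumes "t \<in> cone y" "y \<in> coord_space I"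
  obtains y' where "y' \<in> span {t, y}" 
    "\<And>u. u \<in> H \<Longrightarrow> sgn (pairing I u y') = (if pairing I u t = 0 then - sgn (pairing I u y) else sgn (pairing I u y))"
proof -
  obtain \<delta> where \<delta>: "\<delta> > 0" and "\<forall>\<epsilon>. \<bar>\<epsilon>\<bar> \<le> \<delta> \<longrightarrow>
    (\<forall>u\<in>H. pairing I u t \<noteq> 0 \<longrightarrow> 0 < pairing I u t * pairing I u (t + \<epsilon> *\<^sub>R y))"
    using perturbation[of t y] by blast
  then have pos: "0 < pairing I u t * pairing I u (t + (- \<delta>) *\<^sub>R y)"
    if "u \<in> H" "pairing I u t \<noteq> 0" for u
    using that by (metis abs_minus_cancel abs_of_pos order_refl)
  have "sgn (pairing I u (t + (- \<delta>) *\<^sub>R y)) = (if pairing I u t = 0 then - sgn (pairing I u y) else sgn (pairing I u y))"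
    if u: "u \<in> H" for u
  proof (cases "pairing I u t = 0")
    case True
    then show ?thesis using \<delta> unfolding pairing_simps by (simp add: sgn_mult)
  next
    case False
    have "0 \<le> pairing I u y * pairing I u t" "pairing I u y = 0 \<longrightarrow> pairing I u t = 0"
      using assms u by (auto simp: cone_def)
    then show ?thesis
      using pos[OF u False] False by (auto simp: sgn_if zero_less_mult_iff zero_le_mult_iff)
  qed
  moreover have "t + (- \<delta>) *\<^sub>R y \<in> span {t, y}"
    by (intro span_add span_scale span_base) auto
  ultimately show thesis using that by blast
qed

end

locale flat_arrangement = arrangement I H for I :: "'k set" and H +
  fixes \<W> :: "('k \<Rightarrow> real) set set" and e :: nat and \<omega> :: "('k \<Rightarrow> real) set \<Rightarrow> nat"
  assumes nonempty: "\<W> \<noteq> {}"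
    and flats: "\<And>W. W \<in> \<W> \<Longrightarrow> \<exists>K\<subseteq>H. W = solutions I K"
    and dims: "\<And>W. W \<in> \<W> \<Longrightarrow> dim W = e"
    and weight_pos: "\<And>U. 0 < \<omega> U"
begin

abbreviation "X \<equiv> \<Union>\<W>"
abbreviation "\<Gamma> \<equiv> subspace_fan I H \<W> \<omega>"

lemma cells_eq: "cells \<Gamma> = cone ` X" and wt_eq: "wt \<Gamma> \<sigma> = \<omega> (lin \<sigma>)"
  by (simp_all add: subspace_fan_def)

lemma X_coord: "X \<subseteq> coord_space I"
  using flats solutions_subset_coord by fastforce

lemma subspace_W: "W \<in> \<W> \<Longrightarrow> subspace W"
  using flats by fastforce

lemma flat_subset_W: "W \<in> \<W> \<Longrightarrow> x \<in> W \<Longrightarrow> flat x \<subseteq> W"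
  using flats[of W] by (auto simp: flat_def solutions_def)

lemma cone_subset_X: "x \<in> X \<Longrightarrow> cone x \<subseteq> X"
  using cone_subset_flat[of x] flat_subset_W by blast

lemma dim_flat_le: "W \<in> \<W> \<Longrightarrow> x \<in> W \<Longrightarrow> flat x = W \<or> dim (flat x) < e"
  using dim_less[OF finite_I _ subspace_flat[of x] subspace_W[of W]] flat_subset_W[of W x] dims[of W] X_coord
  by blast

text \<open>
  Among the points of \<open>W\<close> whose cell contains \<open>x\<close>, one off as many hyperplanes as possible has a
  full-dimensional cell: otherwise some \<open>z \<in> W\<close> would be off a further hyperplane, and moving
  slightly in direction \<open>z\<close> would improve the point.
\<close>

lemma generic_point_W:
  assumes "W \<in> \<W>" "x \<in> W"
  obtains y where "y \<in> W" "x \<in> cone y" "flat y = W"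
proof -
  define N where "N y = {u \<in> H. pairing I u y \<noteq> 0}" for y
  have fin: "finite (N y)" for y using finite_H by (simp add: N_def)
  have WI: "W \<subseteq> coord_space I" using assms X_coord by blast
  have "\<forall>y. y \<in> W \<and> x \<in> cone y \<longrightarrow> card (N y) < Suc (card H)"
    using finite_H by (auto simp: N_def less_Suc_eq_le intro: card_mono)
  moreover have "x \<in> W \<and> x \<in> cone x" using assms WI self_in_cone by blast
  ultimately obtain y where y: "y \<in> W" "x \<in> cone y"
      "\<And>z. z \<in> W \<Longrightarrow> x \<in> cone z \<Longrightarrow> card (N z) \<le> card (N y)"
    using ex_has_greatest_nat[where P = "\<lambda>y. y \<in> W \<and> x \<in> cone y" and f = "\<lambda>y. card (N y)"] by metis
  have "z \<in> flat y" if z: "z \<in> W" for z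
  proof (rule ccontr)
    assume "z \<notin> flat y"
    then obtain u where u: "u \<in> H" "pairing I u y = 0" "pairing I u z \<noteq> 0"
      using z WI unfolding flat_iff by blast
    obtain \<delta> where \<delta>: "\<delta> > 0" and *: "\<forall>\<epsilon>. \<bar>\<epsilon>\<bar> \<le> \<delta> \<longrightarrow>
      (\<forall>u\<in>H. pairing I u y \<noteq> 0 \<longrightarrow> 0 < pairing I u y * pairing I u (y + \<epsilon> *\<^sub>R z))"
      using perturbation[of y z] by blast
    define w where "w = y + \<delta> *\<^sub>R z"
    have w: "w \<in> W" unfolding w_def
      using y z subspace_W[OF assms(1)] by (intro subspace_add subspace_scale)
    have pos: "0 < pairing I u y * pairing I u w" if "u \<in> H" "pairing I u y \<noteq> 0" for u
      using * that \<delta> unfolding w_def by simp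
    have "0 \<le> pairing I u w * pairing I u y \<and> (pairing I u w = 0 \<longrightarrow> pairing I u y = 0)" if "u \<in> H" for u
      using pos[OF that] by (cases "pairing I u y = 0") (auto simp: mult.commute)
    then have "y \<in> cone w" using y(1) WI unfolding cone_def by blast
    then have "x \<in> cone w" using cone_mono y(2) by blast
    then have "card (N w) \<le> card (N y)" using y(3) w by blast
    moreover have "N y \<subseteq> N w" using pos by (force simp: N_def)
    moreover have "pairing I u w \<noteq> 0" unfolding w_def pairing_simps using u \<delta> by simp
    then have "u \<in> N w" "u \<notin> N y" using u by (auto simp: N_def)
    ultimately show False using fin[of w] by (metis card_seteq)
  qed
  then have "flat y = W" using flat_subset_W[OF assms(1) y(1)] by blast
  with y that show thesis by blast
qed

lemma pdim_cell: "x \<in> X \<Longrightarrow> pdim (cone x) = dim (flat x)"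
  using X_coord pdim_cone by blast

lemma finite_cone_image: "finite (cone ` Y)"
  using finite_cones by (rule finite_subset[rotated]) blast

lemma cdim_eq: "cdim \<Gamma> = e"
proof -
  have fin: "finite (pdim ` cells \<Gamma>)"
    unfolding cells_eq using finite_cone_image by (rule finite_imageI)
  obtain W where W: "W \<in> \<W>" using nonempty by blast
  then have "0 \<in> W" using subspace_W subspace_0 by blast
  then obtain y where y: "y \<in> W" "flat y = W" using generic_point_W[OF W] by blast
  then have yX: "y \<in> X" using W by blast
  have "pdim (cone y) = e" using pdim_cell[OF yX] dims[OF W] y(2) by simp
  then have "e \<in> pdim ` cells \<Gamma>" unfolding cells_eq using yX by blast
  moreover have "pdim (cone x) \<le> e" if x: "x \<in> X" for x
  proof -
    obtain W where "W \<in> \<W>" "x \<in> W" using x by blast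
    then show ?thesis using dim_flat_le[of W x] dims[of W] pdim_cell[OF x] by (metis less_imp_le order_refl)
  qed
  then have "n \<le> e" if "n \<in> pdim ` cells \<Gamma>" for n
    using that unfolding cells_eq by blast
  ultimately show ?thesis unfolding cdim_def by (intro Max_eqI fin) auto
qed

lemma facets_eq: "facets \<Gamma> = cone ` {y \<in> X. flat y \<in> \<W>}"
proof -
  have "dim (flat y) = e \<longleftrightarrow> flat y \<in> \<W>" if "y \<in> X" for y
    using that dim_flat_le dims by fastforce
  then have "pdim (cone y) = e \<longleftrightarrow> flat y \<in> \<W>" if "y \<in> X" for y
    using that pdim_cell[OF that] by metis
  then show ?thesis unfolding facets_def cdim_eq cells_eq by blast
qed

lemma supp_eq: "supp \<Gamma> = X"
  unfolding supp_def cells_eq using cone_subset_X self_in_cone X_coord by blast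

lemma complex: "polyhedral_complex I (cells \<Gamma>)"
  unfolding polyhedral_complex_def
proof (intro conjI ballI allI impI)
  show "finite (cells \<Gamma>)" unfolding cells_eq by (rule finite_cone_image)
next
  fix \<sigma> assume "\<sigma> \<in> cells \<Gamma>"
  then show "rational_polyhedron I \<sigma>" "\<sigma> \<noteq> {}"
    unfolding cells_eq using rational_polyhedron_cone zero_in_cone by blast+
next
  fix \<sigma> \<tau> assume "\<sigma> \<in> cells \<Gamma>" and \<tau>: "\<tau> face_of \<sigma> \<and> \<tau> \<noteq> {}"
  then obtain x where x: "x \<in> X" "\<sigma> = cone x" unfolding cells_eq by blast
  with \<tau> obtain y where "y \<in> cone x" "\<tau> = cone y" by (metis face_of_cone)
  then show "\<tau> \<in> cells \<Gamma>" unfolding cells_eq using cone_subset_X x by blast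
next
  fix \<sigma> \<sigma>' assume "\<sigma> \<in> cells \<Gamma>" "\<sigma>' \<in> cells \<Gamma>"
  then obtain x x' where x: "\<sigma> = cone x" "\<sigma>' = cone x'" unfolding cells_eq by blast
  obtain y where "y \<in> cone x" "y \<in> cone x'" "cone x \<inter> cone x' = cone y" by (rule cone_inter)
  then show "\<sigma> \<inter> \<sigma>' face_of \<sigma>" "\<sigma> \<inter> \<sigma>' face_of \<sigma>'" using x cone_face_of by metis+
qed

text \<open>
  Around a cell \<open>\<tau>\<close> of codimension one, reflection in \<open>\<tau>\<close> is an involution of the facets that preserves
  spans, hence weights.  The generators are chosen with one vector per span, up to sign, so that
  reflection negates them; the weighted sum \<open>S\<close> then satisfies \<open>S = - S\<close>.
\<close>

lemma balanced_fan: "balanced I \<Gamma>"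
  unfolding balanced_def cdim_eq
proof (intro ballI impI)
  fix \<tau> assume \<tau>: "\<tau> \<in> cells \<Gamma>" and dim_\<tau>: "pdim \<tau> + 1 = e"
  then obtain t where t: "t \<in> X" "\<tau> = cone t" unfolding cells_eq by blast
  have tc: "t \<in> coord_space I" using t X_coord by blast
  define A where "A = {\<sigma> \<in> facets \<Gamma>. \<tau> \<subseteq> \<sigma>}"
  have finA: "finite A"
    unfolding A_def facets_eq using finite_cone_image by (rule finite_subset[rotated]) blast
  define star where "star y \<longleftrightarrow> y \<in> X \<and> flat y \<in> \<W> \<and> t \<in> cone y" for y
  have A_iff: "\<sigma> \<in> A \<longleftrightarrow> (\<exists>y. star y \<and> \<sigma> = cone y)" for \<sigma>
    unfolding A_def facets_eq star_def t(2)
    using self_in_cone[OF tc] cone_mono[of t] by blast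
  have star: "y \<in> coord_space I" "t \<in> cone y" "dim (flat t) + 1 = dim (flat y)" if "star y" for y
    using that X_coord dims[of "flat y"] dim_\<tau> pdim_cell[OF t(1)] t(2) unfolding star_def by auto
  define generates where "generates U v \<longleftrightarrow>
    U \<inter> int_lattice I = {of_int z *\<^sub>R v + w | z w. w \<in> flat t \<inter> int_lattice I}" for U v
  define gen where "gen U = (SOME v. generates U v)" for U
  have gen: "generates (flat y) (gen (flat y))" if y: "star y" for y
    unfolding gen_def
  proof (rule someI_ex[of "generates (flat y)"])
    show "\<exists>v. generates (flat y) v"
      unfolding generates_def using lattice_generator[OF star(2,1,3)[OF y]] by metis
  qed
  define v where "v \<sigma> = (if primitive_generator I \<sigma> \<tau> (gen (lin \<sigma>)) then gen (lin \<sigma>) else - gen (lin \<sigma>))" for \<sigma>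
  have sep: "\<exists>u\<in>H. pairing I u t = 0 \<and> pairing I u y \<noteq> 0" if y: "star y" for y
  proof -
    have "dim (flat t) < dim (flat y)" using star(3)[OF y] by simp
    from separating_form[OF star(2,1)[OF y] this] show ?thesis by blast
  qed
  have v: "primitive_generator I (cone y) \<tau> (v (cone y))" if y: "star y" for y
  proof -
    obtain u where u: "u \<in> H" "pairing I u t = 0" "pairing I u y \<noteq> 0" using sep[OF y] by blast
    note s = star(2,1,3)[OF y]
    have g: "generates (flat y) (gen (flat y))" "generates (flat y) (- gen (flat y))"
      using gen[OF y] generator_uminus unfolding generates_def by metis+
    have "pairing I u (gen (flat y)) \<noteq> 0"
      using generator_transverse(2)[OF s u] g(1) unfolding generates_def by blast
    then have "0 < pairing I u y * pairing I u (gen (flat y)) \<or>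
        0 < pairing I u y * pairing I u (- gen (flat y))"
      unfolding pairing_simps using u(3) by (auto simp: zero_less_mult_iff mult_less_0_iff)
    then have "primitive_generator I (cone y) \<tau> (gen (flat y)) \<or>
        primitive_generator I (cone y) \<tau> (- gen (flat y))"
      unfolding t(2) using primitive_generator_sign[OF s u] g unfolding generates_def by blast
    then show ?thesis unfolding v_def lin_cone[OF s(2)] by auto
  qed
  have ex_opp: "\<exists>\<sigma>'. \<forall>y. star y \<and> \<sigma> = cone y \<longrightarrow> (\<exists>y'. star y' \<and> \<sigma>' = cone y' \<and>
     (\<forall>u\<in>H. sgn (pairing I u y') = (if pairing I u t = 0 then - sgn (pairing I u y) else sgn (pairing I u y))))" for \<sigma>
  proof (cases "\<exists>y. star y \<and> \<sigma> = cone y")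
    case True
    then obtain y where y: "star y" "\<sigma> = cone y" by blast
    obtain y' where y': "y' \<in> span {t, y}"
      "\<And>u. u \<in> H \<Longrightarrow> sgn (pairing I u y') = (if pairing I u t = 0 then - sgn (pairing I u y) else sgn (pairing I u y))"
      using reflected_point[OF star(2,1)[OF y(1)]] by blast
    have tz: "pairing I u y = 0 \<Longrightarrow> pairing I u t = 0" if "u \<in> H" for u
      using star(2)[OF y(1)] that by (auto simp: cone_def)
    have ker: "pairing I u y' = 0 \<longleftrightarrow> pairing I u y = 0" if "u \<in> H" for u
      using y'(2)[OF that] tz[OF that] by (metis neg_equal_0_iff_equal sgn_eq_0_iff)
    then have fl: "flat y' = flat y" by (intro Set.set_eqI) (simp add: flat_iff)
    have "{t, y} \<subseteq> flat y" using star(1,2)[OF y(1)] cone_subset_flat self_in_cone by blast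
    then have "span {t, y} \<subseteq> flat y" by (intro span_minimal) auto
    then have y'y: "y' \<in> flat y" using y'(1) by blast
    have "t \<in> cone y'"
    proof -
      have "0 \<le> pairing I u y' * pairing I u t \<and> (pairing I u y' = 0 \<longrightarrow> pairing I u t = 0)" if u: "u \<in> H" for u
      proof (cases "pairing I u t = 0")
        case False
        then have "sgn (pairing I u y') = sgn (pairing I u y)" using y'(2)[OF u] by simp
        moreover have "0 \<le> pairing I u y * pairing I u t" "pairing I u y \<noteq> 0"
          using star(2)[OF y(1)] u False by (auto simp: cone_def)
        ultimately show ?thesis by (auto simp: sgn_if zero_le_mult_iff split: if_splits)
      qed simp
      then show ?thesis using tc unfolding cone_def by blast
    qed
    then have sy': "star y'" using y(1) y'y unfolding star_def fl by blast
    have "sgn (pairing I u y') = (if pairing I u t = 0 then - sgn (pairing I u z) else sgn (pairing I u z))"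
      if "star z" "\<sigma> = cone z" "u \<in> H" for z u
      using y'(2)[OF that(3)] sgn_eq_of_cone_eq[of y z u] that y star(1) by metis
    then show ?thesis using sy' by blast
  qed blast
  then obtain opp where opp: "\<And>\<sigma> y. star y \<Longrightarrow> \<sigma> = cone y \<Longrightarrow> \<exists>y'. star y' \<and> opp \<sigma> = cone y' \<and>
     (\<forall>u\<in>H. sgn (pairing I u y') = (if pairing I u t = 0 then - sgn (pairing I u y) else sgn (pairing I u y)))"
    by metis
  have opp_A: "opp \<sigma> \<in> A" "opp (opp \<sigma>) = \<sigma>" "lin (opp \<sigma>) = lin \<sigma>" "v (opp \<sigma>) = - v \<sigma>" if "\<sigma> \<in> A" for \<sigma>
  proof -
    obtain y where y: "star y" "\<sigma> = cone y" using \<open>\<sigma> \<in> A\<close> A_iff by blast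
    obtain y' where y': "star y'" "opp \<sigma> = cone y'"
      "\<And>u. u \<in> H \<Longrightarrow> sgn (pairing I u y') = (if pairing I u t = 0 then - sgn (pairing I u y) else sgn (pairing I u y))"
      using opp[OF y] by blast
    obtain y'' where y'': "star y''" "opp (opp \<sigma>) = cone y''"
      "\<And>u. u \<in> H \<Longrightarrow> sgn (pairing I u y'') = (if pairing I u t = 0 then - sgn (pairing I u y') else sgn (pairing I u y'))"
      using opp[OF y'(1,2)] by blast
    show "opp \<sigma> \<in> A" using y' A_iff by blast
    have "sgn (pairing I u y'') = sgn (pairing I u y)" if "u \<in> H" for u
      using y''(3)[OF that] y'(3)[OF that] by auto
    then show "opp (opp \<sigma>) = \<sigma>" using cone_cong[of y'' y] y'' y by simp
    have "pairing I u y' = 0 \<longleftrightarrow> pairing I u y = 0" if "u \<in> H" for u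
      using y'(3)[OF that] by (metis neg_equal_0_iff_equal sgn_eq_0_iff)
    then have fl: "flat y' = flat y" by (intro Set.set_eqI) (simp add: flat_iff)
    then show lin: "lin (opp \<sigma>) = lin \<sigma>" using y y' star(1) lin_cone by simp
    obtain u where u: "u \<in> H" "pairing I u t = 0" "pairing I u y \<noteq> 0" using sep[OF y(1)] by blast
    have neg: "sgn (pairing I u y') = - sgn (pairing I u y)" using y'(3) u by simp
    then have u': "pairing I u y' \<noteq> 0" using u(3) by (auto simp: sgn_0_0)
    have g: "generates (flat y) (gen (flat y))" using gen[OF y(1)] .
    have lin_y: "lin \<sigma> = flat y" using y(2) lin_cone[OF star(1)[OF y(1)]] by simp
    have nz: "pairing I u (gen (flat y)) \<noteq> 0"
      using generator_transverse(2)[OF star(2,1,3)[OF y(1)] u] g unfolding generates_def by blast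
    have "primitive_generator I (cone y') \<tau> (gen (flat y)) \<longleftrightarrow> 0 < pairing I u y' * pairing I u (gen (flat y))"
      unfolding t(2)
      using primitive_generator_sign[OF star(2,1,3)[OF y'(1)] u(1,2) u', of "gen (flat y)"] g fl
      unfolding generates_def by simp
    moreover have "primitive_generator I (cone y) \<tau> (gen (flat y)) \<longleftrightarrow> 0 < pairing I u y * pairing I u (gen (flat y))"
      unfolding t(2)
      using primitive_generator_sign[OF star(2,1,3)[OF y(1)] u, of "gen (flat y)"] g
      unfolding generates_def by simp
    moreover have "0 < pairing I u y' * pairing I u (gen (flat y)) \<longleftrightarrow> \<not> 0 < pairing I u y * pairing I u (gen (flat y))"
      using neg u(3) u' nz by (auto simp: sgn_if zero_less_mult_iff split: if_splits)
    ultimately have "primitive_generator I (opp \<sigma>) \<tau> (gen (lin \<sigma>)) \<longleftrightarrow> \<not> primitive_generator I \<sigma> \<tau> (gen (lin \<sigma>))"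
      unfolding y'(2) lin_y y(2)[symmetric] by blast
    then show "v (opp \<sigma>) = - v \<sigma>" unfolding v_def lin by simp
  qed
  define S where "S = (\<Sum>\<sigma>\<in>A. real (wt \<Gamma> \<sigma>) *\<^sub>R v \<sigma>)"
  have "S = (\<Sum>\<sigma>\<in>A. real (wt \<Gamma> (opp \<sigma>)) *\<^sub>R v (opp \<sigma>))"
    unfolding S_def by (rule sum.reindex_bij_witness[of A opp opp]) (simp_all only: opp_A)
  also have "\<dots> = (\<Sum>\<sigma>\<in>A. - (real (wt \<Gamma> \<sigma>) *\<^sub>R v \<sigma>))"
    by (intro sum.cong refl) (simp only: opp_A wt_eq scaleR_minus_right)
  also have "\<dots> = - S" unfolding S_def by (rule sum_negf)
  finally have "S = - S" .
  then have "S = 0" by (metis equation_minus_iff scaleR_half_double scaleR_zero_right add.right_inverse)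
  then have S: "S \<in> lin \<tau>" unfolding lin_def by (simp only: span_zero)
  show "\<exists>v. (\<forall>\<sigma>\<in>facets \<Gamma>. \<tau> \<subseteq> \<sigma> \<longrightarrow> primitive_generator I \<sigma> \<tau> (v \<sigma>)) \<and>
      (\<Sum>\<sigma> | \<sigma> \<in> facets \<Gamma> \<and> \<tau> \<subseteq> \<sigma>. real (wt \<Gamma> \<sigma>) *\<^sub>R v \<sigma>) \<in> lin \<tau>"
  proof (intro exI[of _ v] conjI ballI impI)
    fix \<sigma> assume "\<sigma> \<in> facets \<Gamma>" "\<tau> \<subseteq> \<sigma>"
    then have "\<sigma> \<in> A" by (simp only: A_def mem_Collect_eq)
    then obtain y where "star y" "\<sigma> = cone y" using A_iff by blast
    with v[of y] show "primitive_generator I \<sigma> \<tau> (v \<sigma>)" by (simp only:)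
  qed (use S in \<open>simp only: S_def A_def\<close>)
qed

lemma tropical: "tropical_variety I e \<Gamma>"
  unfolding tropical_variety_def
proof (intro conjI complex balanced_fan)
  show "cells \<Gamma> \<noteq> {}" unfolding cells_eq using nonempty subspace_W subspace_0 by blast
  show "\<forall>\<sigma>\<in>cells \<Gamma>. \<exists>\<sigma>'\<in>cells \<Gamma>. \<sigma> \<subseteq> \<sigma>' \<and> pdim \<sigma>' = e"
  proof
    fix \<sigma> assume "\<sigma> \<in> cells \<Gamma>"
    then obtain W x where x: "W \<in> \<W>" "x \<in> W" "\<sigma> = cone x" unfolding cells_eq by blast
    obtain y where "y \<in> W" "x \<in> cone y" "flat y = W" using generic_point_W[OF x(1,2)] .
    then show "\<exists>\<sigma>'\<in>cells \<Gamma>. \<sigma> \<subseteq> \<sigma>' \<and> pdim \<sigma>' = e"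
      unfolding cells_eq using x cone_mono[of x y] dims[OF x(1)] pdim_cell[of y] by blast
  qed
  show "\<forall>\<sigma>\<in>facets \<Gamma>. 0 < wt \<Gamma> \<sigma>" using weight_pos by (simp add: wt_eq)
qed

end

section \<open>Translation admissibility\<close>

lemma union_of_rational_subspaces_tropical:
  fixes I :: "'k set"
  assumes "finite I" "finite \<W>" "\<W> \<noteq> {}"
    and rat: "\<And>W. W \<in> \<W> \<Longrightarrow> rational_subspace I W" and dims: "\<And>W. W \<in> \<W> \<Longrightarrow> dim W = e"
  shows "\<exists>\<Delta>. tropical_variety I e \<Delta> \<and> supp \<Delta> = \<Union>\<W>"
proof -
  have "\<forall>W\<in>\<W>. \<exists>K. finite K \<and> K \<subseteq> int_lattice I \<and> W = solutions I K"
    using rational_subspace_solutions[OF assms(1) rat] by metis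
  then obtain K where K: "\<And>W. W \<in> \<W> \<Longrightarrow> finite (K W) \<and> K W \<subseteq> int_lattice I \<and> W = solutions I (K W)"
    by metis
  define H where "H = \<Union>(K ` \<W>)"
  interpret flat_arrangement I H \<W> e "\<lambda>_. 1"
  proof
    show "finite H" "H \<subseteq> int_lattice I" using K assms(2) by (auto simp: H_def)
    show "\<exists>K\<subseteq>H. W = solutions I K" if "W \<in> \<W>" for W
      using K[OF that] that by (intro exI[of _ "K W"]) (auto simp: H_def)
  qed (use assms in auto)
  show ?thesis using tropical supp_eq by blast
qed

lemma coord_space_insert: "coord_space (insert k S) = span (insert (unit k) (coord_space S))"
proof (rule antisym)
  show "span (insert (unit k) (coord_space S)) \<subseteq> coord_space (insert k S)"
    by (rule span_minimal[OF _ subspace_coord_space]) (auto simp: coord_space_def unit_def)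
  show "coord_space (insert k S) \<subseteq> span (insert (unit k) (coord_space S))"
  proof
    fix x :: "'a \<Rightarrow> real" assume "x \<in> coord_space (insert k S)"
    then have "x - x k *\<^sub>R unit k \<in> span (coord_space S)"
      by (intro span_base) (auto simp: coord_space_def unit_def)
    then show "x \<in> span (insert (unit k) (coord_space S))"
      unfolding span_insert by blast
  qed
qed

lemma coord_space_mono: "S \<subseteq> T \<Longrightarrow> coord_space S \<subseteq> coord_space T"
  by (auto simp: coord_space_def)

lemma dim_coord_space: "finite S \<Longrightarrow> dim (coord_space S) = card S"
proof (induction S rule: finite_induct)
  case empty
  have "coord_space {} = span ({} :: ('a \<Rightarrow> real) set)"
    using coord_space_span[of "{} :: 'a set"] by (simp only: image_empty finite.emptyI)
  then show ?case
    using dim_span[of "{} :: ('a \<Rightarrow> real) set"] dim_eq_card_independent[OF independent_empty]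
    by (metis card.empty)
next
  case (insert k S)
  then have "dim (span (insert (unit k) (coord_space S))) = Suc (dim (coord_space S))"
    by (intro dim_insert_new[of "insert k S"] coord_space_mono) auto
  then show ?case using insert by (simp add: coord_space_insert)
qed

lemma sum_coord_space_subspace:
  assumes "finite S" "subspace V"
  shows "coord_space S + V = span (V \<union> unit ` S)"
proof -
  have "span (unit ` S \<union> V) = {x + y | x y. x \<in> coord_space S \<and> y \<in> V}"
    unfolding span_Un coord_space_span[OF assms(1)] span_eq_iff[THEN iffD2, OF assms(2)] ..
  then show ?thesis by (auto simp: set_plus_def Un_commute)
qed

text \<open>
  The unit vectors in the quotient by \<open>V\<close> form a matroid.  If its rank is at most one, a single space
  contains all others.  Otherwise the pairs of independent unit vectors give the spaces of maximal
  dimension, and a dependent pair spans no more than a vector that extends to an independent pair.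
\<close>

lemma coordinate_planes_plus_subspace:
  assumes I: "finite I" "2 \<le> card I" and V: "rational_subspace I V"
  shows "\<exists>\<Q> e. finite \<Q> \<and> \<Q> \<noteq> {} \<and> (\<forall>W\<in>\<Q>. rational_subspace I W \<and> dim W = e) \<and>
    \<Union>(coord_space ` {S. S \<subseteq> I \<and> card S = 2}) + V = \<Union>\<Q>"
proof -
  define U where "U S = span (V \<union> unit ` S)" for S
  define P where "P = {S. S \<subseteq> I \<and> card S = 2}"
  obtain B where B: "B \<subseteq> int_lattice I" "V = span B" using V by (auto simp: rational_subspace_def)
  have V_sub: "subspace V" by (simp add: B(2))
  have "V \<subseteq> coord_space I"
    unfolding B(2) using B(1) int_lattice_subset_coord by (intro span_minimal) auto
  then have U_coord: "U S \<subseteq> coord_space I" if "S \<subseteq> I" for S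
    unfolding U_def using that by (intro span_minimal) auto
  have U_rat: "rational_subspace I (U S)" if "S \<subseteq> I" for S
  proof -
    have "U S = span (B \<union> unit ` S)"
      unfolding U_def B(2) by (simp only: span_Un span_span)
    moreover have "B \<union> unit ` S \<subseteq> int_lattice I" using B(1) that by auto
    ultimately show ?thesis unfolding rational_subspace_def by blast
  qed
  have U_empty: "U {} = V" unfolding U_def using V_sub by (simp add: span_eq_iff)
  have U_insert: "U (insert k S) = span (insert (unit k) (U S))" for k S
    unfolding U_def by (simp only: image_insert Un_insert_right span_insert span_span)
  have U_mono: "S \<subseteq> T \<Longrightarrow> U S \<subseteq> U T" for S T
    unfolding U_def by (intro span_mono) auto
  have U_least: "U S \<subseteq> U T" if S: "\<And>k. k \<in> S \<Longrightarrow> unit k \<in> U T" for S T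
  proof -
    have "V \<union> unit ` S \<subseteq> U T" using S U_mono[of "{}" T] U_empty by blast
    moreover have "subspace (U T)" by (simp add: U_def)
    ultimately show ?thesis unfolding U_def[of S] by (rule span_minimal)
  qed
  have unit_U: "k \<in> S \<Longrightarrow> unit k \<in> U S" for k S
    unfolding U_def by (intro span_base) auto
  have U_absorb: "U (insert k S) = U S" if "unit k \<in> U S" for k S
    using that unit_U by (intro antisym U_least U_mono) auto
  have dim_U: "dim (U (insert k S)) = Suc (dim (U S))" if "insert k S \<subseteq> I" "unit k \<notin> U S" for k S
    unfolding U_insert using that U_coord[of S] by (intro dim_insert_new[OF I(1)]) (auto simp: U_def)
  have "S \<in> P \<Longrightarrow> coord_space S + V = U S" for S
    unfolding U_def P_def using finite_subset[OF _ I(1)] V_sub by (intro sum_coord_space_subspace) auto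
  moreover have "\<Union>(coord_space ` P) + V = (\<Union>S\<in>P. coord_space S + V)"
    unfolding set_plus_def by blast
  ultimately have sum: "\<Union>(coord_space ` P) + V = \<Union>(U ` P)" by simp
  have P_pair: "{k, l} \<in> P" if "k \<in> I" "l \<in> I" "k \<noteq> l" for k l using that by (simp add: P_def)
  have P_elim: "\<exists>k l. S = {k, l} \<and> k \<in> I \<and> l \<in> I \<and> k \<noteq> l" if "S \<in> P" for S
    using that by (auto simp: P_def card_2_iff)
  show ?thesis
  proof (cases "\<exists>a\<in>I. \<exists>b\<in>I. unit a \<notin> V \<and> unit b \<notin> U {a}")
    case True
    then obtain a b where ab: "a \<in> I" "b \<in> I" "unit a \<notin> V" "unit b \<notin> U {a}" by blast
    define \<Q> where "\<Q> = {U {k, l} | k l. k \<in> I \<and> l \<in> I \<and> unit k \<notin> V \<and> unit l \<notin> U {k}}"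
    have distinct: "k \<noteq> l" if "unit l \<notin> U {k}" for k l using that unit_U by blast
    have dim_pair: "dim (U {k, l}) = dim V + 2"
      if "k \<in> I" "l \<in> I" "unit k \<notin> V" "unit l \<notin> U {k}" for k l
      using that dim_U[of l "{k}"] dim_U[of k "{}"] U_empty by (simp add: insert_commute)
    have extend: "\<exists>m\<in>I. unit m \<notin> U {k}" if k: "k \<in> I" "unit k \<notin> V" for k
    proof (rule ccontr)
      assume "\<not> ?thesis"
      then have "unit a \<in> U {k}" "unit b \<in> U {k}" using ab by auto
      then have "unit k \<in> U {a}"
        using in_span_insert[of "unit a" "unit k" V] ab(3) span_eq_iff[THEN iffD2, OF V_sub]
        unfolding U_insert U_empty by (simp only: not_False_eq_True)
      then have "U {k} \<subseteq> U {a}" by (intro U_least) auto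
      with \<open>unit b \<in> U {k}\<close> ab(4) show False by blast
    qed
    have cover: "\<exists>W\<in>\<Q>. U {k} \<subseteq> W" if k: "k \<in> I" "unit k \<notin> V" for k
    proof -
      obtain m where "m \<in> I" "unit m \<notin> U {k}" using extend[OF k] by blast
      then have "U {k, m} \<in> \<Q>" using k by (auto simp: \<Q>_def)
      then show ?thesis using U_mono[of "{k}" "{k, m}"] by blast
    qed
    have "\<exists>W\<in>\<Q>. U S \<subseteq> W" if S: "S \<in> P" for S
    proof -
      obtain k l where kl: "S = {k, l}" "k \<in> I" "l \<in> I" using P_elim[OF S] by blast
      have V_cover: "\<exists>W\<in>\<Q>. V \<subseteq> W"
        using cover[OF ab(1,3)] U_mono[of "{}" "{a}"] U_empty by blast
      consider "unit k \<notin> V" "unit l \<notin> U {k}" | "unit k \<notin> V" "unit l \<in> U {k}"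
        | "unit k \<in> V" "unit l \<notin> V" | "unit k \<in> V" "unit l \<in> V" by blast
      then show ?thesis
      proof cases
        case 1
        then have "U S \<in> \<Q>" unfolding \<Q>_def kl(1) using kl by blast
        then show ?thesis by blast
      next
        case 2
        then have "U S = U {k}" using U_absorb[of l "{k}"] by (simp add: kl(1) insert_commute)
        then show ?thesis using cover[OF kl(2)] 2 by simp
      next
        case 3
        then have "unit k \<in> U {l}" using U_mono[of "{}" "{l}"] U_empty by blast
        then have "U S = U {l}" using U_absorb[of k "{l}"] by (simp add: kl(1))
        then show ?thesis using cover[OF kl(3)] 3 by simp
      next
        case 4
        then have "U S \<subseteq> U {}" unfolding kl(1) U_empty[symmetric] by (intro U_least) auto
        then show ?thesis using V_cover U_empty by blast
      qed
    qed
    then have "\<Union>(U ` P) \<subseteq> \<Union>\<Q>" by blast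
    moreover have "\<Q> \<subseteq> U ` P"
    proof
      fix W assume "W \<in> \<Q>"
      then obtain k l where "W = U {k, l}" "k \<in> I" "l \<in> I" "unit l \<notin> U {k}"
        unfolding \<Q>_def by blast
      then show "W \<in> U ` P" using P_pair distinct by blast
    qed
    moreover have "finite P" unfolding P_def using I(1) by simp
    ultimately have "finite \<Q>" "\<Union>(U ` P) = \<Union>\<Q>"
      by (meson finite_imageI finite_subset) (meson \<open>\<Q> \<subseteq> U ` P\<close> \<open>\<Union>(U ` P) \<subseteq> \<Union>\<Q>\<close> Union_mono subset_antisym)
    moreover have "\<Q> \<noteq> {}" using cover[OF ab(1,3)] by blast
    moreover have "rational_subspace I W \<and> dim W = dim V + 2" if W: "W \<in> \<Q>" for W
    proof -
      obtain k l where "W = U {k, l}" "k \<in> I" "l \<in> I" "unit k \<notin> V" "unit l \<notin> U {k}"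
        using W unfolding \<Q>_def by blast
      then show ?thesis using dim_pair U_rat[of "{k, l}"] by simp
    qed
    ultimately show ?thesis unfolding P_def[symmetric] sum by metis
  next
    case False
    have "I \<noteq> {}" using I by auto
    then obtain c where c: "c \<in> I" "\<And>b. b \<in> I \<Longrightarrow> unit b \<in> U {c}"
      using False U_mono[of "{}"] U_empty by blast
    have "\<not> I \<subseteq> {c}"
    proof
      assume "I \<subseteq> {c}"
      then have "card I \<le> card {c}" by (intro card_mono) auto
      then show False using I(2) by simp
    qed
    then obtain m where m: "m \<in> I" "m \<noteq> c" by blast
    have "U S \<subseteq> U {c}" if "S \<in> P" for S
      using that c(2) by (intro U_least) (auto simp: P_def)
    moreover have "U {c} \<subseteq> U {c, m}" by (intro U_mono) auto
    moreover have "{c, m} \<in> P" using P_pair c(1) m by blast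
    ultimately have "\<Union>(U ` P) = \<Union>{U {c}}" by blast
    moreover have "rational_subspace I (U {c})" using U_rat c(1) by simp
    ultimately show ?thesis unfolding P_def[symmetric] sum
      by (intro exI[of _ "{U {c}}"] exI[of _ "dim (U {c})"]) simp
  qed
qed

lemma translation_admissible_coordinate_planes:
  assumes "finite I" "2 \<le> card I" "supp \<Gamma> = \<Union>(coord_space ` {S. S \<subseteq> I \<and> card S = 2})"
  shows "translation_admissible I \<Gamma>"
  unfolding translation_admissible_def assms(3)
proof (intro allI impI)
  fix V assume "rational_subspace I V"
  from coordinate_planes_plus_subspace[OF assms(1,2) this]
  obtain \<Q> e where \<Q>: "finite \<Q>" "\<Q> \<noteq> {}" "\<forall>W\<in>\<Q>. rational_subspace I W \<and> dim W = e"
    "\<Union>(coord_space ` {S. S \<subseteq> I \<and> card S = 2}) + V = \<Union>\<Q>"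
    by (elim exE conjE)
  have "\<exists>\<Delta>. tropical_variety I e \<Delta> \<and> supp \<Delta> = \<Union>\<Q>"
    by (rule union_of_rational_subspaces_tropical[OF assms(1) \<Q>(1,2)]) (use \<Q>(3) in blast)+
  then show "\<exists>e \<Delta>. tropical_variety I e \<Delta> \<and>
      supp \<Delta> = \<Union>(coord_space ` {S. S \<subseteq> I \<and> card S = 2}) + V"
    unfolding \<Q>(4) by blast
qed

section \<open>Stable intersection of coordinate fans with coordinate hyperplanes\<close>

lemma tendsto_fun_iff:
  fixes y :: "'a \<Rightarrow> 'k \<Rightarrow> real"
  shows "(y \<longlongrightarrow> x) G \<longleftrightarrow> (\<forall>k. ((\<lambda>\<epsilon>. y \<epsilon> k) \<longlongrightarrow> x k) G)"
proof -
  have "(y \<longlongrightarrow> x) G \<longleftrightarrow> limitin (product_topology (\<lambda>_. euclidean) UNIV) y x G"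
    by (simp only: euclidean_product_topology limitin_canonical_iff)
  then show ?thesis by (simp add: limitin_componentwise)
qed

definition orthant :: "'k set \<Rightarrow> ('k \<Rightarrow> real) \<Rightarrow> ('k \<Rightarrow> real) set"
  where "orthant I x = arrangement.cone I (unit ` I) x"

definition support :: "('k \<Rightarrow> real) \<Rightarrow> 'k set"
  where "support x = {k. x k \<noteq> 0}"

lemma coord_space_iff_support: "x \<in> coord_space I \<longleftrightarrow> support x \<subseteq> I"
  by (auto simp: coord_space_def support_def)

lemma arrangement_units: "finite I \<Longrightarrow> arrangement I (unit ` I)"
  by unfold_locales auto

lemma orthant_iff:
  assumes "finite I"
  shows "y \<in> orthant I x \<longleftrightarrow>
    y \<in> coord_space I \<and> (\<forall>k\<in>I. 0 \<le> x k * y k \<and> (x k = 0 \<longrightarrow> y k = 0))"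
  using arrangement.cone_def[OF arrangement_units[OF assms], of x] assms
  by (auto simp: orthant_def pairing_unit)

lemma flat_units:
  assumes "finite I" "x \<in> coord_space I"
  shows "arrangement.flat I (unit ` I) x = coord_space (support x)"
proof (rule Set.set_eqI)
  fix y
  have "y \<in> arrangement.flat I (unit ` I) x \<longleftrightarrow> y \<in> coord_space I \<and> (\<forall>k\<in>I. x k = 0 \<longrightarrow> y k = 0)"
    using arrangement.flat_iff[OF arrangement_units[OF assms(1)], of y x] assms(1)
    by (simp add: pairing_unit)
  also have "\<dots> \<longleftrightarrow> y \<in> coord_space (support x)"
    using assms(2) unfolding coord_space_def support_def by blast
  finally show "y \<in> arrangement.flat I (unit ` I) x \<longleftrightarrow> y \<in> coord_space (support x)" .
qed

lemma lin_orthant: "finite I \<Longrightarrow> x \<in> coord_space I \<Longrightarrow> lin (orthant I x) = coord_space (support x)"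
  using arrangement.lin_cone[OF arrangement_units] flat_units by (metis orthant_def)

lemma finite_support: "finite I \<Longrightarrow> x \<in> coord_space I \<Longrightarrow> finite (support x)"
  by (auto simp: coord_space_iff_support intro: finite_subset)

lemma pdim_orthant: "finite I \<Longrightarrow> x \<in> coord_space I \<Longrightarrow> pdim (orthant I x) = card (support x)"
  by (simp add: pdim_def lin_orthant dim_coord_space finite_support)

lemma orthant_cong:
  assumes "finite I" "\<And>k. k \<in> I \<Longrightarrow> sgn (x k) = sgn (y k)"
  shows "orthant I x = orthant I y"
  unfolding orthant_def using assms
  by (intro arrangement.cone_cong[OF arrangement_units]) (auto simp: pairing_unit)

lemma sgn_eq_of_orthant_eq:
  assumes "finite I" "orthant I x = orthant I y" "x \<in> coord_space I" "y \<in> coord_space I"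
  shows "sgn (x k) = sgn (y k)"
proof (cases "k \<in> I")
  case True
  then show ?thesis
    using arrangement.sgn_eq_of_cone_eq[OF arrangement_units[OF assms(1)], of x y "unit k"] assms
    by (simp add: orthant_def pairing_unit)
next
  case False
  then show ?thesis using assms(3,4) by (simp add: coord_space_def)
qed

lemma self_in_orthant: "finite I \<Longrightarrow> x \<in> coord_space I \<Longrightarrow> x \<in> orthant I x"
  by (simp add: orthant_iff)

lemma orthant_face:
  "finite I \<Longrightarrow> y \<in> orthant I x \<Longrightarrow> orthant I y face_of orthant I x"
  unfolding orthant_def by (rule arrangement.cone_face_of[OF arrangement_units])

lemma face_of_orthant:
  assumes "finite I" "F face_of orthant I x" "F \<noteq> {}"
  obtains y where "y \<in> orthant I x" "F = orthant I y"
  using assms arrangement.face_of_cone[OF arrangement_units] unfolding orthant_def by metis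

lemma support_orthant: "finite I \<Longrightarrow> y \<in> orthant I x \<Longrightarrow> support y \<subseteq> support x"
  by (auto simp: orthant_iff support_def coord_space_def)

text \<open>A coordinate subspace is the only cone of the empty arrangement, so it has no proper nonempty face.\<close>

lemma face_of_coord_space:
  assumes "finite J" "F face_of coord_space J" "F \<noteq> {}"
  shows "F = coord_space J"
proof -
  interpret arrangement J "{}" by unfold_locales (use assms in auto)
  have "cone x = coord_space J" for x by (simp add: cone_def)
  then show ?thesis using face_of_cone[of F 0] assms by metis
qed

lemma lin_coord_space: "finite J \<Longrightarrow> lin (coord_space J) = coord_space J"
proof -
  assume "finite J"
  interpret arrangement J "{}" by unfold_locales (use \<open>finite J\<close> in auto)
  have "cone 0 = coord_space J" "flat 0 = coord_space J"
    by (simp_all add: cone_def flat_def solutions_def)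
  moreover have "0 \<in> coord_space J" by (rule subspace_0) simp
  ultimately show ?thesis using lin_cone[of 0] by simp
qed

lemma sum_memI: "x = a + b \<Longrightarrow> a \<in> A \<Longrightarrow> b \<in> B \<Longrightarrow> x \<in> A + B"
  by (simp only: set_plus_intro)

lemma coord_space_sum: "coord_space A + coord_space B = coord_space (A \<union> B)"
proof (rule antisym)
  show "coord_space A + coord_space B \<subseteq> coord_space (A \<union> B)"
    by (rule subsetI, erule set_plus_elim) (auto simp: coord_space_def)
  show "coord_space (A \<union> B) \<subseteq> coord_space A + coord_space B"
  proof
    fix x :: "'a \<Rightarrow> real" assume x: "x \<in> coord_space (A \<union> B)"
    have "x = (\<lambda>k. if k \<in> A then x k else 0) + (\<lambda>k. if k \<in> A then 0 else x k)"
      by (rule ext) simp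
    moreover have "(\<lambda>k. if k \<in> A then x k else 0) \<in> coord_space A" "(\<lambda>k. if k \<in> A then 0 else x k) \<in> coord_space B"
      using x by (auto simp: coord_space_def)
    ultimately show "x \<in> coord_space A + coord_space B" by (rule sum_memI)
  qed
qed

lemma lattice_index_self: "L \<noteq> {} \<Longrightarrow> lattice_index L L' = 1" if "L \<subseteq> L'" "\<And>x y. x \<in> L \<Longrightarrow> y \<in> L \<Longrightarrow> x - y \<in> L" for L L'
proof -
  assume "L \<noteq> {}"
  have "{(x, y). x \<in> L \<and> y \<in> L \<and> x - y \<in> L'} = L \<times> L" using that by blast
  moreover have "L // (L \<times> L) = {L}" unfolding quotient_def using \<open>L \<noteq> {}\<close> by blast
  ultimately show ?thesis by (simp add: lattice_index_def)
qed

lemma lattice_index_coordinate: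
  assumes "A \<union> B = I" and "lin \<sigma> = coord_space A" "lin \<sigma>' = coord_space B"
  shows "lattice_index (int_lattice I) (lat I \<sigma> + lat I \<sigma>') = 1"
proof (rule lattice_index_self)
  show "int_lattice I \<noteq> {}" using int_lattice_closed(4) by blast
  show "x - y \<in> int_lattice I" if "x \<in> int_lattice I" "y \<in> int_lattice I" for x y :: "'a \<Rightarrow> real"
    using that by (rule int_lattice_closed)
  show "int_lattice I \<subseteq> lat I \<sigma> + lat I \<sigma>'"
  proof
    fix x :: "'a \<Rightarrow> real" assume x: "x \<in> int_lattice I"
    have "x = (\<lambda>k. if k \<in> A then x k else 0) + (\<lambda>k. if k \<in> A then 0 else x k)"
      by (rule ext) simp
    moreover have "(\<lambda>k. if k \<in> A then x k else 0) \<in> lat I \<sigma>" "(\<lambda>k. if k \<in> A then 0 else x k) \<in> lat I \<sigma>'"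
      using x assms by (auto simp: lat_def coord_space_def int_lattice_def)
    ultimately show "x \<in> lat I \<sigma> + lat I \<sigma>'" by (rule sum_memI)
  qed
qed

lemma displaced_inter_coord:
  assumes "T \<subseteq> I" "v \<in> coord_space I" "P \<subseteq> coord_space I"
  shows "p \<in> displaced_inter v P (coord_space (I - T)) \<epsilon> \<longleftrightarrow> p \<in> P \<and> (\<forall>k\<in>T. p k = \<epsilon> * v k)"
proof -
  have "p \<in> (\<lambda>x. x + \<epsilon> *\<^sub>R v) ` coord_space (I - T) \<longleftrightarrow> p - \<epsilon> *\<^sub>R v \<in> coord_space (I - T)"
    by (metis (no_types, lifting) add_diff_cancel_right' diff_add_cancel image_iff)
  also have "\<dots> \<longleftrightarrow> (\<forall>k\<in>T. p k = \<epsilon> * v k)" if "p \<in> P"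
    using that assms by (auto simp: coord_space_def)
  finally show ?thesis unfolding displaced_inter_def by blast
qed

text \<open>
  A point in the displaced subspace has coordinates \<open>\<epsilon> * v k\<close> for \<open>k \<in> T\<close>.  It can be in the orthant
  only if \<open>x\<close> has the signs of \<open>v\<close> there; as \<open>\<epsilon>\<close> vanishes, these coordinates tend to zero and
  the other ones stay unrestricted.
\<close>

lemma limit_displaced_orthant:
  assumes I: "finite I" "T \<subseteq> I" and v: "v \<in> coord_space I" "\<And>k. k \<in> T \<Longrightarrow> v k \<noteq> 0"
    and x: "x \<in> coord_space I"
  shows "limit_set (displaced_inter v (orthant I x) (coord_space (I - T))) =
    (if \<forall>k\<in>T. 0 < v k * x k then orthant I (\<lambda>k. if k \<in> T then 0 else x k) else {})"
proof -
  let ?D = "displaced_inter v (orthant I x) (coord_space (I - T))"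
  let ?x = "\<lambda>k. if k \<in> T then 0 else x k"
  have D: "p \<in> ?D \<epsilon> \<longleftrightarrow> p \<in> orthant I x \<and> (\<forall>k\<in>T. p k = \<epsilon> * v k)" for p \<epsilon>
    by (intro displaced_inter_coord I v) (auto simp: orthant_iff[OF I(1)])
  have fwd: "(\<forall>k\<in>T. 0 < v k * x k) \<and> z \<in> orthant I ?x" if z: "z \<in> limit_set ?D" for z
  proof -
    obtain y where y: "\<forall>\<^sub>F \<epsilon> in at_right 0. y \<epsilon> \<in> ?D \<epsilon>" "(y \<longlongrightarrow> z) (at_right 0)"
      using z unfolding limit_set_def by blast
    have lim: "((\<lambda>\<epsilon>. y \<epsilon> k) \<longlongrightarrow> z k) (at_right 0)" for k using y(2) by (simp add: tendsto_fun_iff)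
    have "\<forall>\<^sub>F \<epsilon> in at_right (0::real). 0 < \<epsilon> \<and> y \<epsilon> \<in> ?D \<epsilon>"
      using y(1) eventually_at_right_less by (rule eventually_elim2) simp
    then obtain \<epsilon> :: real where "0 < \<epsilon>" "y \<epsilon> \<in> ?D \<epsilon>"
      using eventually_happens'[OF trivial_limit_at_right_real] by blast
    then have pos: "0 < v k * x k" if k: "k \<in> T" for k
    proof -
      have "y \<epsilon> k = \<epsilon> * v k" "0 \<le> x k * y \<epsilon> k" "x k = 0 \<longrightarrow> y \<epsilon> k = 0"
        using \<open>y \<epsilon> \<in> ?D \<epsilon>\<close> k I(2) unfolding D orthant_iff[OF I(1)] by blast+
      then have "0 \<le> \<epsilon> * (v k * x k)" "v k * x k \<noteq> 0"
        using v(2)[OF k] \<open>0 < \<epsilon>\<close> by (auto simp: mult_ac)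
      then show ?thesis using \<open>0 < \<epsilon>\<close> by (simp add: zero_le_mult_iff less_le)
    qed
    have zT: "z k = 0" if k: "k \<in> T" for k
    proof -
      have "\<forall>\<^sub>F \<epsilon> in at_right 0. y \<epsilon> k = \<epsilon> * v k"
        using y(1) by (rule eventually_mono) (use D k in blast)
      then have "((\<lambda>\<epsilon>. \<epsilon> * v k) \<longlongrightarrow> z k) (at_right 0)" using lim[of k] by (rule Lim_transform_eventually[rotated])
      moreover have "((\<lambda>\<epsilon>::real. \<epsilon> * v k) \<longlongrightarrow> 0 * v k) (at_right 0)" by (intro tendsto_intros)
      ultimately show ?thesis using tendsto_unique[OF trivial_limit_at_right_real] by fastforce
    qed
    have nonneg: "0 \<le> x k * z k" if "k \<in> I" for k
    proof (rule tendsto_lowerbound[OF tendsto_mult_left[OF lim]])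
      show "\<forall>\<^sub>F \<epsilon> in at_right 0. 0 \<le> x k * y \<epsilon> k"
        using y(1) by (rule eventually_mono) (use D that I in \<open>auto simp: orthant_iff\<close>)
    qed simp
    have zero: "z k = 0" if "k \<notin> I \<or> x k = 0" for k
    proof -
      have "\<forall>\<^sub>F \<epsilon> in at_right 0. y \<epsilon> k = 0"
        using y(1) by (rule eventually_mono)
          (use D that I x in \<open>auto simp: orthant_iff coord_space_def\<close>)
      then have "((\<lambda>\<epsilon>. 0) \<longlongrightarrow> z k) (at_right (0::real))" using lim[of k] by (rule Lim_transform_eventually[rotated])
      then show ?thesis using tendsto_unique[OF trivial_limit_at_right_real _ tendsto_const] by blast
    qed
    show ?thesis using pos zT nonneg zero I(1) by (auto simp: orthant_iff coord_space_def)
  qed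
  moreover have "z \<in> limit_set ?D" if pos: "\<forall>k\<in>T. 0 < v k * x k" and z: "z \<in> orthant I ?x" for z
  proof -
    define y where "y \<epsilon> = (\<lambda>k. if k \<in> T then \<epsilon> * v k else z k)" for \<epsilon>
    have "y \<epsilon> \<in> ?D \<epsilon>" if \<epsilon>: "0 < \<epsilon>" for \<epsilon>
    proof -
      have "y \<epsilon> \<in> coord_space I" using z I by (auto simp: y_def orthant_iff coord_space_def)
      moreover have "0 \<le> x k * y \<epsilon> k \<and> (x k = 0 \<longrightarrow> y \<epsilon> k = 0)" if k: "k \<in> I" for k
      proof (cases "k \<in> T")
        case True
        then have "0 < \<epsilon> * (v k * x k)" using pos \<epsilon> by simp
        then show ?thesis using True by (auto simp: y_def mult_ac)
      next
        case False
        then show ?thesis using z k I by (auto simp: y_def orthant_iff)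
      qed
      ultimately show ?thesis unfolding D by (auto simp: orthant_iff[OF I(1)] y_def)
    qed
    then have "\<forall>\<^sub>F \<epsilon> in at_right 0. y \<epsilon> \<in> ?D \<epsilon>"
      using eventually_at_right_less[of 0] by (rule eventually_mono[rotated])
    moreover have "(y \<longlongrightarrow> z) (at_right 0)"
      unfolding tendsto_fun_iff
    proof
      fix k
      have "((\<lambda>\<epsilon>::real. \<epsilon> * v k) \<longlongrightarrow> 0 * v k) (at_right 0)" by (intro tendsto_intros)
      moreover have "k \<in> T \<Longrightarrow> z k = 0" using z I by (auto simp: orthant_iff)
      ultimately show "((\<lambda>\<epsilon>. y \<epsilon> k) \<longlongrightarrow> z k) (at_right 0)"
        by (cases "k \<in> T") (simp_all add: y_def)
    qed
    ultimately show ?thesis unfolding limit_set_def by blast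
  qed
  ultimately show ?thesis by auto
qed

subsection \<open>Families of coordinate subspaces\<close>

definition coordinate_cells :: "'k set \<Rightarrow> 'k set set \<Rightarrow> ('k \<Rightarrow> real) set set"
  where "coordinate_cells I \<S> = orthant I ` \<Union>(coord_space ` \<S>)"

text \<open>
  Weights are fixed on the facets only.  A stable intersection has the value \<open>0\<close> on all other sets, so
  this relation, unlike an equation between complexes, is preserved by it.
\<close>

definition is_coordinate_fan :: "'k set \<Rightarrow> 'k set set \<Rightarrow> ('k set \<Rightarrow> nat) \<Rightarrow> 'k wcomplex \<Rightarrow> bool"
  where "is_coordinate_fan I \<S> w \<Delta> \<longleftrightarrow> cells \<Delta> = coordinate_cells I \<S> \<and>
    (\<forall>x \<in> coord_space I. support x \<in> \<S> \<longrightarrow> wt \<Delta> (orthant I x) = w (support x))"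

definition is_coordinate_subspace :: "'k set \<Rightarrow> 'k set \<Rightarrow> 'k wcomplex \<Rightarrow> bool"
  where "is_coordinate_subspace I T \<Delta> \<longleftrightarrow>
    cells \<Delta> = {coord_space (I - T)} \<and> wt \<Delta> (coord_space (I - T)) = 1"

text \<open>For the bases of a matroid, this is the contraction of an independent set.\<close>

definition contraction :: "'k set set \<Rightarrow> 'k set \<Rightarrow> 'k set set"
  where "contraction \<S> T = {S - T | S. S \<in> \<S> \<and> T \<subseteq> S}"

lemma coordinate_flat_arrangement:
  assumes I: "finite I" and S: "\<S> \<noteq> {}" "\<And>S. S \<in> \<S> \<Longrightarrow> S \<subseteq> I \<and> card S = d" and \<omega>: "\<And>U. 0 < \<omega> U"
  shows "flat_arrangement I (unit ` I) (coord_space ` \<S>) d \<omega>"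
proof (intro flat_arrangement.intro flat_arrangement_axioms.intro arrangement_units[OF I])
  fix W assume "W \<in> coord_space ` \<S>"
  then obtain A where A: "A \<in> \<S>" "W = coord_space A" by (rule imageE)
  have AI: "finite A" "A \<subseteq> I" using S(2)[OF A(1)] finite_subset[OF _ I] by blast+
  have "coord_space A = solutions I (unit ` (I - A))"
    using AI(2) I by (auto simp: solutions_def pairing_unit coord_space_def)
  then have "W = solutions I (unit ` (I - A))" using A(2) by (simp only:)
  moreover have "unit ` (I - A) \<subseteq> unit ` I" by (rule image_mono) (rule Diff_subset)
  ultimately show "\<exists>K\<subseteq>unit ` I. W = solutions I K" by (intro exI conjI)
  show "dim W = d" using A(2) AI(1) S(2)[OF A(1)] dim_coord_space[of A] by simp
qed (use S(1) \<omega> in simp_all)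

lemma coordinate_facets:
  assumes I: "finite I" and S: "\<And>S. S \<in> \<S> \<Longrightarrow> S \<subseteq> I \<and> card S = d" and \<Delta>: "cells \<Delta> = coordinate_cells I \<S>"
  shows "facets \<Delta> = orthant I ` {x. support x \<in> \<S>}"
proof (cases "\<S> = {}")
  case True
  then show ?thesis using \<Delta> by (simp add: facets_def coordinate_cells_def)
next
  case False
  interpret flat_arrangement I "unit ` I" "coord_space ` \<S>" d "\<lambda>_. 1"
    by (rule coordinate_flat_arrangement[OF I False S]) simp_all
  have "cells \<Delta> = cells \<Gamma>"
    unfolding \<Delta> coordinate_cells_def cells_eq orthant_def ..
  then have "facets \<Delta> = facets \<Gamma>" by (simp add: facets_def cdim_def)
  also have "\<dots> = orthant I ` {x \<in> X. coord_space (support x) \<in> coord_space ` \<S>}"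
  proof -
    have "flat x = coord_space (support x)" if "x \<in> X" for x
      using that X_coord flat_units[OF I] by blast
    then show ?thesis unfolding facets_eq orthant_def by (metis (no_types, lifting) Collect_cong)
  qed
  also have "{x \<in> X. coord_space (support x) \<in> coord_space ` \<S>} = {x. support x \<in> \<S>}"
  proof -
    have inj: "A = B" if "coord_space A = coord_space B" for A B :: "'a set"
    proof -
      have "unit k \<in> coord_space A \<longleftrightarrow> unit k \<in> coord_space B" for k using that by simp
      then show ?thesis by auto
    qed
    have "x \<in> X" if "support x \<in> \<S>" for x
      using that by (auto intro!: bexI[of _ "support x"] simp: coord_space_iff_support)
    then show ?thesis using inj by blast
  qed
  finally show ?thesis .
qed

lemma orthant_coord: "finite I \<Longrightarrow> orthant I x \<subseteq> coord_space I"
  by (auto simp: orthant_iff)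

lemma single_cell_facets: "cells \<Delta> = {\<sigma>} \<Longrightarrow> facets \<Delta> = {\<sigma>}"
  by (auto simp: facets_def cdim_def)

lemma stable_inter_empty:
  assumes "facets \<Delta> = {} \<or> facets \<Delta>' = {}"
  shows "cells (stable_inter I \<Delta> \<Delta>') = {}"
  using assms by (auto simp: stable_inter_def Let_def stable_pairs_def)

lemma empty_facets: "cells \<Delta> = {} \<Longrightarrow> facets \<Delta> = {}"
  by (simp add: facets_def)

text \<open>The all-ones vector is generic: it moves \<open>coord_space (I - T)\<close> off every orthant whose support
  misses a coordinate in \<open>T\<close>, and the orthants that remain are transverse to that subspace.\<close>

lemma generic_displacement_exists:
  assumes I: "finite I" "T \<subseteq> I"
    and cells: "cells \<Delta> = coordinate_cells I \<S>" "\<And>S. S \<in> \<S> \<Longrightarrow> S \<subseteq> I"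
    and lin: "cells \<Delta>' = {coord_space (I - T)}"
  shows "\<exists>v. generic_displacement I \<Delta> \<Delta>' v"
proof -
  define v :: "'a \<Rightarrow> real" where "v = (\<lambda>k. if k \<in> I then 1 else 0)"
  have vI: "v \<in> coord_space I" by (simp add: v_def coord_space_def)
  have "lin \<sigma> + lin \<sigma>' = coord_space I"
    if \<epsilon>: "0 < \<epsilon>" and cells': "\<sigma> \<in> cells \<Delta>" "\<sigma>' \<in> cells \<Delta>'" and ne: "displaced_inter v \<sigma> \<sigma>' \<epsilon> \<noteq> {}" for \<epsilon> \<sigma> \<sigma>'
  proof -
    have \<sigma>': "\<sigma>' = coord_space (I - T)" using cells'(2) lin by simp
    obtain x where x: "x \<in> coord_space I" "\<sigma> = orthant I x"
      using cells'(1) cells(2) unfolding cells(1) coordinate_cells_def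
      by (blast dest: subsetD[OF coord_space_mono])
    obtain p where "p \<in> displaced_inter v \<sigma> \<sigma>' \<epsilon>" using ne by blast
    then have p: "p \<in> orthant I x" "\<forall>k\<in>T. p k = \<epsilon> * v k"
      using displaced_inter_coord[OF I(2) vI orthant_coord[OF I(1)]] unfolding x(2) \<sigma>' by blast+
    have "T \<subseteq> support p" using p(2) \<epsilon> I(2) by (auto simp: support_def v_def)
    then have "T \<subseteq> support x" using support_orthant[OF I(1) p(1)] by blast
    moreover have "support x \<subseteq> I" using x(1) by (simp add: coord_space_iff_support)
    ultimately have "support x \<union> (I - T) = I" by blast
    then show ?thesis
      unfolding x(2) \<sigma>' lin_orthant[OF I(1) x(1)] lin_coord_space[OF finite_Diff[OF I(1)]] coord_space_sum
      by (simp only:)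
  qed
  then have "\<forall>\<^sub>F \<epsilon> in at_right 0. \<forall>\<sigma> \<in> cells \<Delta>. \<forall>\<sigma>' \<in> cells \<Delta>'.
       displaced_inter v \<sigma> \<sigma>' \<epsilon> \<noteq> {} \<longrightarrow> lin \<sigma> + lin \<sigma>' = coord_space I"
    by (intro eventually_mono[OF eventually_at_right_less[of 0]] ballI impI)
  then show ?thesis unfolding generic_displacement_def using vI by blast
qed

text \<open>If \<open>v i = 0\<close>, the displaced hyperplane still meets the cell \<open>\<sigma>\<close>, which is not transverse to it,
  at the origin.\<close>

lemma generic_displacement_nonzero:
  assumes I: "finite I" "i \<in> I"
    and gen: "generic_displacement I \<Delta> \<Delta>' v"
    and \<sigma>: "\<sigma> \<in> cells \<Delta>" "0 \<in> \<sigma>" "lin \<sigma> \<subseteq> coord_space (I - {i})"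
    and lin: "coord_space (I - {i}) \<in> cells \<Delta>'"
  shows "v i \<noteq> 0"
proof
  assume "v i = 0"
  have vI: "v \<in> coord_space I" using gen unfolding generic_displacement_def by blast
  then have mv: "- (\<epsilon> *\<^sub>R v) \<in> coord_space (I - {i})" for \<epsilon>
    using \<open>v i = 0\<close> by (auto simp: coord_space_def)
  have "0 \<in> displaced_inter v \<sigma> (coord_space (I - {i})) \<epsilon>" for \<epsilon>
    unfolding displaced_inter_def using \<sigma>(2) mv[of \<epsilon>]
    by (intro IntI image_eqI[of _ _ "- (\<epsilon> *\<^sub>R v)"]) (simp_all only: add.left_inverse)
  then have ne: "displaced_inter v \<sigma> (coord_space (I - {i})) \<epsilon> \<noteq> {}" for \<epsilon> by blast
  have "\<forall>\<^sub>F \<epsilon> in at_right 0. \<forall>\<sigma> \<in> cells \<Delta>. \<forall>\<sigma>' \<in> cells \<Delta>'.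
       displaced_inter v \<sigma> \<sigma>' \<epsilon> \<noteq> {} \<longrightarrow> lin \<sigma> + lin \<sigma>' = coord_space I"
    using gen unfolding generic_displacement_def by blast
  from eventually_happens'[OF trivial_limit_at_right_real this]
  have "lin \<sigma> + lin (coord_space (I - {i})) = coord_space I"
    using ne \<sigma>(1) lin by metis
  then have "unit i \<in> lin \<sigma> + coord_space (I - {i})"
    using I lin_coord_space[of "I - {i}"] by simp
  then obtain a b where "unit i = a + b" "a \<in> lin \<sigma>" "b \<in> coord_space (I - {i})"
    by (rule set_plus_elim)
  moreover from this have "a \<in> coord_space (I - {i})" using \<sigma>(3) by blast
  ultimately have "unit i \<in> coord_space (I - {i})" by (metis subspace_add subspace_coord_space)
  then show False by simp
qed

text \<open>
  A facet whose support contains \<open>T\<close> meets the displaced hyperplane if its signs on \<open>T\<close> are those of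
  the displacement, so of the orthants that become equal after setting the coordinates in \<open>T\<close> to
  zero exactly one contributes.  Coordinate subspaces that span the space have lattice index one;
  hence the weight is unchanged.  Allowing \<open>T = {}\<close> covers the zeroth power of a divisor too.
\<close>

lemma stable_inter_coordinate_hyperplane:
  assumes I: "finite I" "T \<subseteq> {i}" "i \<in> I"
    and S: "\<And>S. S \<in> \<S> \<Longrightarrow> S \<subseteq> I \<and> card S = d"
    and \<Delta>: "is_coordinate_fan I \<S> w \<Delta>" and \<Delta>': "is_coordinate_subspace I T \<Delta>'"
  shows "is_coordinate_fan I (contraction \<S> T) (\<lambda>S. w (S \<union> T)) (stable_inter I \<Delta> \<Delta>')"
proof (cases "\<S> = {}")
  case True
  then have "facets \<Delta> = {}" using \<Delta> by (simp add: is_coordinate_fan_def coordinate_cells_def empty_facets)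
  then have "cells (stable_inter I \<Delta> \<Delta>') = {}" using stable_inter_empty by blast
  then show ?thesis using True by (simp add: is_coordinate_fan_def coordinate_cells_def contraction_def)
next
  case False
  have TI: "T \<subseteq> I" using I by blast
  let ?K = "coord_space (I - T)"
  have cells: "cells \<Delta> = coordinate_cells I \<S>" using \<Delta> by (simp only: is_coordinate_fan_def)
  have wt: "wt \<Delta> (orthant I x) = w (support x)" if x: "support x \<in> \<S>" for x
  proof -
    have "x \<in> coord_space I" using S[OF x] by (simp add: coord_space_iff_support)
    then show ?thesis using \<Delta> x unfolding is_coordinate_fan_def by blast
  qed
  have cells': "cells \<Delta>' = {?K}" "wt \<Delta>' ?K = 1" using \<Delta>' by (simp_all add: is_coordinate_subspace_def)
  define v where "v = (SOME v. generic_displacement I \<Delta> \<Delta>' v)"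
  have gen: "generic_displacement I \<Delta> \<Delta>' v"
    unfolding v_def using generic_displacement_exists[OF I(1) TI cells _ cells'(1)] S by (intro someI_ex[of "generic_displacement I \<Delta> \<Delta>'"]) blast
  have vI: "v \<in> coord_space I" using gen unfolding generic_displacement_def by blast
  have zero: "0 \<in> coord_space J" for J :: "'a set" by (rule subspace_0) simp
  have v0: "v k \<noteq> 0" if k: "k \<in> T" for k
  proof -
    have "T = {i}" "k = i" using I k by auto
    obtain S where "S \<in> \<S>" using False by blast
    then have "orthant I 0 \<in> cells \<Delta>" unfolding cells coordinate_cells_def using zero by blast
    moreover have "lin (orthant I 0) \<subseteq> coord_space (I - {i})"
      unfolding lin_orthant[OF I(1) zero] by (rule coord_space_mono) (simp add: support_def)
    ultimately show ?thesis
      using generic_displacement_nonzero[OF I(1,3) gen _ self_in_orthant[OF I(1) zero]] cells'(1)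
      unfolding \<open>T = {i}\<close> \<open>k = i\<close> by blast
  qed
  have facets: "facets \<Delta> = orthant I ` {x. support x \<in> \<S>}"
    by (rule coordinate_facets[OF I(1) S cells])
  have facets': "facets \<Delta>' = {?K}" by (rule single_cell_facets[OF cells'(1)])
  define cut :: "('a \<Rightarrow> real) \<Rightarrow> 'a \<Rightarrow> real" where "cut x = (\<lambda>k. if k \<in> T then 0 else x k)" for x
  have supp_cut: "support (cut x) = support x - T" for x by (auto simp: support_def cut_def)
  have pairs: "(\<sigma>, \<sigma>') \<in> stable_pairs I v \<Delta> \<Delta>' \<rho> \<longleftrightarrow>
      (\<exists>x. support x \<in> \<S> \<and> (\<forall>k\<in>T. 0 < v k * x k) \<and> \<sigma> = orthant I x \<and> \<sigma>' = ?K \<and> \<rho> = orthant I (cut x))"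
    for \<sigma> \<sigma>' \<rho>
  proof -
    have *: "\<rho> = limit_set (displaced_inter v (orthant I x) ?K) \<and> \<rho> \<noteq> {} \<and>
        pdim \<rho> + card I = pdim (orthant I x) + pdim ?K \<longleftrightarrow>
        (\<forall>k\<in>T. 0 < v k * x k) \<and> \<rho> = orthant I (cut x)" if x: "support x \<in> \<S>" for x
    proof -
      have xI: "x \<in> coord_space I" "support x \<subseteq> I" using S[OF x] by (auto simp: coord_space_iff_support)
      have cutI: "cut x \<in> coord_space I" using xI by (auto simp: coord_space_def cut_def)
      have lim: "limit_set (displaced_inter v (orthant I x) ?K) =
          (if \<forall>k\<in>T. 0 < v k * x k then orthant I (cut x) else {})"
        unfolding cut_def by (rule limit_displaced_orthant[OF I(1) TI vI v0 xI(1)])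
      have "pdim (orthant I (cut x)) + card I = pdim (orthant I x) + pdim ?K" if "\<forall>k\<in>T. 0 < v k * x k"
      proof -
        have "T \<subseteq> support x" using that by (auto simp: support_def)
        moreover have "finite T" "finite (support x)" using TI xI(2) I(1) by (auto intro: finite_subset)
        moreover have "pdim ?K = card I - card T"
          using lin_coord_space[of "I - T"] dim_coord_space[of "I - T"] I(1) \<open>finite T\<close> TI
          by (simp add: pdim_def card_Diff_subset)
        ultimately show ?thesis
          using card_mono[of "support x" T] card_mono[OF I(1) TI]
          by (simp add: pdim_orthant I(1) xI(1) cutI supp_cut card_Diff_subset)
      qed
      moreover have "orthant I (cut x) \<noteq> {}" using self_in_orthant[OF I(1) cutI] by blast
      ultimately show ?thesis unfolding lim by auto
    qed
    show ?thesis unfolding stable_pairs_def facets facets' using * by blast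
  qed
  have wt_value: "(\<Sum>(\<sigma>, \<sigma>') \<in> stable_pairs I v \<Delta> \<Delta>' (orthant I z).
      wt \<Delta> \<sigma> * wt \<Delta>' \<sigma>' * lattice_index (int_lattice I) (lat I \<sigma> + lat I \<sigma>')) = w (support z \<union> T)"
    if z: "support z \<in> contraction \<S> T" for z
  proof -
    obtain S where S': "S \<in> \<S>" "T \<subseteq> S" "support z = S - T" using z by (auto simp: contraction_def)
    \<comment> \<open>the only facet, up to the choice of an interior point, that is cut down to the orthant of \<open>z\<close>\<close>
    define x where "x = (\<lambda>k. if k \<in> T then v k else z k)"
    have supp_x: "support x = support z \<union> T"
      using v0 S'(3) by (auto simp: x_def support_def)
    then have xS: "support x \<in> \<S>" using S' by (simp add: Un_absorb2)
    have xI: "x \<in> coord_space I" "support x \<subseteq> I" using S[OF xS] by (auto simp: coord_space_iff_support)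
    have zI: "z \<in> coord_space I" using S[OF S'(1)] S'(3) by (auto simp: coord_space_iff_support)
    have "z k = 0" if "k \<in> T" for k using S'(3) that unfolding support_def by blast
    then have cut_x: "cut x = z" by (auto simp: cut_def x_def)
    have pos: "0 < v k * x k" if "k \<in> T" for k using v0[OF that] that by (auto simp: x_def zero_less_mult_iff neq_iff)
    have uniq: "orthant I y = orthant I x"
      if y: "support y \<in> \<S>" "\<forall>k\<in>T. 0 < v k * y k" "orthant I z = orthant I (cut y)" for y
    proof (rule orthant_cong[OF I(1)])
      fix k assume "k \<in> I"
      have "cut y \<in> coord_space I" using S[OF y(1)] by (auto simp: coord_space_iff_support supp_cut)
      from sgn_eq_of_orthant_eq[OF I(1) y(3) zI this, of k]
      show "sgn (y k) = sgn (x k)"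
        using y(2) by (cases "k \<in> T") (auto simp: cut_def x_def sgn_if zero_less_mult_iff)
    qed
    have "stable_pairs I v \<Delta> \<Delta>' (orthant I z) = {(orthant I x, ?K)}"
    proof (intro subset_antisym subsetI)
      fix p assume "p \<in> stable_pairs I v \<Delta> \<Delta>' (orthant I z)"
      then obtain \<sigma> \<sigma>' where p: "p = (\<sigma>, \<sigma>')" "(\<sigma>, \<sigma>') \<in> stable_pairs I v \<Delta> \<Delta>' (orthant I z)"
        by (cases p) blast
      from p(2) obtain y where "support y \<in> \<S>" "\<forall>k\<in>T. 0 < v k * y k" "\<sigma> = orthant I y"
        "\<sigma>' = ?K" "orthant I z = orthant I (cut y)" unfolding pairs by blast
      then show "p \<in> {(orthant I x, ?K)}" using uniq[of y] p(1) by blast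
    next
      fix p assume "p \<in> {(orthant I x, ?K)}"
      moreover have "(orthant I x, ?K) \<in> stable_pairs I v \<Delta> \<Delta>' (orthant I z)"
        unfolding pairs using xS pos cut_x by blast
      ultimately show "p \<in> stable_pairs I v \<Delta> \<Delta>' (orthant I z)" by blast
    qed
    moreover have "lattice_index (int_lattice I) (lat I (orthant I x) + lat I ?K) = 1"
    proof (rule lattice_index_coordinate)
      show "support x \<union> (I - T) = I" using supp_x xI(2) by blast
      show "lin (orthant I x) = coord_space (support x)" by (rule lin_orthant[OF I(1) xI(1)])
      show "lin ?K = ?K" using I(1) by (intro lin_coord_space) simp
    qed
    ultimately show ?thesis by (simp add: wt[OF xS] cells'(2) supp_x)
  qed
  have "cells (stable_inter I \<Delta> \<Delta>') = coordinate_cells I (contraction \<S> T)"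
  proof -
    have c: "cells (stable_inter I \<Delta> \<Delta>') = {\<tau>. \<tau> \<noteq> {} \<and> (\<exists>\<rho>. stable_pairs I v \<Delta> \<Delta>' \<rho> \<noteq> {} \<and> \<tau> face_of \<rho>)}"
      by (simp add: stable_inter_def Let_def v_def)
    have ne: "stable_pairs I v \<Delta> \<Delta>' \<rho> \<noteq> {} \<longleftrightarrow>
        (\<exists>x. support x \<in> \<S> \<and> (\<forall>k\<in>T. 0 < v k * x k) \<and> \<rho> = orthant I (cut x))" for \<rho>
      using pairs[of _ _ \<rho>] by (metis (no_types, lifting) all_not_in_conv surj_pair)
    show ?thesis
    proof (intro Set.set_eqI iffI)
      fix \<tau> assume "\<tau> \<in> cells (stable_inter I \<Delta> \<Delta>')"
      then obtain x where x: "\<tau> \<noteq> {}" "support x \<in> \<S>" "\<forall>k\<in>T. 0 < v k * x k" "\<tau> face_of orthant I (cut x)"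
        unfolding c ne by blast
      obtain y where y: "y \<in> orthant I (cut x)" "\<tau> = orthant I y" using face_of_orthant[OF I(1) x(4,1)] .
      have "T \<subseteq> support x" using x(3) by (auto simp: support_def)
      then have "support x - T \<in> contraction \<S> T" using x(2) by (auto simp: contraction_def)
      moreover have "y \<in> coord_space (support x - T)"
        using support_orthant[OF I(1) y(1)] by (simp add: supp_cut coord_space_iff_support)
      ultimately show "\<tau> \<in> coordinate_cells I (contraction \<S> T)"
        unfolding coordinate_cells_def y(2) by blast
    next
      fix \<tau> assume "\<tau> \<in> coordinate_cells I (contraction \<S> T)"
      then obtain S y where y: "S \<in> \<S>" "T \<subseteq> S" "y \<in> coord_space (S - T)" "\<tau> = orthant I y"
        by (auto simp: coordinate_cells_def contraction_def)
      define x where "x = (\<lambda>k. if k \<in> T then v k else if k \<in> S then if y k = 0 then 1 else y k else 0)"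
      have "support x = S" using v0 y(2) by (auto simp: x_def support_def)
      moreover have "0 < v k * x k" if "k \<in> T" for k using v0[OF that] that by (auto simp: x_def zero_less_mult_iff neq_iff)
      moreover have SI: "S \<subseteq> I" using S[OF y(1)] by blast
      then have yI: "y \<in> coord_space I" using y(3) by (auto simp: coord_space_def)
      have "y \<in> orthant I (cut x)"
        using yI y(3) by (auto simp: orthant_iff[OF I(1)] cut_def x_def coord_space_def)
      then have "\<tau> face_of orthant I (cut x)" unfolding y(4) by (rule orthant_face[OF I(1)])
      moreover have "\<tau> \<noteq> {}" unfolding y(4) using self_in_orthant[OF I(1) yI] by blast
      ultimately show "\<tau> \<in> cells (stable_inter I \<Delta> \<Delta>')" unfolding c ne using y(1) by blast
    qed
  qed
  then show ?thesis
    using wt_value unfolding is_coordinate_fan_def by (simp add: stable_inter_def Let_def v_def[symmetric])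
qed

lemma generic_displacementI:
  assumes "generic_displacement I \<Delta> \<Delta>' v0"
  obtains v where "v = (SOME v. generic_displacement I \<Delta> \<Delta>' v)" "generic_displacement I \<Delta> \<Delta>' v"
  using assms someI[of "generic_displacement I \<Delta> \<Delta>'"] by blast

lemma stable_inter_whole_space:
  assumes I: "finite I" "T \<subseteq> I"
    and \<Delta>: "is_coordinate_subspace I {} \<Delta>" and \<Delta>': "is_coordinate_subspace I T \<Delta>'"
  shows "is_coordinate_subspace I T (stable_inter I \<Delta> \<Delta>')"
proof -
  let ?K = "coord_space (I - T)"
  have cells: "cells \<Delta> = {coord_space I}" "wt \<Delta> (coord_space I) = 1"
    "cells \<Delta>' = {?K}" "wt \<Delta>' ?K = 1"
    using \<Delta> \<Delta>' by (simp_all add: is_coordinate_subspace_def)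
  have lins: "lin (coord_space I) = coord_space I" "lin ?K = ?K"
    using I(1) by (simp_all add: lin_coord_space)
  have gen0: "generic_displacement I \<Delta> \<Delta>' 0"
    unfolding generic_displacement_def cells
  proof (intro conjI always_eventually allI ballI impI)
    show "0 \<in> coord_space I" by (rule subspace_0) simp
    fix \<sigma> \<sigma>' assume "\<sigma> \<in> {coord_space I}" "\<sigma>' \<in> {?K}"
    then have "\<sigma> = coord_space I" "\<sigma>' = ?K" by blast+
    then show "lin \<sigma> + lin \<sigma>' = coord_space I"
      by (simp only: lins coord_space_sum Un_Diff_cancel2 Un_absorb2 Diff_subset)
  qed
  obtain v where v: "v = (SOME v. generic_displacement I \<Delta> \<Delta>' v)" "generic_displacement I \<Delta> \<Delta>' v"
    by (rule generic_displacementI[OF gen0])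
  have vI: "v \<in> coord_space I" using v(2) unfolding generic_displacement_def by blast
  have D: "p \<in> displaced_inter v (coord_space I) ?K \<epsilon> \<longleftrightarrow> p \<in> coord_space I \<and> (\<forall>k\<in>T. p k = \<epsilon> * v k)" for p \<epsilon>
    by (rule displaced_inter_coord[OF I(2) vI order_refl])
  have lim: "limit_set (displaced_inter v (coord_space I) ?K) = ?K"
  proof (intro subset_antisym subsetI)
    fix z assume "z \<in> limit_set (displaced_inter v (coord_space I) ?K)"
    then obtain y where y: "\<forall>\<^sub>F \<epsilon> in at_right 0. y \<epsilon> \<in> displaced_inter v (coord_space I) ?K \<epsilon>" "(y \<longlongrightarrow> z) (at_right 0)"
      unfolding limit_set_def by blast
    have "z k = 0" if k: "k \<notin> I - T" for k
    proof -
      have "\<forall>\<^sub>F \<epsilon> in at_right 0. y \<epsilon> k = \<epsilon> * v k"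
        using y(1)
      proof (rule eventually_mono)
        fix \<epsilon> assume "y \<epsilon> \<in> displaced_inter v (coord_space I) ?K \<epsilon>"
        then have "y \<epsilon> \<in> coord_space I" "k \<in> T \<longrightarrow> y \<epsilon> k = \<epsilon> * v k" unfolding D by blast+
        then show "y \<epsilon> k = \<epsilon> * v k" using k vI by (cases "k \<in> T") (auto simp: coord_space_def)
      qed
      moreover have "((\<lambda>\<epsilon>. y \<epsilon> k) \<longlongrightarrow> z k) (at_right 0)" using y(2) by (simp add: tendsto_fun_iff)
      ultimately have "((\<lambda>\<epsilon>. \<epsilon> * v k) \<longlongrightarrow> z k) (at_right 0)" by (rule Lim_transform_eventually[rotated])
      moreover have "((\<lambda>\<epsilon>::real. \<epsilon> * v k) \<longlongrightarrow> 0 * v k) (at_right 0)" by (intro tendsto_intros)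
      ultimately show ?thesis using tendsto_unique[OF trivial_limit_at_right_real] by fastforce
    qed
    then show "z \<in> ?K" unfolding coord_space_def by blast
  next
    fix z assume z: "z \<in> ?K"
    define y where "y \<epsilon> = z + \<epsilon> *\<^sub>R v" for \<epsilon>
    have "y \<epsilon> \<in> displaced_inter v (coord_space I) ?K \<epsilon>" for \<epsilon>
      unfolding D y_def using z vI by (auto simp: coord_space_def)
    moreover have "(y \<longlongrightarrow> z) (at_right 0)"
      unfolding tendsto_fun_iff
    proof
      fix k
      have "((\<lambda>\<epsilon>::real. z k + \<epsilon> * v k) \<longlongrightarrow> z k + 0 * v k) (at_right 0)" by (intro tendsto_intros)
      then show "((\<lambda>\<epsilon>. y \<epsilon> k) \<longlongrightarrow> z k) (at_right 0)" by (simp add: y_def)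
    qed
    ultimately show "z \<in> limit_set (displaced_inter v (coord_space I) ?K)"
      unfolding limit_set_def using always_eventually by blast
  qed
  have zero: "0 \<in> ?K" by (rule subspace_0) simp
  have facets: "facets \<Delta> = {coord_space I}" "facets \<Delta>' = {?K}"
    using cells by (simp_all add: single_cell_facets)
  have pd: "pdim (coord_space I) = card I" using I(1) lins by (simp add: pdim_def dim_coord_space)
  have pairs: "stable_pairs I v \<Delta> \<Delta>' \<rho> = (if \<rho> = ?K then {(coord_space I, ?K)} else {})" for \<rho>
    unfolding stable_pairs_def facets using lim zero pd by auto
  have "cells (stable_inter I \<Delta> \<Delta>') = {\<tau>. \<tau> \<noteq> {} \<and> \<tau> face_of ?K}"
    using pairs by (simp add: stable_inter_def Let_def v(1)[symmetric])
  also have "\<dots> = {?K}"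
  proof -
    have "?K face_of ?K" using subspace_imp_convex[OF subspace_coord_space] by (rule face_of_refl)
    then show ?thesis using face_of_coord_space[of "I - T"] I(1) zero by blast
  qed
  finally have "cells (stable_inter I \<Delta> \<Delta>') = {?K}" .
  moreover have "wt (stable_inter I \<Delta> \<Delta>') ?K = 1"
    using pairs[of ?K] cells lattice_index_coordinate[of I "I - T" I "coord_space I" ?K] lins
    by (simp add: stable_inter_def Let_def v(1)[symmetric] Un_absorb2)
  ultimately show ?thesis by (simp add: is_coordinate_subspace_def)
qed

text \<open>A generic displacement has \<open>v i \<noteq> 0\<close> and makes the two copies of the hyperplane parallel and disjoint.\<close>

lemma stable_self_intersection_hyperplane:
  assumes I: "finite I" "i \<in> I"
    and \<Delta>: "is_coordinate_subspace I {i} \<Delta>" and \<Delta>': "is_coordinate_subspace I {i} \<Delta>'"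
  shows "cells (stable_inter I \<Delta> \<Delta>') = {}"
proof -
  let ?K = "coord_space (I - {i})"
  have cells: "cells \<Delta> = {?K}" "cells \<Delta>' = {?K}" using \<Delta> \<Delta>' by (simp_all add: is_coordinate_subspace_def)
  have sub: "{i} \<subseteq> I" "?K \<subseteq> coord_space I" using I(2) coord_space_mono[of "I - {i}" I] by auto
  have D: "p \<in> displaced_inter v ?K ?K \<epsilon> \<longleftrightarrow> p \<in> ?K \<and> p i = \<epsilon> * v i" if "v \<in> coord_space I" for v p \<epsilon>
    using displaced_inter_coord[OF sub(1) that sub(2)] by simp
  have empty: "displaced_inter v ?K ?K \<epsilon> = {}" if "v \<in> coord_space I" "v i \<noteq> 0" "0 < \<epsilon>" for v \<epsilon>
    using D[OF that(1)] that(2,3) by (auto simp: coord_space_def)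
  have ui: "unit i \<in> coord_space I" "unit i i \<noteq> 0" using I by (simp, simp add: unit_def)
  have "\<forall>\<^sub>F \<epsilon> in at_right 0. \<forall>\<sigma> \<in> cells \<Delta>. \<forall>\<sigma>' \<in> cells \<Delta>'.
       displaced_inter (unit i) \<sigma> \<sigma>' \<epsilon> \<noteq> {} \<longrightarrow> lin \<sigma> + lin \<sigma>' = coord_space I"
    using eventually_at_right_less[of 0]
  proof (rule eventually_mono, intro ballI impI)
    fix \<epsilon> :: real and \<sigma> \<sigma>'
    assume "0 < \<epsilon>" "\<sigma> \<in> cells \<Delta>" "\<sigma>' \<in> cells \<Delta>'" "displaced_inter (unit i) \<sigma> \<sigma>' \<epsilon> \<noteq> {}"
    then have False using empty[OF ui] unfolding cells by blast
    then show "lin \<sigma> + lin \<sigma>' = coord_space I" ..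
  qed
  then have gen0: "generic_displacement I \<Delta> \<Delta>' (unit i)"
    unfolding generic_displacement_def using ui(1) by blast
  obtain v where v: "v = (SOME v. generic_displacement I \<Delta> \<Delta>' v)" "generic_displacement I \<Delta> \<Delta>' v"
    by (rule generic_displacementI[OF gen0])
  have vI: "v \<in> coord_space I" using v(2) unfolding generic_displacement_def by blast
  have zero: "0 \<in> ?K" by (rule subspace_0) simp
  have vi: "v i \<noteq> 0"
  proof (rule generic_displacement_nonzero[OF I v(2) _ zero])
    show "?K \<in> cells \<Delta>" "?K \<in> cells \<Delta>'" using cells by simp_all
    show "lin ?K \<subseteq> ?K" using lin_coord_space[of "I - {i}"] I(1) by simp
  qed
  have "limit_set (displaced_inter v ?K ?K) = {}"
  proof (rule ccontr)
    assume "limit_set (displaced_inter v ?K ?K) \<noteq> {}"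
    then obtain y where "\<forall>\<^sub>F \<epsilon> in at_right 0. y \<epsilon> \<in> displaced_inter v ?K ?K \<epsilon>"
      unfolding limit_set_def by blast
    then have "\<forall>\<^sub>F \<epsilon> in at_right (0::real). 0 < \<epsilon> \<and> y \<epsilon> \<in> displaced_inter v ?K ?K \<epsilon>"
      using eventually_at_right_less by (rule eventually_elim2) simp
    then obtain \<epsilon> :: real where "0 < \<epsilon>" "y \<epsilon> \<in> displaced_inter v ?K ?K \<epsilon>"
      using eventually_happens'[OF trivial_limit_at_right_real] by blast
    then show False using empty[OF vI vi] by blast
  qed
  then have "stable_pairs I v \<Delta> \<Delta>' \<rho> = {}" for \<rho>
    unfolding stable_pairs_def single_cell_facets[OF cells(1)] single_cell_facets[OF cells(2)] by blast
  then show ?thesis by (simp add: stable_inter_def Let_def v(1)[symmetric])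
qed

lemma stable_power_hyperplane:
  assumes I: "finite I" "i \<in> I" and \<Delta>: "is_coordinate_subspace I {i} \<Delta>"
  shows "is_coordinate_subspace I {} (stable_power I \<Delta> 0)"
    and "is_coordinate_subspace I {i} (stable_power I \<Delta> 1)"
    and "cells (stable_power I \<Delta> 2) = {}"
proof -
  show 0: "is_coordinate_subspace I {} (stable_power I \<Delta> 0)"
    by (simp add: is_coordinate_subspace_def whole_space_def)
  show 1: "is_coordinate_subspace I {i} (stable_power I \<Delta> 1)"
    using stable_inter_whole_space[OF I(1) _ 0 \<Delta>] I(2) by simp
  show "cells (stable_power I \<Delta> 2) = {}"
    using stable_self_intersection_hyperplane[OF I 1 \<Delta>] by (simp add: numeral_2_eq_2)
qed

lemma contraction_contraction:
  assumes "T \<inter> T' = {}"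
  shows "contraction (contraction \<S> T) T' = contraction \<S> (T \<union> T')"
proof (intro subset_antisym subsetI)
  fix A assume "A \<in> contraction (contraction \<S> T) T'"
  then obtain S where "S \<in> \<S>" "T \<subseteq> S" "T' \<subseteq> S - T" "A = S - T - T'"
    unfolding contraction_def by blast
  then show "A \<in> contraction \<S> (T \<union> T')" unfolding contraction_def by blast
next
  fix A assume "A \<in> contraction \<S> (T \<union> T')"
  then obtain S where S: "S \<in> \<S>" "T \<union> T' \<subseteq> S" "A = S - (T \<union> T')" unfolding contraction_def by blast
  then have "S - T \<in> contraction \<S> T" "T' \<subseteq> S - T" "A = (S - T) - T'"
    using assms unfolding contraction_def by blast+
  then show "A \<in> contraction (contraction \<S> T) T'" unfolding contraction_def[of _ T'] by blast
qed

text \<open>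
  The factor for \<open>i\<close> is the hyperplane of the coordinate \<open>e i\<close> if \<open>t i = {e i}\<close>, and the whole space if
  \<open>t i = {}\<close>.  Successive contractions compose since the coordinates are distinct.
\<close>

lemma iterated_stable_inter:
  assumes I: "finite I" and e: "inj_on e (set is)" "e ` set is \<subseteq> I" and "distinct is"
    and S: "\<And>S. S \<in> \<S> \<Longrightarrow> S \<subseteq> I \<and> card S = d"
    and \<Delta>: "is_coordinate_fan I \<S> w \<Delta>"
    and D: "\<And>i. i \<in> set is \<Longrightarrow> t i \<subseteq> {e i} \<and> is_coordinate_subspace I (t i) (D i)"
  shows "is_coordinate_fan I (contraction \<S> (\<Union>(t ` set is))) (\<lambda>S. w (S \<union> \<Union>(t ` set is)))
    (foldl (\<lambda>\<Delta> i. stable_inter I \<Delta> (D i)) \<Delta> is)"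
  using e assms(4) D
proof (induction "is" rule: rev_induct)
  case Nil
  have "contraction \<S> {} = \<S>" by (auto simp: contraction_def)
  then show ?case using \<Delta> by simp
next
  case (snoc j js)
  let ?T = "\<Union>(t ` set js)"
  have t: "t i \<subseteq> {e i}" "is_coordinate_subspace I (t i) (D i)" if "i \<in> set (js @ [j])" for i
    using snoc.prems(4)[OF that] by blast+
  have eI: "e i \<in> I" if "i \<in> set (js @ [j])" for i using snoc.prems(2) that by blast
  have TI: "?T \<subseteq> I"
  proof
    fix k assume "k \<in> ?T"
    then obtain i where "i \<in> set js" "k \<in> t i" by blast
    then show "k \<in> I" using t(1)[of i] eI[of i] by auto
  qed
  have disj: "?T \<inter> t j = {}"
  proof -
    have "k \<notin> t j" if k: "i \<in> set js" "k \<in> t i" for k i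
    proof
      assume "k \<in> t j"
      then have "e i = e j" using t(1)[of i] t(1)[of j] k by auto
      then have "i = j" using inj_onD[OF snoc.prems(1)] k(1) by simp
      then show False using snoc.prems(3) k(1) by simp
    qed
    then show ?thesis by blast
  qed
  have IH: "is_coordinate_fan I (contraction \<S> ?T) (\<lambda>S. w (S \<union> ?T)) (foldl (\<lambda>\<Delta> i. stable_inter I \<Delta> (D i)) \<Delta> js)"
  proof (rule snoc.IH)
    show "inj_on e (set js)" using snoc.prems(1) by (rule inj_on_subset) auto
    show "e ` set js \<subseteq> I" using eI by auto
    show "distinct js" using snoc.prems(3) by simp
    show "t i \<subseteq> {e i} \<and> is_coordinate_subspace I (t i) (D i)" if "i \<in> set js" for i
      using snoc.prems(4)[of i] that by simp
  qed
  have card: "A \<subseteq> I \<and> card A = d - card ?T" if "A \<in> contraction \<S> ?T" for A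
    using that S I TI by (auto simp: contraction_def card_Diff_subset finite_subset)
  have "is_coordinate_fan I (contraction (contraction \<S> ?T) (t j)) (\<lambda>S. w ((S \<union> t j) \<union> ?T))
      (stable_inter I (foldl (\<lambda>\<Delta> i. stable_inter I \<Delta> (D i)) \<Delta> js) (D j))"
    using t[of j] eI[of j] by (intro stable_inter_coordinate_hyperplane[OF I _ _ card IH, of "t j" "e j"]) simp_all
  then show ?case
    unfolding contraction_contraction[OF disj] by (simp add: Un_ac)
qed

lemma iterated_stable_inter_empty:
  assumes "i \<in> set is" "cells (D i) = {}"
  shows "cells (foldl (\<lambda>\<Delta> i. stable_inter I \<Delta> (D i)) \<Delta> is) = {}"
  using assms(1)
proof (induction "is" rule: rev_induct)
  case (snoc j js)
  then have "facets (foldl (\<lambda>\<Delta> i. stable_inter I \<Delta> (D i)) \<Delta> js) = {} \<or> facets (D j) = {}"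
    using assms(2) empty_facets by (cases "i = j") auto
  then show ?case by (simp add: stable_inter_empty)
qed simp

lemma degree0_origin:
  assumes "finite I" "is_coordinate_fan I {{}} w \<Delta>"
  shows "degree0 \<Delta> = w {}"
proof -
  have "x = 0" if "x \<in> coord_space {}" for x :: "'a \<Rightarrow> real"
    using that by (auto simp: coord_space_def)
  moreover have zero: "0 \<in> coord_space J" for J :: "'a set" by (rule subspace_0) simp
  ultimately have "coordinate_cells I {{}} = {orthant I 0}"
    unfolding coordinate_cells_def by blast
  then have "cells \<Delta> = {orthant I 0}" using assms(2) unfolding is_coordinate_fan_def by (simp only:)
  then have "facets \<Delta> = {orthant I 0}" by (rule single_cell_facets)
  moreover have "support (0 :: 'a \<Rightarrow> real) = {}" by (simp add: support_def)
  then have "wt \<Delta> (orthant I 0) = w {}"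
    using assms(2) zero unfolding is_coordinate_fan_def by (metis singletonI)
  ultimately show ?thesis by (simp add: degree0_def)
qed

lemma degree0_empty: "cells \<Delta> = {} \<Longrightarrow> degree0 \<Delta> = 0"
  by (simp add: degree0_def facets_def)

section \<open>Weighted coordinate planes\<close>

definition coordinate_fan :: "'k set \<Rightarrow> 'k set set \<Rightarrow> ('k set \<Rightarrow> nat) \<Rightarrow> 'k wcomplex"
  where "coordinate_fan I \<S> w = subspace_fan I (unit ` I) (coord_space ` \<S>) (\<lambda>U. w {k. unit k \<in> U})"

lemma coordinate_fan_properties:
  assumes I: "finite I" and S: "\<S> \<noteq> {}" "\<And>S. S \<in> \<S> \<Longrightarrow> S \<subseteq> I \<and> card S = d" and w: "\<And>S. 0 < w S"
  shows "tropical_variety I d (coordinate_fan I \<S> w)"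
    and "supp (coordinate_fan I \<S> w) = \<Union>(coord_space ` \<S>)"
    and "is_coordinate_fan I \<S> w (coordinate_fan I \<S> w)"
    and "cdim (coordinate_fan I \<S> w) = d"
proof -
  interpret flat_arrangement I "unit ` I" "coord_space ` \<S>" d "\<lambda>U. w {k. unit k \<in> U}"
    by (rule coordinate_flat_arrangement[OF I S w])
  have \<Gamma>: "coordinate_fan I \<S> w = \<Gamma>" by (simp only: coordinate_fan_def)
  show "tropical_variety I d (coordinate_fan I \<S> w)" unfolding \<Gamma> by (rule tropical)
  show "supp (coordinate_fan I \<S> w) = \<Union>(coord_space ` \<S>)" unfolding \<Gamma> by (rule supp_eq)
  show "cdim (coordinate_fan I \<S> w) = d" unfolding \<Gamma> by (rule cdim_eq)
  have "wt \<Gamma> (orthant I x) = w (support x)" if "x \<in> coord_space I" for x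
    unfolding wt_eq lin_orthant[OF I that] by simp
  moreover have "cells \<Gamma> = coordinate_cells I \<S>"
    unfolding cells_eq coordinate_cells_def orthant_def ..
  ultimately show "is_coordinate_fan I \<S> w (coordinate_fan I \<S> w)"
    unfolding \<Gamma> is_coordinate_fan_def by blast
qed

text \<open>Quadrants in two coordinate planes are joined through a quadrant that contains one
  bounding ray of each.\<close>

lemma connected_coordinate_planes:
  assumes I: "finite I" and "2 \<le> card I" and w: "\<And>S. 0 < w S"
  shows "connected_codim_one (coordinate_fan I {S. S \<subseteq> I \<and> card S = 2} w)"
proof -
  let ?P = "{S. S \<subseteq> I \<and> card S = 2}"
  let ?G = "coordinate_fan I ?P w"
  obtain S where "S \<subseteq> I" "card S = 2" using obtain_subset_with_card_n[OF assms(2)] by metis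
  then have P: "?P \<noteq> {}" by blast
  have P2: "S \<in> ?P \<Longrightarrow> S \<subseteq> I \<and> card S = 2" for S by blast
  note props = coordinate_fan_properties[OF I P P2 w]
  have cells: "cells ?G = coordinate_cells I ?P" using props(3) by (simp only: is_coordinate_fan_def)
  have facets: "facets ?G = orthant I ` {x. support x \<in> ?P}"
    by (rule coordinate_facets[OF I _ cells]) blast
  define R where "R = {(\<alpha>, \<beta>). \<alpha> \<in> facets ?G \<and> \<beta> \<in> facets ?G \<and>
        (\<exists>\<tau> \<in> cells ?G. \<tau> face_of \<alpha> \<and> \<tau> face_of \<beta> \<and> pdim \<tau> + 1 = cdim ?G)}"
  have adj: "(orthant I x, orthant I y) \<in> R"
    if x: "support x \<in> ?P" and y: "support y \<in> ?P" and a: "a \<in> support x" "x a = y a" for x y a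
  proof -
    define r where "r = (\<lambda>k. if k = a then x a else 0)"
    have xI: "x \<in> coord_space I" "y \<in> coord_space I" using x y by (auto simp: coord_space_iff_support)
    have supp_r: "support r = {a}" using a(1) by (auto simp: r_def support_def)
    then have r_x: "r \<in> coord_space (support x)" using a(1) by (simp add: coord_space_iff_support)
    have rI: "r \<in> coord_space I" using a(1) x supp_r by (auto simp: coord_space_iff_support)
    have "r \<in> orthant I x" "r \<in> orthant I y"
      using rI a by (auto simp: orthant_iff[OF I] r_def support_def)
    then have "orthant I r face_of orthant I x" "orthant I r face_of orthant I y"
      using orthant_face[OF I] by blast+
    moreover have "orthant I r \<in> cells ?G"
      unfolding cells coordinate_cells_def using r_x x by blast
    moreover have "pdim (orthant I r) + 1 = cdim ?G"
      using props(4) by (simp add: pdim_orthant[OF I rI] supp_r)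
    ultimately show ?thesis unfolding R_def facets using x y by blast
  qed
  have "(orthant I x, orthant I y) \<in> R\<^sup>*" if x: "support x \<in> ?P" and y: "support y \<in> ?P" for x y
  proof -
    have "card (support x) = 2" "card (support y) = 2" using x y by blast+
    then obtain a b c where ab: "support x = {a, b}" "a \<noteq> b" and c: "c \<in> support y"
      by (metis card_2_iff insertI1)
    define a' where "a' = (if a = c then b else a)"
    have a': "a' \<in> support x" "a' \<noteq> c" using ab by (auto simp: a'_def)
    define z where "z = (\<lambda>k. if k = a' then x a' else if k = c then y c else 0)"
    have "support z = {a', c}" using a' c by (auto simp: z_def support_def)
    then have z: "support z \<in> ?P" using a' c x y by auto
    have "(orthant I x, orthant I z) \<in> R"
      by (rule adj[OF x z a'(1)]) (simp add: z_def)
    moreover have "(orthant I z, orthant I y) \<in> R"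
      by (rule adj[OF z y, of c]) (use a' c in \<open>simp_all add: z_def support_def\<close>)
    ultimately show ?thesis by (meson converse_rtrancl_into_rtrancl r_into_rtrancl)
  qed
  then have R: "\<forall>\<sigma>\<in>facets ?G. \<forall>\<sigma>'\<in>facets ?G. (\<sigma>, \<sigma>') \<in> R\<^sup>*"
    unfolding facets by (intro ballI) (elim imageE, simp only: mem_Collect_eq)
  show ?thesis unfolding connected_codim_one_def by (rule R[unfolded R_def])
qed

subsection \<open>The multidegrees\<close>

text \<open>The space \<open>coord_space {}\<close> consists of the origin.\<close>

definition point_divisor :: "nat wcomplex"
  where "point_divisor = \<lparr> cells = {coord_space {}}, wt = (\<lambda>_. 1) \<rparr>"

abbreviation line_blocks :: "nat \<Rightarrow> (nat \<times> nat) set"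
  where "line_blocks p \<equiv> blocks p (\<lambda>_. 1)"

lemma finite_line_blocks: "finite (line_blocks p)"
  by (simp add: blocks_def)

lemma card_line_blocks: "card (line_blocks p) = p"
  by (simp add: blocks_def)

lemma block_preimage_point:
  assumes "i \<in> {1..p}"
  shows "is_coordinate_subspace (line_blocks p) {(i, 1)} (block_preimage p (\<lambda>_. 1) i point_divisor)"
proof -
  have "{x \<in> coord_space (line_blocks p). block_proj i x \<in> coord_space {}} = coord_space (line_blocks p - {(i, 1)})"
    using assms by (auto simp: coord_space_def block_proj_def blocks_def)
  then show ?thesis by (simp add: is_coordinate_subspace_def block_preimage_def point_divisor_def)
qed

text \<open>
  Contracting both elements of \<open>{i, j}\<close> leaves only the plane of these two coordinates, as the origin
  with its weight.
\<close>

lemma multidegree_coordinate_planes: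
  assumes w: "\<And>S. 0 < w S"
    and \<Gamma>: "\<Gamma> = coordinate_fan (line_blocks p) {S. S \<subseteq> line_blocks p \<and> card S = 2} w"
    and i: "i \<in> {1..p}"
  shows "j \<in> {1..p} \<Longrightarrow> i \<noteq> j \<Longrightarrow> multidegree p (\<lambda>_. 1) \<Gamma> (\<lambda>_. point_divisor)
      (Poly_Mapping.single i 1 + Poly_Mapping.single j 1) = w {(i, 1), (j, 1)}"
    and "multidegree p (\<lambda>_. 1) \<Gamma> (\<lambda>_. point_divisor) (Poly_Mapping.single i 2) = 0"
proof -
  let ?I = "line_blocks p"
  let ?P = "{S. S \<subseteq> ?I \<and> card S = 2}"
  let ?H = "\<lambda>i. block_preimage p (\<lambda>_. 1) i point_divisor"
  have e: "(k, 1) \<in> ?I" if "k \<in> {1..p}" for k using that by (simp add: blocks_def)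
  have set_upt: "set [1..<Suc p] = {1..p}" by auto
  note power = stable_power_hyperplane[OF finite_line_blocks e block_preimage_point]
  show "multidegree p (\<lambda>_. 1) \<Gamma> (\<lambda>_. point_divisor) (Poly_Mapping.single i 2) = 0"
  proof -
    have "cells (stable_power ?I (?H i) (Poly_Mapping.lookup (Poly_Mapping.single i 2) i)) = {}"
      using power(3)[OF i i] by simp
    then show ?thesis
      unfolding multidegree_def using i set_upt
      by (intro degree0_empty iterated_stable_inter_empty[of i]) (simp_all only:)
  qed
  assume j: "j \<in> {1..p}" "i \<noteq> j"
  define n where "n = Poly_Mapping.single i (1::nat) + Poly_Mapping.single j 1"
  have n: "Poly_Mapping.lookup n k = (if k = i \<or> k = j then 1 else 0)" for k
    using j(2) by (simp add: n_def lookup_add lookup_single when_def)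
  define t where "t k = (if k = i \<or> k = j then {(k, 1 :: nat)} else {})" for k
  have "is_coordinate_subspace ?I (t k) (stable_power ?I (?H k) (Poly_Mapping.lookup n k))"
    if k: "k \<in> {1..p}" for k
    using power(1,2)[OF k k] by (simp add: n t_def)
  then have D: "t k \<subseteq> {(k, 1)} \<and> is_coordinate_subspace ?I (t k) (stable_power ?I (?H k) (Poly_Mapping.lookup n k))"
    if "k \<in> set [1..<Suc p]" for k
    using that unfolding set_upt by (simp add: t_def)
  let ?T = "{(i, 1), (j, 1)} :: (nat \<times> nat) set"
  have T: "\<Union>(t ` set [1..<Suc p]) = ?T"
    unfolding set_upt using i j by (auto simp: t_def split: if_splits)
  have TP: "?T \<in> ?P" using j(2) e[OF i] e[OF j(1)] by simp
  have "?P \<noteq> {}" using TP by blast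
  then have "is_coordinate_fan ?I ?P w \<Gamma>"
    unfolding \<Gamma> by (intro coordinate_fan_properties(3) finite_line_blocks w) blast+
  then have fan: "is_coordinate_fan ?I (contraction ?P (\<Union>(t ` set [1..<Suc p]))) (\<lambda>S. w (S \<union> \<Union>(t ` set [1..<Suc p])))
      (foldl (\<lambda>\<Delta> k. stable_inter ?I \<Delta> (stable_power ?I (?H k) (Poly_Mapping.lookup n k))) \<Gamma> [1..<Suc p])"
    using D e by (intro iterated_stable_inter[where e = "\<lambda>k. (k, 1)" and d = 2] finite_line_blocks)
      (auto simp: inj_on_def)
  have contr: "contraction ?P ?T = {{}}"
  proof (intro subset_antisym subsetI)
    fix A assume "A \<in> contraction ?P ?T"
    then obtain S where S: "S \<in> ?P" "?T \<subseteq> S" "A = S - ?T" unfolding contraction_def by blast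
    have "finite S" using S(1) finite_line_blocks by (auto intro: finite_subset)
    then have "S = ?T" using S(1,2) TP card_seteq[of S ?T] by simp
    then show "A \<in> {{}}" using S(3) by simp
  next
    fix A :: "(nat \<times> nat) set" assume "A \<in> {{}}"
    then have "A = ?T - ?T" by simp
    then show "A \<in> contraction ?P ?T" unfolding contraction_def using TP by blast
  qed
  show "multidegree p (\<lambda>_. 1) \<Gamma> (\<lambda>_. point_divisor)
      (Poly_Mapping.single i 1 + Poly_Mapping.single j 1) = w ?T"
    using degree0_origin[OF finite_line_blocks fan[unfolded T contr]]
    unfolding multidegree_def n_def by simp
qed

section \<open>A point on the line is a positive divisor\<close>

lemma sum_fun_apply: "(\<Sum>x\<in>A. f x) k = (\<Sum>x\<in>A. f x k)" for f :: "'b \<Rightarrow> 'k \<Rightarrow> real"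
  by (induction A rule: infinite_finite_induct) auto

lemma line_eqI:
  assumes "x \<in> coord_space {l}" "y \<in> coord_space {l}" "x l = y l"
  shows "x = y"
proof
  fix k show "x k = y k" using assms by (cases "k = l") (auto simp: coord_space_def)
qed

lemma polyhedron_coord: "rational_polyhedron I P \<Longrightarrow> P \<subseteq> coord_space I"
  by (auto simp: rational_polyhedron_def)

lemma convex_polyhedron:
  assumes "rational_polyhedron I P"
  shows "convex P"
proof -
  obtain H where P: "P = {x \<in> coord_space I. \<forall>(u, c) \<in> H. pairing I u x \<le> c}"
    using assms unfolding rational_polyhedron_def pairing_def by blast
  show ?thesis
    unfolding convex_def
  proof (intro ballI allI impI)
    fix x y and s t :: real assume xy: "x \<in> P" "y \<in> P" and st: "0 \<le> s" "0 \<le> t" "s + t = 1"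
    have "pairing I u (s *\<^sub>R x + t *\<^sub>R y) \<le> c" if "(u, c) \<in> H" for u c
    proof -
      have "pairing I u x \<le> c" "pairing I u y \<le> c" using xy that P by blast+
      then have "s * pairing I u x + t * pairing I u y \<le> c"
        by (rule convex_bound_le) (use st in auto)
      then show ?thesis by (simp only: pairing_simps)
    qed
    moreover have "s *\<^sub>R x + t *\<^sub>R y \<in> coord_space I"
      using xy P by (intro subspace_add subspace_scale) auto
    ultimately show "s *\<^sub>R x + t *\<^sub>R y \<in> P" unfolding P by blast
  qed
qed

lemma closed_polyhedron_on_line:
  assumes "rational_polyhedron I P" "p \<in> coord_space I" "q \<in> coord_space I"
  shows "closed {r. p + r *\<^sub>R q \<in> P}"
proof -
  obtain H where P: "P = {x \<in> coord_space I. \<forall>(u, c) \<in> H. pairing I u x \<le> c}"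
    using assms unfolding rational_polyhedron_def pairing_def by blast
  have "p + r *\<^sub>R q \<in> coord_space I" for r
    using assms by (intro subspace_add subspace_scale) auto
  then have "{r. p + r *\<^sub>R q \<in> P} = (\<Inter>(u, c)\<in>H. {r. pairing I u p + r * pairing I u q \<le> c})"
    unfolding P by (auto simp: pairing_simps)
  also have "closed \<dots>"
    by (intro closed_INT ballI) (auto intro!: closed_Collect_le continuous_intros)
  finally show ?thesis .
qed

lemma unit_in_lin:
  assumes "x \<in> P" "y \<in> P" "x l \<noteq> y l" "P \<subseteq> coord_space {l}"
  shows "unit l \<in> lin P"
proof -
  have "x - y \<in> lin P" unfolding lin_def using assms by (intro span_base) blast
  then have "inverse (x l - y l) *\<^sub>R (x - y) \<in> lin P" unfolding lin_def by (rule span_scale)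
  moreover have "inverse (x l - y l) *\<^sub>R (x - y) = unit l"
  proof (rule line_eqI)
    show "inverse (x l - y l) *\<^sub>R (x - y) \<in> coord_space {l}"
      using assms by (intro subspace_scale subspace_diff) auto
    show "(inverse (x l - y l) *\<^sub>R (x - y)) l = unit l l" using assms(3) by (simp add: unit_def)
  qed simp
  ultimately show ?thesis by (simp only:)
qed

lemma lin_eq_line:
  assumes "unit l \<in> lin P" "P \<subseteq> coord_space {l}"
  shows "lin P = coord_space {l}"
proof (rule antisym)
  show "lin P \<subseteq> coord_space {l}"
    unfolding lin_def using assms(2) by (intro span_minimal) (auto intro!: subspace_diff)
  show "coord_space {l} \<subseteq> lin P"
    unfolding coord_space_span[of "{l}", simplified] lin_def
    using assms(1) by (intro span_minimal) (auto simp: lin_def)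
qed

lemma lin_point: "lin {b} = coord_space {}"
proof (rule antisym)
  show "lin {b} \<subseteq> coord_space {}"
    unfolding lin_def by (rule span_minimal[OF _ subspace_coord_space]) (auto simp: coord_space_def)
  show "coord_space {} \<subseteq> lin {b}"
  proof
    fix x :: "'a \<Rightarrow> real" assume "x \<in> coord_space {}"
    then have "x = 0" by (auto simp: coord_space_def)
    then show "x \<in> lin {b}" unfolding lin_def by (simp only: span_zero)
  qed
qed

locale tropical_line =
  fixes l :: 'k and C :: "'k wcomplex"
  assumes tropical: "tropical_variety {l} 1 C"
begin

lemma complex: "polyhedral_complex {l} (cells C)" and cells_nonempty: "cells C \<noteq> {}"
  and facet_weight: "\<sigma> \<in> facets C \<Longrightarrow> 0 < wt C \<sigma>" and balanced: "balanced {l} C"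
  using tropical by (simp_all add: tropical_variety_def)

lemma cell: "rational_polyhedron {l} \<sigma>" "\<sigma> \<noteq> {}" "\<sigma> \<subseteq> coord_space {l}" "convex \<sigma>" if "\<sigma> \<in> cells C"
proof -
  show r: "rational_polyhedron {l} \<sigma>" "\<sigma> \<noteq> {}"
    using complex that by (simp_all add: polyhedral_complex_def)
  show "\<sigma> \<subseteq> coord_space {l}" by (rule polyhedron_coord[OF r(1)])
  show "convex \<sigma>" by (rule convex_polyhedron[OF r(1)])
qed

lemma face_cell: "\<sigma> \<in> cells C \<Longrightarrow> \<tau> face_of \<sigma> \<Longrightarrow> \<tau> \<noteq> {} \<Longrightarrow> \<tau> \<in> cells C"
  using complex[unfolded polyhedral_complex_def, THEN conjunct2, THEN conjunct2, THEN conjunct1] by blast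

lemma finite_cells: "finite (cells C)"
  by (rule complex[unfolded polyhedral_complex_def, THEN conjunct1])

lemma pdim_le: "\<sigma> \<in> cells C \<Longrightarrow> pdim \<sigma> \<le> 1"
proof -
  assume \<sigma>: "\<sigma> \<in> cells C"
  have "lin \<sigma> \<subseteq> coord_space {l}"
    unfolding lin_def using cell(3)[OF \<sigma>] by (intro span_minimal) (auto intro!: subspace_diff)
  moreover have "subspace (lin \<sigma>)" by (simp add: lin_def)
  ultimately have "lin \<sigma> = coord_space {l} \<or> dim (lin \<sigma>) < dim (coord_space {l} :: ('k \<Rightarrow> real) set)"
    using dim_less[of "{l}" "coord_space {l}" "lin \<sigma>"] by auto
  then show ?thesis unfolding pdim_def using dim_coord_space[of "{l}"] by auto
qed

lemma pdim_1: "\<sigma> \<in> cells C \<Longrightarrow> lin \<sigma> = coord_space {l} \<Longrightarrow> pdim \<sigma> = 1"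
  unfolding pdim_def using dim_coord_space[of "{l}"] by simp

lemma lin_of_pdim_1:
  assumes "\<sigma> \<in> cells C" "pdim \<sigma> = 1"
  shows "lin \<sigma> = coord_space {l}"
proof (rule ccontr)
  assume "lin \<sigma> \<noteq> coord_space {l}"
  moreover have "lin \<sigma> \<subseteq> coord_space {l}"
    unfolding lin_def using cell(3)[OF assms(1)] by (intro span_minimal) (auto intro!: subspace_diff)
  moreover have "subspace (lin \<sigma>)" by (simp add: lin_def)
  ultimately have "dim (lin \<sigma>) < dim (coord_space {l} :: ('k \<Rightarrow> real) set)"
    by (intro dim_less[of "{l}"]) auto
  then show False using assms(2) dim_coord_space[of "{l}"] by (simp add: pdim_def)
qed

lemma contained_in_facet:
  assumes "\<sigma> \<in> cells C"
  obtains \<sigma>' where "\<sigma>' \<in> cells C" "\<sigma> \<subseteq> \<sigma>'" "pdim \<sigma>' = 1"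
proof -
  have "\<exists>\<sigma>'\<in>cells C. \<sigma> \<subseteq> \<sigma>' \<and> pdim \<sigma>' = 1"
    using tropical assms by (simp add: tropical_variety_def)
  then show thesis using that by blast
qed

lemma cdim: "cdim C = 1"
proof -
  obtain \<sigma> where "\<sigma> \<in> cells C" using cells_nonempty by blast
  then obtain \<sigma>' where "\<sigma>' \<in> cells C" "pdim \<sigma>' = 1" using contained_in_facet by metis
  then have "1 \<in> pdim ` cells C" by force
  then show ?thesis unfolding cdim_def using finite_cells pdim_le by (intro Max_eqI) auto
qed

lemma facet_iff: "\<sigma> \<in> facets C \<longleftrightarrow> \<sigma> \<in> cells C \<and> pdim \<sigma> = 1"
  by (simp add: facets_def cdim)

text \<open>If the support missed \<open>p\<close>, the point \<open>b\<close> of the support nearest to \<open>p\<close> on one side would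
  be a vertex all of whose edges point away from \<open>p\<close>, which contradicts balancing there.\<close>

lemma support_is_line:
  assumes p: "p \<in> coord_space {l}"
  shows "p \<in> supp C"
proof (rule ccontr)
  assume "p \<notin> supp C"
  then have no: "p \<notin> \<sigma>" if "\<sigma> \<in> cells C" for \<sigma> using that unfolding supp_def by blast
  obtain \<sigma>0 q where q: "\<sigma>0 \<in> cells C" "q \<in> \<sigma>0" using cells_nonempty cell(2) by blast
  have qI: "q \<in> coord_space {l}" using q cell(3) by blast
  define s where "s = sgn (q l - p l)"
  have "q l \<noteq> p l" using line_eqI[OF qI p] no[OF q(1)] q(2) by blast
  then have s: "s * s = 1" "s * (q l - p l) > 0" by (auto simp: s_def sgn_if)
  define f where "f r = p + r *\<^sub>R (s *\<^sub>R unit l)" for r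
  define dist where "dist x = s * (x l - p l)" for x
  have su: "s *\<^sub>R unit l \<in> coord_space {l}" by (intro subspace_scale) auto
  have f_eq: "x = f (dist x)" if "x \<in> coord_space {l}" for x
  proof (rule line_eqI[OF that])
    show "f (dist x) \<in> coord_space {l}" unfolding f_def using p su by (intro subspace_add subspace_scale) auto
    have "dist x * s = x l - p l" using s(1) by (simp add: dist_def mult_ac)
    then show "x l = f (dist x) l" by (simp add: f_def unit_def)
  qed
  define R where "R = {r. 0 \<le> r \<and> (\<exists>\<sigma>\<in>cells C. f r \<in> \<sigma>)}"
  have "R = {0..} \<inter> (\<Union>\<sigma>\<in>cells C. {r. f r \<in> \<sigma>})" unfolding R_def by auto
  moreover have "closed {r. f r \<in> \<sigma>}" if "\<sigma> \<in> cells C" for \<sigma>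
    unfolding f_def by (rule closed_polyhedron_on_line[OF cell(1)[OF that] p su])
  ultimately have "closed R" using finite_cells by (auto intro!: closed_Int closed_UN)
  moreover have "dist q \<in> R"
    unfolding R_def using s(2) q f_eq[OF qI] by (auto simp: dist_def)
  moreover have "bdd_below R" by (rule bdd_belowI[of _ 0]) (simp add: R_def)
  ultimately have r0R: "Inf R \<in> R" by (intro closed_contains_Inf) auto
  define r0 where "r0 = Inf R"
  \<comment> \<open>the point of the support nearest to \<open>p\<close> on the side of \<open>q\<close>\<close>
  define b where "b = f r0"
  obtain \<sigma>1 where \<sigma>1: "\<sigma>1 \<in> cells C" "b \<in> \<sigma>1" and "0 \<le> r0"
    using r0R unfolding R_def b_def r0_def by blast
  have "f 0 = p" by (simp add: f_def)
  then have "r0 \<noteq> 0" using no[OF \<sigma>1(1)] \<sigma>1(2) unfolding b_def by metis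
  then have r0: "0 < r0" using \<open>0 \<le> r0\<close> by simp
  have least: "r0 \<le> r" if "r \<in> R" for r
    unfolding r0_def using that \<open>bdd_below R\<close> by (rule cInf_lower)
  have bI: "b \<in> coord_space {l}" using \<sigma>1 cell(3) by blast
  have dist_b: "dist b = r0" using s(1) by (simp add: dist_def b_def f_def unit_def mult_ac)
  have far: "r0 \<le> dist x" if \<sigma>: "\<sigma> \<in> cells C" "b \<in> \<sigma>" and x: "x \<in> \<sigma>" for \<sigma> x
  proof (rule ccontr)
    assume less: "\<not> r0 \<le> dist x"
    have xI: "x \<in> coord_space {l}" using x cell(3)[OF \<sigma>(1)] by blast
    show False
    proof (cases "0 \<le> dist x")
      case True
      then have "dist x \<in> R" unfolding R_def using f_eq[OF xI] x \<sigma>(1) by auto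
      then show False using least less by blast
    next
      case False
      define t where "t = r0 / (r0 - dist x)"
      have t: "0 \<le> t" "0 \<le> 1 - t" using False r0 by (auto simp: t_def divide_simps)
      have "(1 - t) *\<^sub>R b + t *\<^sub>R x \<in> \<sigma>"
        using convexD[OF cell(4)[OF \<sigma>(1)] \<sigma>(2) x t(2,1)] by simp
      moreover have "(1 - t) *\<^sub>R b + t *\<^sub>R x = p"
      proof (rule line_eqI[OF _ p])
        show "(1 - t) *\<^sub>R b + t *\<^sub>R x \<in> coord_space {l}"
          using bI xI by (intro subspace_add subspace_scale) auto
        have "t * (r0 - dist x) = r0" using False r0 by (simp add: t_def)
        then have "(1 - t) * dist b + t * dist x = 0" unfolding dist_b by (simp add: algebra_simps)
        then have "s * ((1 - t) * b l + t * x l - p l) = 0" by (simp add: dist_def algebra_simps)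
        then show "((1 - t) *\<^sub>R b + t *\<^sub>R x) l = p l" using s(1) by auto
      qed
      ultimately show False using no[OF \<sigma>(1)] by metis
    qed
  qed
  obtain \<sigma>2 where \<sigma>2: "\<sigma>2 \<in> cells C" "b \<in> \<sigma>2" "pdim \<sigma>2 = 1" using contained_in_facet[OF \<sigma>1(1)] \<sigma>1(2) by blast
  have "{b} face_of \<sigma>2"
    unfolding face_of_singleton extreme_point_of_def
  proof (intro conjI \<sigma>2(2) ballI notI)
    fix x y assume xy: "x \<in> \<sigma>2" "y \<in> \<sigma>2" and "b \<in> open_segment x y"
    then obtain t where t: "x \<noteq> y" "0 < t" "t < 1" "b = (1 - t) *\<^sub>R x + t *\<^sub>R y" by (auto simp: in_segment)
    have bl: "b l = (1 - t) * x l + t * y l" using t(4) by simp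
    have "dist b = (1 - t) * dist x + t * dist y" unfolding dist_def bl by (simp add: algebra_simps)
    then have eq: "(1 - t) * (dist x - r0) + t * (dist y - r0) = 0" unfolding dist_b by (simp add: algebra_simps)
    have ge: "0 \<le> (1 - t) * (dist x - r0)" "0 \<le> t * (dist y - r0)"
      using far[OF \<sigma>2(1,2)] xy t(2,3) by auto
    then have "(1 - t) * (dist x - r0) = 0" "t * (dist y - r0) = 0" using eq by linarith+
    then have "dist x = dist y" using t(2,3) by auto
    then have "x = y" using f_eq xy cell(3)[OF \<sigma>2(1)] by (metis subsetD)
    then show False using t(1) by blast
  qed
  then have b_cell: "{b} \<in> cells C"
    using face_cell[OF \<sigma>2(1)] by simp
  have lin_b: "w l = 0" if "w \<in> lin {b}" for w
    using that unfolding lin_point by (simp add: coord_space_def)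
  have "pdim {b} + 1 = cdim C" unfolding pdim_def lin_point cdim by (simp add: dim_coord_space)
  then obtain v where v: "\<And>\<sigma>. \<sigma> \<in> facets C \<Longrightarrow> {b} \<subseteq> \<sigma> \<Longrightarrow> primitive_generator {l} \<sigma> {b} (v \<sigma>)"
    and sum: "(\<Sum>\<sigma> | \<sigma> \<in> facets C \<and> {b} \<subseteq> \<sigma>. real (wt C \<sigma>) *\<^sub>R v \<sigma>) \<in> lin {b}"
    using bspec[OF balanced[unfolded balanced_def] b_cell] by blast
  have pos: "0 < real (wt C \<sigma>) * (s * v \<sigma> l)" if \<sigma>: "\<sigma> \<in> facets C" "{b} \<subseteq> \<sigma>" for \<sigma>
  proof -
    have cells: "\<sigma> \<in> cells C" "b \<in> \<sigma>" "pdim \<sigma> = 1" using \<sigma> facet_iff by auto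
    note prim = v[OF \<sigma>]
    obtain x c where x: "x \<in> \<sigma>" "0 < c" "x - b - c *\<^sub>R v \<sigma> \<in> lin {b}"
      using prim unfolding primitive_generator_def by blast
    have "dist x - dist b = s * (x l - b l)" by (simp add: dist_def algebra_simps)
    also have "x l - b l = c * v \<sigma> l" using lin_b[OF x(3)] by simp
    finally have "dist x - dist b = c * (s * v \<sigma> l)" by simp
    then have "0 \<le> c * (s * v \<sigma> l)" using far[OF cells(1,2) x(1)] dist_b by simp
    then have "0 \<le> s * v \<sigma> l" using x(2) by (simp add: zero_le_mult_iff)
    moreover have "v \<sigma> l \<noteq> 0"
    proof
      assume v0: "v \<sigma> l = 0"
      have "unit l \<in> lat {l} \<sigma>" unfolding lat_def lin_of_pdim_1[OF cells(1,3)] by simp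
      then obtain z w where "unit l = of_int z *\<^sub>R v \<sigma> + w" "w \<in> lat {l} {b}"
        using prim unfolding primitive_generator_def by blast
      then have "unit l l = of_int z * v \<sigma> l + w l" "w l = 0" using lin_b by (auto simp: lat_def)
      then show False using v0 by (simp add: unit_def)
    qed
    moreover have "s \<noteq> 0" using s(1) by auto
    ultimately have "0 < s * v \<sigma> l" by (simp add: less_le)
    moreover have "0 < wt C \<sigma>" by (rule facet_weight[OF \<sigma>(1)])
    ultimately show ?thesis by simp
  qed
  have "0 < (\<Sum>\<sigma> | \<sigma> \<in> facets C \<and> {b} \<subseteq> \<sigma>. real (wt C \<sigma>) * (s * v \<sigma> l))"
  proof (rule sum_pos)
    show "finite {\<sigma>. \<sigma> \<in> facets C \<and> {b} \<subseteq> \<sigma>}"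
      using finite_cells by (rule finite_subset[rotated]) (auto simp: facets_def)
    show "{\<sigma>. \<sigma> \<in> facets C \<and> {b} \<subseteq> \<sigma>} \<noteq> {}" using \<sigma>2 facet_iff by blast
  qed (use pos in blast)
  also have "\<dots> = s * (\<Sum>\<sigma> | \<sigma> \<in> facets C \<and> {b} \<subseteq> \<sigma>. real (wt C \<sigma>) *\<^sub>R v \<sigma>) l"
    by (simp add: sum_fun_apply sum_distrib_left mult_ac)
  also have "\<dots> = 0" using lin_b[OF sum] by simp
  finally show False by simp
qed

end

context tropical_line
begin

lemma line_in_lin:
  assumes "lin (coord_space {}) + lin \<sigma> = coord_space {l}"
  shows "unit l \<in> lin \<sigma>"
proof -
  have "unit l \<in> lin (coord_space {}) + lin \<sigma>" using assms by simp
  then obtain a b where ab: "unit l = a + b" "a \<in> lin (coord_space {})" "b \<in> lin \<sigma>"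
    by (rule set_plus_elim)
  have "a k = 0" for k using ab(2) lin_coord_space[of "{} :: 'k set"] by (simp add: coord_space_def)
  then have "unit l = b" unfolding ab(1) by (intro ext) simp
  then show ?thesis using ab(3) by (simp only:)
qed

lemma displaced_origin:
  "displaced_inter v (coord_space {}) \<sigma> \<epsilon> \<noteq> {} \<longleftrightarrow> - (\<epsilon> *\<^sub>R v) \<in> \<sigma>"
  "displaced_inter v (coord_space {}) \<sigma> \<epsilon> \<subseteq> coord_space {}"
  "- (\<epsilon> *\<^sub>R v) \<in> \<sigma> \<Longrightarrow> 0 \<in> displaced_inter v (coord_space {}) \<sigma> \<epsilon>"
proof -
  show sub: "displaced_inter v (coord_space {}) \<sigma> \<epsilon> \<subseteq> coord_space {}"
    unfolding displaced_inter_def by (rule Int_lower1)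
  have zero: "0 \<in> coord_space {}" by (rule subspace_0) simp
  show mem: "0 \<in> displaced_inter v (coord_space {}) \<sigma> \<epsilon>" if "- (\<epsilon> *\<^sub>R v) \<in> \<sigma>"
    unfolding displaced_inter_def
    using zero that by (intro IntI image_eqI[of _ _ "- (\<epsilon> *\<^sub>R v)"]) (simp_all only: add.left_inverse)
  have "- (\<epsilon> *\<^sub>R v) \<in> \<sigma>" if p: "p \<in> displaced_inter v (coord_space {}) \<sigma> \<epsilon>" for p
  proof -
    obtain x where x: "x \<in> \<sigma>" "p = x + \<epsilon> *\<^sub>R v" using p unfolding displaced_inter_def by blast
    have "p = 0" using subsetD[OF sub p] by (auto simp: coord_space_def)
    then have "x = - (\<epsilon> *\<^sub>R v)" using x(2) by (metis eq_neg_iff_add_eq_0)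
    then show ?thesis using x(1) by (simp only:)
  qed
  then show "displaced_inter v (coord_space {}) \<sigma> \<epsilon> \<noteq> {} \<longleftrightarrow> - (\<epsilon> *\<^sub>R v) \<in> \<sigma>" using mem by blast
qed

lemma generic_displacement_origin:
  assumes "cells \<Lambda> = {coord_space {}}"
  shows "generic_displacement {l} \<Lambda> C (unit l)"
proof -
  let ?Z = "coord_space {} :: ('k \<Rightarrow> real) set"
  have "\<forall>\<^sub>F \<epsilon> in at_right 0. - (\<epsilon> *\<^sub>R unit l) \<in> \<sigma> \<longrightarrow> lin ?Z + lin \<sigma> = coord_space {l}"
    if \<sigma>: "\<sigma> \<in> cells C" for \<sigma>
  proof (cases "unit l \<in> lin \<sigma>")
    case True
    have "lin ?Z + lin \<sigma> = coord_space {l}"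
      unfolding lin_eq_line[OF True cell(3)[OF \<sigma>]] using lin_coord_space[of "{} :: 'k set"]
      by (simp add: coord_space_sum)
    then show ?thesis by simp
  next
    case False
    have unique: "\<epsilon> = \<epsilon>'" if "- (\<epsilon> *\<^sub>R unit l) \<in> \<sigma>" "- (\<epsilon>' *\<^sub>R unit l) \<in> \<sigma>" for \<epsilon> \<epsilon>'
      using unit_in_lin[OF that, of l] False cell(3)[OF \<sigma>] by (auto simp: unit_def)
    show ?thesis
    proof (cases "\<exists>\<epsilon>0>0. - (\<epsilon>0 *\<^sub>R unit l) \<in> \<sigma>")
      case True
      then obtain \<epsilon>0 where "\<epsilon>0 > 0" "- (\<epsilon>0 *\<^sub>R unit l) \<in> \<sigma>" by blast
      then show ?thesis
        unfolding eventually_at_right_field using unique by (intro exI[of _ \<epsilon>0]) blast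
    next
      case False
      then show ?thesis using eventually_at_right_less[of 0] by (rule_tac eventually_mono) blast+
    qed
  qed
  then have "\<forall>\<^sub>F \<epsilon> in at_right 0. \<forall>\<sigma>\<in>cells C. - (\<epsilon> *\<^sub>R unit l) \<in> \<sigma> \<longrightarrow> lin ?Z + lin \<sigma> = coord_space {l}"
    using finite_cells by (intro eventually_ball_finite) blast+
  then show ?thesis
    unfolding generic_displacement_def assms displaced_origin(1)[symmetric] by simp
qed

text \<open>
  Since the curve covers the line, the displaced origin \<open>- \<epsilon> v\<close> remains in one edge of the
  curve for all small \<open>\<epsilon> > 0\<close>; this edge contributes its positive weight at the origin.
\<close>

lemma positive_degree_origin:
  assumes \<Lambda>: "cells \<Lambda> = {coord_space {}}" "0 < wt \<Lambda> (coord_space {})"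
  shows "0 < degree0 (stable_inter {l} \<Lambda> C)"
proof -
  let ?Z = "coord_space {} :: ('k \<Rightarrow> real) set"
  have lin_Z: "lin ?Z = ?Z" by (rule lin_coord_space) simp
  obtain v where v: "v = (SOME v. generic_displacement {l} \<Lambda> C v)" "generic_displacement {l} \<Lambda> C v"
    by (rule generic_displacementI[OF generic_displacement_origin[OF \<Lambda>(1)]])
  have vI: "v \<in> coord_space {l}" using v(2) unfolding generic_displacement_def by blast
  have gen: "\<forall>\<^sub>F \<epsilon> in at_right 0. \<forall>\<sigma>\<in>cells C. - (\<epsilon> *\<^sub>R v) \<in> \<sigma> \<longrightarrow> lin ?Z + lin \<sigma> = coord_space {l}"
    using v(2) by (simp add: generic_displacement_def \<Lambda>(1) displaced_origin(1))
  \<comment> \<open>Finitely many convex cells cover the segment from 0 in direction \<open>- v\<close>, so one of them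
    contains an initial piece of it.\<close>
  have cover: "\<exists>\<sigma>\<in>cells C. - (\<epsilon> *\<^sub>R v) \<in> \<sigma>" for \<epsilon>
  proof -
    have "- (\<epsilon> *\<^sub>R v) \<in> coord_space {l}" using vI by (intro subspace_neg subspace_scale) simp_all
    from support_is_line[OF this] show ?thesis unfolding supp_def by blast
  qed
  have "\<exists>\<^sub>F \<epsilon> in at_right (0::real). \<exists>\<sigma>\<in>cells C. - (\<epsilon> *\<^sub>R v) \<in> \<sigma>"
    using cover by (intro eventually_frequently trivial_limit_at_right_real) simp
  from frequently_bex_finite[OF finite_cells this]
  obtain \<sigma> where \<sigma>: "\<sigma> \<in> cells C" "\<exists>\<^sub>F \<epsilon> in at_right (0::real). - (\<epsilon> *\<^sub>R v) \<in> \<sigma>" by blast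
  have near: "\<exists>\<epsilon>. 0 < \<epsilon> \<and> \<epsilon> < \<delta> \<and> - (\<epsilon> *\<^sub>R v) \<in> \<sigma>" if "0 < \<delta>" for \<delta>
  proof (rule ccontr)
    assume "\<not> ?thesis"
    then have "\<forall>\<^sub>F \<epsilon> in at_right 0. \<not> - (\<epsilon> *\<^sub>R v) \<in> \<sigma>"
      unfolding eventually_at_right_field using that by (intro exI[of _ \<delta>]) blast
    then show False using \<sigma>(2) by (simp add: frequently_def)
  qed
  obtain \<epsilon>0 where \<epsilon>0: "0 < \<epsilon>0" "- (\<epsilon>0 *\<^sub>R v) \<in> \<sigma>" using near[of 1] by auto
  have "- (\<epsilon> *\<^sub>R v) \<in> \<sigma>" if \<epsilon>: "0 < \<epsilon>" "\<epsilon> < \<epsilon>0" for \<epsilon>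
  proof -
    obtain \<epsilon>1 where \<epsilon>1: "0 < \<epsilon>1" "\<epsilon>1 < \<epsilon>" "- (\<epsilon>1 *\<^sub>R v) \<in> \<sigma>" using near[OF \<epsilon>(1)] by blast
    define t where "t = (\<epsilon> - \<epsilon>1) / (\<epsilon>0 - \<epsilon>1)"
    have t: "0 \<le> t" "0 \<le> 1 - t" using \<epsilon> \<epsilon>1 by (auto simp: t_def divide_simps)
    have "(1 - t) *\<^sub>R - (\<epsilon>1 *\<^sub>R v) + t *\<^sub>R - (\<epsilon>0 *\<^sub>R v) \<in> \<sigma>"
      using convexD[OF cell(4)[OF \<sigma>(1)] \<epsilon>1(3) \<epsilon>0(2) t(2,1)] by simp
    moreover have "(1 - t) *\<^sub>R - (\<epsilon>1 *\<^sub>R v) + t *\<^sub>R - (\<epsilon>0 *\<^sub>R v) = - (\<epsilon> *\<^sub>R v)"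
    proof
      fix k
      have "t * (\<epsilon>0 - \<epsilon>1) = \<epsilon> - \<epsilon>1" using \<epsilon> \<epsilon>1 by (simp add: t_def)
      then have "(1 - t) * \<epsilon>1 + t * \<epsilon>0 = \<epsilon>" by (simp add: algebra_simps)
      then have "((1 - t) * \<epsilon>1 + t * \<epsilon>0) * v k = \<epsilon> * v k" by simp
      then show "((1 - t) *\<^sub>R - (\<epsilon>1 *\<^sub>R v) + t *\<^sub>R - (\<epsilon>0 *\<^sub>R v)) k = (- (\<epsilon> *\<^sub>R v)) k"
        by (simp add: algebra_simps)
    qed
    ultimately show ?thesis by (simp only:)
  qed
  then have eventually_in: "\<forall>\<^sub>F \<epsilon> in at_right 0. - (\<epsilon> *\<^sub>R v) \<in> \<sigma>"
    unfolding eventually_at_right_field using \<epsilon>0(1) by blast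
  have "\<forall>\<^sub>F \<epsilon> in at_right (0::real). lin ?Z + lin \<sigma> = coord_space {l}"
    using gen eventually_in by (rule eventually_elim2) (use \<sigma>(1) in blast)
  then have "lin ?Z + lin \<sigma> = coord_space {l}"
    using eventually_happens'[OF trivial_limit_at_right_real] by blast
  then have lin_\<sigma>: "lin \<sigma> = coord_space {l}" using lin_eq_line[OF line_in_lin cell(3)[OF \<sigma>(1)]] by blast
  then have pdim_\<sigma>: "pdim \<sigma> = 1" and facet: "\<sigma> \<in> facets C" using pdim_1[OF \<sigma>(1)] \<sigma>(1) facet_iff by blast+
  have lim_sub: "limit_set (displaced_inter v ?Z \<sigma>') \<subseteq> ?Z" for \<sigma>'
  proof
    fix x assume "x \<in> limit_set (displaced_inter v ?Z \<sigma>')"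
    then obtain y where y: "\<forall>\<^sub>F \<epsilon> in at_right 0. y \<epsilon> \<in> displaced_inter v ?Z \<sigma>' \<epsilon>" "(y \<longlongrightarrow> x) (at_right 0)"
      unfolding limit_set_def by blast
    have "x k = 0" for k
    proof -
      have "\<forall>\<^sub>F \<epsilon> in at_right 0. y \<epsilon> k = 0"
        using y(1)
      proof (rule eventually_mono)
        fix \<epsilon> assume "y \<epsilon> \<in> displaced_inter v ?Z \<sigma>' \<epsilon>"
        from subsetD[OF displaced_origin(2) this] show "y \<epsilon> k = 0" by (simp add: coord_space_def)
      qed
      moreover have "((\<lambda>\<epsilon>. y \<epsilon> k) \<longlongrightarrow> x k) (at_right 0)" using y(2) by (simp add: tendsto_fun_iff)
      ultimately have "((\<lambda>\<epsilon>. 0) \<longlongrightarrow> x k) (at_right (0::real))" by (rule Lim_transform_eventually[rotated])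
      then show ?thesis using tendsto_unique[OF trivial_limit_at_right_real _ tendsto_const] by blast
    qed
    then show "x \<in> ?Z" by (simp add: coord_space_def)
  qed
  have Z_zero: "x = 0" if "x \<in> ?Z" for x using that by (auto simp: coord_space_def)
  have zero_Z: "0 \<in> ?Z" by (rule subspace_0) simp
  have Z_single: "\<rho> = ?Z" if "\<rho> \<subseteq> ?Z" "\<rho> \<noteq> {}" for \<rho> using that Z_zero by blast
  have "0 \<in> limit_set (displaced_inter v ?Z \<sigma>)"
  proof -
    have "\<forall>\<^sub>F \<epsilon> in at_right 0. 0 \<in> displaced_inter v ?Z \<sigma> \<epsilon>"
      using eventually_in by (rule eventually_mono) (rule displaced_origin(3))
    moreover have "((\<lambda>_. 0) \<longlongrightarrow> (0 :: 'k \<Rightarrow> real)) (at_right (0::real))" by (rule tendsto_const)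
    ultimately show ?thesis unfolding limit_set_def by (intro CollectI exI[of _ "\<lambda>_. 0"] conjI)
  qed
  then have lim: "limit_set (displaced_inter v ?Z \<sigma>) = ?Z" using Z_single[OF lim_sub] by blast
  have facets_\<Lambda>: "facets \<Lambda> = {?Z}" by (rule single_cell_facets[OF \<Lambda>(1)])
  have pair: "(?Z, \<sigma>) \<in> stable_pairs {l} v \<Lambda> C ?Z"
    unfolding stable_pairs_def facets_\<Lambda> using facet lim zero_Z pdim_\<sigma> by auto
  have pair_Z: "\<rho> = ?Z" if \<rho>: "stable_pairs {l} v \<Lambda> C \<rho> \<noteq> {}" for \<rho>
  proof -
    obtain \<sigma>' where "\<rho> = limit_set (displaced_inter v ?Z \<sigma>')" "\<rho> \<noteq> {}"
      using \<rho> unfolding stable_pairs_def facets_\<Lambda> by blast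
    then show ?thesis using lim_sub Z_single by metis
  qed
  have "cells (stable_inter {l} \<Lambda> C) = {\<tau>. \<tau> \<noteq> {} \<and> (\<exists>\<rho>. stable_pairs {l} v \<Lambda> C \<rho> \<noteq> {} \<and> \<tau> face_of \<rho>)}"
    by (simp add: stable_inter_def Let_def v(1)[symmetric])
  also have "\<dots> = {?Z}"
  proof -
    have "?Z face_of ?Z" using subspace_imp_convex[OF subspace_coord_space] by (rule face_of_refl)
    moreover have "stable_pairs {l} v \<Lambda> C ?Z \<noteq> {}" using pair by blast
    moreover have "?Z \<noteq> {}" using zero_Z by blast
    moreover have "\<tau> = ?Z" if \<tau>: "\<tau> \<noteq> {} \<and> (\<exists>\<rho>. stable_pairs {l} v \<Lambda> C \<rho> \<noteq> {} \<and> \<tau> face_of \<rho>)" for \<tau>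
    proof -
      obtain \<rho> where \<rho>: "stable_pairs {l} v \<Lambda> C \<rho> \<noteq> {}" "\<tau> face_of \<rho>" using \<tau> by blast
      have "\<tau> face_of ?Z" using \<rho>(2) unfolding pair_Z[OF \<rho>(1)] .
      then show ?thesis using \<tau> by (intro face_of_coord_space) simp_all
    qed
    ultimately show ?thesis by (intro subset_antisym subsetI) (simp_all only: mem_Collect_eq singleton_iff, blast+)
  qed
  finally have "facets (stable_inter {l} \<Lambda> C) = {?Z}" by (rule single_cell_facets)
  then have "degree0 (stable_inter {l} \<Lambda> C) = wt (stable_inter {l} \<Lambda> C) ?Z" by (simp add: degree0_def)
  also have "\<dots> = (\<Sum>(\<sigma>, \<sigma>') \<in> stable_pairs {l} v \<Lambda> C ?Z.
      wt \<Lambda> \<sigma> * wt C \<sigma>' * lattice_index (int_lattice {l}) (lat {l} \<sigma> + lat {l} \<sigma>'))"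
    by (simp add: stable_inter_def Let_def v(1)[symmetric])
  also have "0 < \<dots>"
  proof (rule sum_pos2[OF _ pair])
    have "stable_pairs {l} v \<Lambda> C ?Z \<subseteq> facets \<Lambda> \<times> facets C" by (auto simp: stable_pairs_def)
    moreover have "finite (facets C)" using finite_cells by (simp add: facets_def)
    ultimately show "finite (stable_pairs {l} v \<Lambda> C ?Z)"
      by (elim finite_subset) (simp only: facets_\<Lambda> finite_cartesian_product finite.emptyI finite.insertI)
    have "lattice_index (int_lattice {l}) (lat {l} ?Z + lat {l} \<sigma>) = 1"
      by (rule lattice_index_coordinate[OF _ lin_Z lin_\<sigma>]) simp
    then show "0 < (case (?Z, \<sigma>) of (\<sigma>, \<sigma>') \<Rightarrow>
        wt \<Lambda> \<sigma> * wt C \<sigma>' * lattice_index (int_lattice {l}) (lat {l} \<sigma> + lat {l} \<sigma>'))"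
      using \<Lambda>(2) facet_weight[OF facet] by simp
  qed simp
  finally show ?thesis .
qed

end

lemma positive_point_divisor: "positive_divisor 1 point_divisor"
proof -
  have I: "{1..1::nat} = {1}" by simp
  interpret flat_arrangement "{1..1::nat}" "unit ` {1..1}" "coord_space ` {{}}" 0 "\<lambda>_. 1"
    by (rule coordinate_flat_arrangement) simp_all
  have "cells \<Gamma> = {coord_space {}}"
  proof -
    have "cone x = coord_space {}" if "x \<in> coord_space {}" for x
    proof -
      have "orthant {1..1} x = coord_space {}"
      proof (intro Set.set_eqI)
        fix y show "y \<in> orthant {1..1} x \<longleftrightarrow> y \<in> coord_space {}"
          using that by (auto simp: orthant_iff coord_space_def) metis
      qed
      then show ?thesis by (simp only: orthant_def)
    qed
    moreover have "(0 :: nat \<Rightarrow> real) \<in> coord_space {}" by (rule subspace_0) simp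
    ultimately show ?thesis unfolding cells_eq by blast
  qed
  then have "\<Gamma> = point_divisor"
    unfolding point_divisor_def subspace_fan_def by (simp only: wcomplex.simps)
  then have "tropical_variety {1..1} 0 point_divisor" using tropical by (simp only:)
  moreover have "0 < degree0 (stable_inter {1..1} point_divisor C)" if "tropical_variety {1..1} 1 C" for C
    unfolding I
    by (rule tropical_line.positive_degree_origin) (use that in \<open>simp_all only: I tropical_line.intro point_divisor_def wcomplex.simps zero_less_one\<close>)
  ultimately show ?thesis unfolding positive_divisor_def by auto
qed

section \<open>Two positive eigenvalues\<close>

lemma two_positive_eigenvalues:
  assumes A: "A \<in> carrier_mat n n" and ev: "eigenvalue A x" "eigenvalue A y" "x \<noteq> y" "0 < x" "0 < y"
  shows "2 \<le> num_positive_eigenvalues A"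
proof -
  let ?M = "filter_mset (\<lambda>x. 0 < x) (proots (char_poly A))"
  have "char_poly A \<noteq> 0" using degree_monic_char_poly[OF A] by auto
  then have mem: "x \<in># ?M" "y \<in># ?M"
    using ev eigenvalue_root_char_poly[OF A] by simp_all
  then obtain M' where M': "?M = add_mset x M'" by (metis mset_add)
  then have "y \<in># M'" using mem(2) ev(3) by auto
  then obtain M'' where "M' = add_mset y M''" by (metis mset_add)
  then show ?thesis unfolding num_positive_eigenvalues_def M' by simp
qed

text \<open>
  With weight \<open>a\<close> on two complementary planes and \<open>b\<close> on the others, the eigenvalues of the quadratic
  form are \<open>a + 2 * b\<close>, \<open>a - 2 * b\<close> and \<open>- a\<close> twice.  Any \<open>a > 2 * b > 0\<close> would do.
\<close>

definition example_weight :: "(nat \<times> nat) set \<Rightarrow> nat"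
  where "example_weight S = (if S \<in> {{(1, 1), (2, 1)}, {(3, 1), (4, 1)}} then 3 else 1)"

definition example_fan :: "(nat \<times> nat) wcomplex"
  where "example_fan = coordinate_fan (line_blocks 4) {S. S \<subseteq> line_blocks 4 \<and> card S = 2} example_weight"

definition example_matrix :: "real Matrix.mat"
  where "example_matrix = Matrix.mat 4 4 (\<lambda>(i, j).
    if i = j then 0 else if {i, j} \<in> {{0, 1}, {2, 3}} then 3 else 1)"

lemma example_weight_eq:
  assumes "a < 4" "b < 4" "a \<noteq> b"
  shows "example_weight {(Suc a, 1), (Suc b, 1)} = (if {a, b} \<in> {{0, 1}, {2, 3}} then 3 else 1)"
proof -
  have "a \<in> {0, 1, 2, 3}" "b \<in> {0, 1, 2, 3}" using assms by auto
  then show ?thesis using assms(3) by (auto simp: example_weight_def doubleton_eq_iff)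
qed

lemma example_quadratic_form:
  "quadratic_form_mat 4 (tvol 4 (\<lambda>_. 1) 2 example_fan (\<lambda>_. point_divisor)) = example_matrix"
proof (rule eq_matI)
  fix a b assume "a < dim_row example_matrix" "b < dim_col example_matrix"
  then have ab: "a < 4" "b < 4" by (simp_all add: example_matrix_def)
  let ?n = "Poly_Mapping.single (Suc a) (1::nat) + Poly_Mapping.single (Suc b) 1"
  let ?h = "tvol 4 (\<lambda>_. 1) 2 example_fan (\<lambda>_. point_divisor)"
  have ab': "Suc a \<in> {1..4}" "Suc b \<in> {1..4}" using ab by auto
  have w: "0 < example_weight S" for S by (simp add: example_weight_def)
  note deg = multidegree_coordinate_planes[OF w example_fan_def ab'(1)]
  have "?n \<in> exponents 4 2"
  proof -
    have "Poly_Mapping.keys ?n \<subseteq> {1..4}"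
      using ab' Poly_Mapping.keys_add[of "Poly_Mapping.single (Suc a) (1::nat)" "Poly_Mapping.single (Suc b) 1"] by auto
    moreover have "(\<Sum>i=1..4. Poly_Mapping.lookup ?n i) = 2"
      using ab' by (simp add: lookup_add lookup_single when_def sum.distrib)
    ultimately show ?thesis by (simp add: exponents_def)
  qed
  then have h: "Poly_Mapping.lookup ?h ?n = fact 2 / (\<Prod>i=1..4. fact (Poly_Mapping.lookup ?n i))
      * real (multidegree 4 (\<lambda>_. 1) example_fan (\<lambda>_. point_divisor) ?n)"
    by (simp only: lookup_tvol if_True)
  have "Poly_Mapping.lookup ?h ?n / (if a = b then 1 else 2) = example_matrix $$ (a, b)"
  proof (cases "a = b")
    case True
    then have "?n = Poly_Mapping.single (Suc a) 2" by (simp only: single_add[symmetric] one_add_one)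
    then have "Poly_Mapping.lookup ?h ?n = 0" using deg(2) h by simp
    then show ?thesis using True ab by (simp add: example_matrix_def)
  next
    case False
    have "fact (Poly_Mapping.lookup ?n i) = (1::real)" for i
      using False by (simp add: lookup_add lookup_single when_def)
    then have "Poly_Mapping.lookup ?h ?n = 2 * real (example_weight {(Suc a, 1), (Suc b, 1)})"
      using deg(1)[OF ab'(2)] False h by simp
    then show ?thesis using False ab example_weight_eq[OF ab False] by (simp add: example_matrix_def)
  qed
  then show "quadratic_form_mat 4 ?h $$ (a, b) = example_matrix $$ (a, b)"
    using ab by (simp add: quadratic_form_mat_def)
qed (simp_all add: quadratic_form_mat_def example_matrix_def)

lemma example_eigenvalues: "eigenvalue example_matrix 5" "eigenvalue example_matrix 1"
proof -
  have less: "i < 4 \<longleftrightarrow> i = 0 \<or> i = 1 \<or> i = 2 \<or> i = 3" for i :: nat by auto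
  have four: "{0..<4} = {0, 1, 2, 3 :: nat}" by auto
  let ?one = "Matrix.vec 4 (\<lambda>_. 1 :: real)" and ?diff = "Matrix.vec 4 (\<lambda>i. if i < 2 then 1 else - 1 :: real)"
  have "example_matrix *\<^sub>v ?one = 5 \<cdot>\<^sub>v ?one"
    by (rule eq_vecI) (auto simp: example_matrix_def scalar_prod_def four less doubleton_eq_iff)
  moreover have "?one \<noteq> 0\<^sub>v 4"
  proof
    assume "?one = 0\<^sub>v 4"
    then have "?one $ 0 = 0\<^sub>v 4 $ 0" by (simp only:)
    then show False by simp
  qed
  ultimately show "eigenvalue example_matrix 5"
    unfolding eigenvalue_def eigenvector_def by (intro exI[of _ ?one]) (simp add: example_matrix_def)
  have "example_matrix *\<^sub>v ?diff = 1 \<cdot>\<^sub>v ?diff"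
    by (rule eq_vecI) (auto simp: example_matrix_def scalar_prod_def four less doubleton_eq_iff)
  moreover have "?diff \<noteq> 0\<^sub>v 4"
  proof
    assume "?diff = 0\<^sub>v 4"
    then have "?diff $ 0 = 0\<^sub>v 4 $ 0" by (simp only:)
    then show False by simp
  qed
  ultimately show "eigenvalue example_matrix 1"
    unfolding eigenvalue_def eigenvector_def by (intro exI[of _ ?diff]) (simp add: example_matrix_def)
qed

theorem proposition4p3:
  shows "\<exists>(p::nat) (m :: nat \<Rightarrow> nat) (d::nat) (\<Gamma> :: (nat \<times> nat) wcomplex) (\<Lambda> :: nat \<Rightarrow> nat wcomplex).
    p \<ge> 1 \<and> (\<forall>i\<in>{1..p}. m i \<ge> 1) \<and>
    tropical_variety (blocks p m) d \<Gamma> \<and>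
    translation_admissible (blocks p m) \<Gamma> \<and>
    connected_codim_one \<Gamma> \<and>
    (\<forall>i\<in>{1..p}. positive_divisor (m i) (\<Lambda> i)) \<and>
    \<not> lorentzian p d (tvol p m d \<Gamma> \<Lambda>)"
proof -
  let ?I = "line_blocks 4"
  let ?P = "{S. S \<subseteq> ?I \<and> card S = 2}"
  have card: "2 \<le> card ?I" unfolding card_line_blocks by simp
  obtain S where "S \<subseteq> ?I" "card S = 2" using obtain_subset_with_card_n[OF card] by metis
  then have P: "?P \<noteq> {}" by blast
  have w: "0 < example_weight S" for S by (simp add: example_weight_def)
  have P2: "\<And>S. S \<in> ?P \<Longrightarrow> S \<subseteq> ?I \<and> card S = 2" by blast
  note props = coordinate_fan_properties[OF finite_line_blocks P P2 w]
  have tropical: "tropical_variety ?I 2 example_fan" unfolding example_fan_def by (rule props(1))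
  have "supp example_fan = \<Union>(coord_space ` ?P)" unfolding example_fan_def by (rule props(2))
  then have admissible: "translation_admissible ?I example_fan"
    by (rule translation_admissible_coordinate_planes[OF finite_line_blocks card])
  have connected: "connected_codim_one example_fan"
    unfolding example_fan_def by (rule connected_coordinate_planes[OF finite_line_blocks card w])
  have "\<not> lorentzian 4 2 (tvol 4 (\<lambda>_. 1) 2 example_fan (\<lambda>_. point_divisor))"
  proof
    assume L: "lorentzian 4 2 (tvol 4 (\<lambda>_. 1) 2 example_fan (\<lambda>_. point_divisor))"
    have "num_positive_eigenvalues (quadratic_form_mat 4
        (fold mpoly_deriv [] (tvol 4 (\<lambda>_. 1) 2 example_fan (\<lambda>_. point_divisor)))) \<le> 1"
      by (rule L[unfolded lorentzian_def, THEN conjunct2, THEN conjunct2, THEN conjunct2, rule_format]) simp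
    then have "num_positive_eigenvalues example_matrix \<le> 1"
      by (simp only: fold_simps example_quadratic_form)
    moreover have "2 \<le> num_positive_eigenvalues example_matrix"
      by (rule two_positive_eigenvalues[of _ 4, OF _ example_eigenvalues]) (simp_all add: example_matrix_def)
    ultimately show False by simp
  qed
  then show ?thesis
    using tropical admissible connected positive_point_divisor
    by (intro exI[of _ 4] exI[of _ "\<lambda>_. 1"] exI[of _ 2] exI[of _ example_fan] exI[of _ "\<lambda>_. point_divisor"]) simp
qed

end
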